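(* Let $V\hookrightarrow H\hookrightarrow V'$, $A:V\to V'$, $G:H\times Z\to H$, $\bar\mu$ and the constants $\alpha_0,\alpha_1,C_0,C_1,C_2,p$ satisfy the setting and standing assumptions listed in the context (evolution triple with compact embedding $V\hookrightarrow H$; demicontinuity, monotonicity, coercivity and growth), and let $(P_t)_{t\ge 0}$ be the Markovian semigroup on $B_b(H)$ associated with the equation $du(t)+Au(t)\,dt=\int_Z G(u(t-),z)\,\bar\mu(dt,dz)$. Let $\nu$ be an invariant measure for $P_t$. Then $$\int_H\big(|x|_H^2+|x|_V^p\big)\,\nu(dx)<\infty,$$ where $|x|_V:=+\infty$ for $x\in H\setminus V$.
   Context: Setting and standing assumptions. $(\Omega,\mathcal F,(\mathcal F_t)_{t\ge0},\mathbb P)$ is a filtered probability space satisfying the usual conditions, with expectation $\mathbb E$. $(Z,\mathcal Z,m)$ is a measure space with $m$ $\sigma$-finite, $\mu$ is a Poisson random measure on $\mathbb R_+\times Z$ with compensator $\mathrm{Leb}\otimes m$, and $\bar\mu:=\mu-\mathrm{Leb}\otimes m$. $H$ is a real separable Hilbert space; $V$ is a reflexive Banach space with dual $V'$, with $V\hookrightarrow H\hookrightarrow V'$ dense and continuous ($H$ identified with its dual); $V$ and $V'$ are strictly convex, and the embedding $V\hookrightarrow H$ is compact. $\langle\cdot,\cdot\rangle$ denotes both the duality between $V$ and $V'$ and the inner product of $H$. $G:H\times Z\to H$ is measurable with $|G(x,\cdot)|_m^2:=\int_Z|G(x,z)|_H^2\,m(dz)<\infty$ for all $x\in H$; likewise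 $|G(x,\cdot)-G(y,\cdot)|_m^2:=\int_Z|G(x,z)-G(y,z)|_H^2\,m(dz)$. $A:V\to V'$ is demicontinuous (if $x_n\to x$ strongly in $V$ then $Ax_n\rightharpoonup Ax$ weakly in $V'$), and there are constants $\alpha_0\ge0$, $\alpha_1>0$, $C_0,C_1>0$, $C_2\in\mathbb R$, $p>2$ such that for all $x,y\in V$: (monotonicity) $2\langle Ax-Ay,x-y\rangle-|G(x,\cdot)-G(y,\cdot)|_m^2\ge0$; (coercivity) $2\langle Ax,x\rangle-|G(x,\cdot)|_m^2+\alpha_0|x|_H^2\ge\alpha_1|x|_V^p-C_0$; (growth) $|Ax|_{V'}\le C_1|x|_V^{p-1}+C_2$. Equation and semigroup. For $x\in H$, let $u(\cdot,x)$ be the unique strong solution of $du(t)+Au(t)\,dt=\int_Z G(u(t-),z)\,\bar\mu(dt,dz)$, $u(0)=x$, i.e. the unique adapted process, c\`adl\`ag in $H$, with $u(t)\in V$ a.s. for a.a. $t$, $\mathbb E\sup_{t\le T}|u(t)|_H^2+\mathbb E\int_0^T|u(t)|_V^p\,dt<\infty$ for all $T$, satisfying the integrated equation in $V'$ (existence, uniqueness and the Markov property are known, due to Gy\"ongy). $B_b(H)$ is the space of bounded Borel functions $H\to\mathbb R$, and $P_t\phi(x):=\mathbb E\phi(u(t,x))$ for $\phi\in B_b(H)$; $(P_t)$ is a Feller Markovian semigroup. An invariant measure for $P_t$ is a Borel probability measure $\nu$ on $H$ with $\int_H P_t\phi\,d\nu=\int_H\phi\,d\nu$ for all $t\ge0$,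 $\phi\in B_b(H)$. *)

theory Defs
  imports "HOL-Probability.Probability"
begin

section \<open>Evolution triples\<close>

text \<open>
  The embedding of \<open>V\<close> into \<open>H\<close> is an explicit map \<open>i\<close>; the dual \<open>V'\<close> is the type
  \<open>'v \<Rightarrow>\<^sub>L real\<close>, and the duality pairing of \<open>f\<close> and \<open>v\<close> is the application \<open>f v\<close>.
\<close>

definition reflexive :: "'v::banach itself \<Rightarrow> bool" where
  "reflexive _ \<longleftrightarrow> (\<forall>\<xi> :: ('v \<Rightarrow>\<^sub>L real) \<Rightarrow>\<^sub>L real. \<exists>v. \<forall>f :: 'v \<Rightarrow>\<^sub>L real. blinfun_apply \<xi> f = blinfun_apply f v)"

definition strictly_convex :: "'v::real_normed_vector itself \<Rightarrow> bool" where
  "strictly_convex _ \<longleftrightarrow>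
     (\<forall>x y :: 'v. norm x = 1 \<longrightarrow> norm y = 1 \<longrightarrow> x \<noteq> y \<longrightarrow> norm ((1/2) *\<^sub>R (x + y)) < 1)"

definition dual_embed :: "('v::real_normed_vector \<Rightarrow> 'h::real_inner) \<Rightarrow> 'h \<Rightarrow> ('v \<Rightarrow>\<^sub>L real)" where
  "dual_embed i h = Blinfun (\<lambda>v. h \<bullet> i v)"

definition evolution_triple :: "('v::banach \<Rightarrow> 'h::{real_inner, banach}) \<Rightarrow> bool" where
  "evolution_triple i \<longleftrightarrow>
     bounded_linear i \<and> inj i \<and> closure (range i) = UNIV \<and>
     bounded_linear (dual_embed i) \<and> inj (dual_embed i) \<and> closure (range (dual_embed i)) = UNIV"

definition compact_map :: "('v::real_normed_vector \<Rightarrow> 'h::real_normed_vector) \<Rightarrow> bool" where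
  "compact_map i \<longleftrightarrow> compact (closure (i ` cball 0 1))"

text \<open>\<open>|x|\<^sub>V\<^sup>p\<close> for \<open>x \<in> H\<close>, with value \<open>\<infinity>\<close> outside \<open>V\<close>.\<close>

definition Vnorm_powr ::
    "('v::real_normed_vector \<Rightarrow> 'h) \<Rightarrow> real \<Rightarrow> 'h \<Rightarrow> ennreal" where
  "Vnorm_powr i p x = (if x \<in> range i then ennreal (norm (inv i x) powr p) else \<infinity>)"

text \<open>\<open>A\<close> as a function on \<open>H\<close>; the value \<open>0\<close> outside \<open>V\<close> is irrelevant, since solutions are in
  \<open>V\<close> for almost every time.\<close>

definition extend_op ::
    "('v::real_normed_vector \<Rightarrow> 'h) \<Rightarrow> ('v \<Rightarrow> ('v \<Rightarrow>\<^sub>L real)) \<Rightarrow> 'h \<Rightarrow> ('v \<Rightarrow>\<^sub>L real)" where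
  "extend_op i A x = (if x \<in> range i then A (inv i x) else 0)"

definition demicontinuous :: "('v::real_normed_vector \<Rightarrow> ('v \<Rightarrow>\<^sub>L real)) \<Rightarrow> bool" where
  "demicontinuous A \<longleftrightarrow>
     (\<forall>X x. X \<longlonglongrightarrow> x \<longrightarrow>
        (\<forall>\<xi> :: ('v \<Rightarrow>\<^sub>L real) \<Rightarrow>\<^sub>L real. (\<lambda>n. blinfun_apply \<xi> (A (X n))) \<longlonglongrightarrow> blinfun_apply \<xi> (A x)))"

definition msq :: "'z measure \<Rightarrow> ('z \<Rightarrow> 'h::real_normed_vector) \<Rightarrow> real" where
  "msq m g = (\<integral>z. (norm (g z))\<^sup>2 \<partial>m)"

text \<open>
  The Bochner integral for values in an arbitrary normed space. This is the definition of
  \<^const>\<open>has_bochner_integral\<close> without its sort constraint \<open>second_countable_topology\<close>, for which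
  \<open>'v \<Rightarrow>\<^sub>L real\<close> has no instance.
\<close>

definition has_bochner_integral_normed ::
    "'a measure \<Rightarrow> ('a \<Rightarrow> 'b::real_normed_vector) \<Rightarrow> 'b \<Rightarrow> bool" where
  "has_bochner_integral_normed M f I \<longleftrightarrow>
     f \<in> borel_measurable M \<and>
     (\<exists>s. (\<forall>n. Bochner_Integration.simple_bochner_integrable M (s n)) \<and>
          (\<lambda>n. \<integral>\<^sup>+x. ennreal (norm (f x - s n x)) \<partial>M) \<longlonglongrightarrow> 0 \<and>
          (\<lambda>n. Bochner_Integration.simple_bochner_integral M (s n)) \<longlonglongrightarrow> I)"

section \<open>Filtrations and processes\<close>

text \<open>Only times \<open>t \<ge> 0\<close> are relevant; nothing is required of \<open>F t\<close> or of a process for \<open>t < 0\<close>.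
  The condition on null sets makes \<open>P\<close> complete.\<close>

definition usual_filtration :: "'w measure \<Rightarrow> (real \<Rightarrow> 'w measure) \<Rightarrow> bool" where
  "usual_filtration P F \<longleftrightarrow>
     (\<forall>t\<ge>0. subalgebra P (F t)) \<and>
     (\<forall>s t. 0 \<le> s \<longrightarrow> s \<le> t \<longrightarrow> sets (F s) \<subseteq> sets (F t)) \<and>
     (\<forall>t\<ge>0. sets (F t) = (\<Inter>s\<in>{t<..}. sets (F s))) \<and>
     (\<forall>N\<in>null_sets P. \<forall>S. S \<subseteq> N \<longrightarrow> S \<in> sets (F 0))"

definition adapted :: "(real \<Rightarrow> 'w measure) \<Rightarrow> (real \<Rightarrow> 'w \<Rightarrow> 'h::topological_space) \<Rightarrow> bool" where
  "adapted F X \<longleftrightarrow> (\<forall>t\<ge>0. X t \<in> borel_measurable (F t))"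

definition cadlag :: "(real \<Rightarrow> 'h::topological_space) \<Rightarrow> bool" where
  "cadlag f \<longleftrightarrow>
     (\<forall>t\<ge>0. (f \<longlongrightarrow> f t) (at_right t)) \<and> (\<forall>t>0. \<exists>l. (f \<longlongrightarrow> l) (at_left t))"

definition left_limit :: "(real \<Rightarrow> 'h::t2_space) \<Rightarrow> real \<Rightarrow> 'h" where
  "left_limit f t = (if t \<le> 0 then f 0 else Lim (at_left t) f)"

definition predictable_algebra :: "'w measure \<Rightarrow> (real \<Rightarrow> 'w measure) \<Rightarrow> (real \<times> 'w) measure" where
  "predictable_algebra P F =
     sigma ({0..} \<times> space P)
       ({{0} \<times> S | S. S \<in> sets (F 0)} \<union>
        {{a<..b} \<times> S | a b S. 0 \<le> a \<and> a \<le> b \<and> S \<in> sets (F a)})"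

section \<open>Poisson random measures\<close>

definition intensity :: "'z measure \<Rightarrow> (real \<times> 'z) measure" where
  "intensity m = restrict_space lborel {0..} \<Otimes>\<^sub>M m"

text \<open>
  The last two conditions say that \<open>\<mu>\<close> is adapted to \<open>F\<close> and that its restriction to
  \<open>(t, \<infinity>) \<times> Z\<close> is independent of \<open>F t\<close>, so that \<open>intensity m\<close> is the compensator of \<open>\<mu>\<close>
  relative to \<open>F\<close>.
\<close>

definition poisson_random_measure ::
    "'w measure \<Rightarrow> (real \<Rightarrow> 'w measure) \<Rightarrow> 'z measure \<Rightarrow> ('w \<Rightarrow> (real \<times> 'z) measure) \<Rightarrow> bool" where
  "poisson_random_measure P F m \<mu> \<longleftrightarrow>
     (\<forall>\<omega>\<in>space P. sets (\<mu> \<omega>) = sets (intensity m) \<and>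
        (\<forall>X\<in>sets (intensity m). emeasure (\<mu> \<omega>) X \<in> insert \<infinity> (range of_nat))) \<and>
     (\<forall>X\<in>sets (intensity m). (\<lambda>\<omega>. emeasure (\<mu> \<omega>) X) \<in> borel_measurable P) \<and>
     (\<forall>X\<in>sets (intensity m). emeasure (intensity m) X < \<infinity> \<longrightarrow>
        (\<forall>k. measure P {\<omega>\<in>space P. emeasure (\<mu> \<omega>) X = of_nat k} =
             exp (- measure (intensity m) X) * measure (intensity m) X ^ k / fact k)) \<and>
     (\<forall>n::nat. \<forall>X. (\<forall>k<n. X k \<in> sets (intensity m)) \<longrightarrow> disjoint_family_on X {..<n} \<longrightarrow>
        prob_space.indep_vars P (\<lambda>_. borel) (\<lambda>k \<omega>. emeasure (\<mu> \<omega>) (X k)) {..<n}) \<and>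
     (\<forall>t\<ge>0. \<forall>X\<in>sets (intensity m). X \<subseteq> {0..t} \<times> space m \<longrightarrow>
        (\<lambda>\<omega>. emeasure (\<mu> \<omega>) X) \<in> borel_measurable (F t)) \<and>
     (\<forall>t\<ge>0. prob_space.indep_set P (sets (F t))
        (sigma_sets (space P)
          {(\<lambda>\<omega>. emeasure (\<mu> \<omega>) X) -` B \<inter> space P | X B.
             X \<in> sets (intensity m) \<and> X \<subseteq> {t<..} \<times> space m \<and> B \<in> sets borel}))"

definition compensated ::
    "'z measure \<Rightarrow> ('w \<Rightarrow> (real \<times> 'z) measure) \<Rightarrow> 'w \<Rightarrow> (real \<times> 'z) set \<Rightarrow> real" where
  "compensated m \<mu> \<omega> X = measure (\<mu> \<omega>) X - measure (intensity m) X"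

section \<open>The stochastic integral\<close>

text \<open>An entry \<open>(a, b, \<xi>, B)\<close> stands for the integrand
  \<open>(s, \<omega>, z) \<mapsto> 1\<^bsub>(a,b]\<^esub>(s) 1\<^bsub>B\<^esub>(z) \<xi>(\<omega>)\<close>, a list for the sum of its entries.\<close>

type_synonym ('w, 'h, 'z) elementary = "(real \<times> real \<times> ('w \<Rightarrow> 'h) \<times> 'z set) list"

definition elementary ::
    "'w measure \<Rightarrow> (real \<Rightarrow> 'w measure) \<Rightarrow> 'z measure \<Rightarrow>
     ('w, 'h::real_normed_vector, 'z) elementary \<Rightarrow> bool" where
  "elementary P F m es \<longleftrightarrow>
     (\<forall>(a, b, \<xi>, B) \<in> set es. 0 \<le> a \<and> a \<le> b \<and> \<xi> \<in> borel_measurable (F a) \<and>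
        bounded (\<xi> ` space P) \<and> B \<in> sets m \<and> emeasure m B < \<infinity>)"

definition elementary_fun ::
    "('w, 'h::real_normed_vector, 'z) elementary \<Rightarrow> real \<Rightarrow> 'w \<Rightarrow> 'z \<Rightarrow> 'h" where
  "elementary_fun es s \<omega> z =
     (\<Sum>(a, b, \<xi>, B)\<leftarrow>es. (indicator {a<..b} s * indicator B z :: real) *\<^sub>R \<xi> \<omega>)"

definition elementary_integral ::
    "'z measure \<Rightarrow> ('w \<Rightarrow> (real \<times> 'z) measure) \<Rightarrow>
     ('w, 'h::real_normed_vector, 'z) elementary \<Rightarrow> real \<Rightarrow> 'w \<Rightarrow> 'h" where
  "elementary_integral m \<mu> es t \<omega> =
     (\<Sum>(a, b, \<xi>, B)\<leftarrow>es. compensated m \<mu> \<omega> ({min a t<..min b t} \<times> B) *\<^sub>R \<xi> \<omega>)"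

text \<open>\<open>M t = \<integral>\<^sub>0\<^sup>t \<integral>\<^sub>Z \<Phi>(s, z) \<mu>\<^bsup>-\<^esup>(ds, dz)\<close> (with \<open>\<mu>\<^bsup>-\<^esup>\<close> the compensated measure), defined by
  isometric extension from elementary integrands to predictable integrands that are square
  integrable on \<open>[0, T] \<times> \<Omega> \<times> Z\<close> for every \<open>T\<close>.\<close>

definition has_stochastic_integral ::
    "'w measure \<Rightarrow> (real \<Rightarrow> 'w measure) \<Rightarrow> 'z measure \<Rightarrow> ('w \<Rightarrow> (real \<times> 'z) measure) \<Rightarrow>
     (real \<Rightarrow> 'w \<Rightarrow> 'z \<Rightarrow> 'h::{real_normed_vector, t2_space}) \<Rightarrow> (real \<Rightarrow> 'w \<Rightarrow> 'h) \<Rightarrow> bool" where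
  "has_stochastic_integral P F m \<mu> \<Phi> M \<longleftrightarrow>
     (\<lambda>((s, \<omega>), z). \<Phi> s \<omega> z) \<in> borel_measurable (predictable_algebra P F \<Otimes>\<^sub>M m) \<and>
     (\<forall>T\<ge>0. (\<integral>\<^sup>+\<omega>. (\<integral>\<^sup>+s\<in>{0..T}. (\<integral>\<^sup>+z. ennreal ((norm (\<Phi> s \<omega> z))\<^sup>2) \<partial>m) \<partial>lborel) \<partial>P) < \<infinity>) \<and>
     adapted F M \<and> (\<forall>\<omega>\<in>space P. cadlag (\<lambda>t. M t \<omega>)) \<and>
     (\<exists>es. (\<forall>n::nat. elementary P F m (es n)) \<and>
        (\<forall>T\<ge>0. (\<lambda>n. \<integral>\<^sup>+\<omega>. (\<integral>\<^sup>+s\<in>{0..T}. (\<integral>\<^sup>+z.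
            ennreal ((norm (\<Phi> s \<omega> z - elementary_fun (es n) s \<omega> z))\<^sup>2) \<partial>m) \<partial>lborel) \<partial>P)
          \<longlonglongrightarrow> 0) \<and>
        (\<forall>t\<ge>0. (\<lambda>n. \<integral>\<^sup>+\<omega>.
            ennreal ((norm (M t \<omega> - elementary_integral m \<mu> (es n) t \<omega>))\<^sup>2) \<partial>P)
          \<longlonglongrightarrow> 0))"

section \<open>Strong solutions, transition semigroup, invariant measures\<close>

definition strong_solution ::
    "'w measure \<Rightarrow> (real \<Rightarrow> 'w measure) \<Rightarrow> 'z measure \<Rightarrow> ('w \<Rightarrow> (real \<times> 'z) measure) \<Rightarrow>
     ('v::banach \<Rightarrow> 'h::{real_inner, banach, second_countable_topology}) \<Rightarrow> real \<Rightarrow>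
     ('v \<Rightarrow> ('v \<Rightarrow>\<^sub>L real)) \<Rightarrow> ('h \<Rightarrow> 'z \<Rightarrow> 'h) \<Rightarrow> 'h \<Rightarrow> (real \<Rightarrow> 'w \<Rightarrow> 'h) \<Rightarrow> bool" where
  "strong_solution P F m \<mu> i p A G x u \<longleftrightarrow>
     adapted F u \<and> (\<forall>\<omega>\<in>space P. cadlag (\<lambda>t. u t \<omega>)) \<and>
     (AE t in lborel. 0 \<le> t \<longrightarrow> (AE \<omega> in P. u t \<omega> \<in> range i)) \<and>
     (\<forall>T\<ge>0. (\<integral>\<^sup>+\<omega>. (SUP t\<in>{0..T}. ennreal ((norm (u t \<omega>))\<^sup>2)) \<partial>P) +
             (\<integral>\<^sup>+\<omega>. (\<integral>\<^sup>+t\<in>{0..T}. Vnorm_powr i p (u t \<omega>) \<partial>lborel) \<partial>P) < \<infinity>) \<and>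
     (AE \<omega> in P. u 0 \<omega> = x) \<and>
     (\<exists>M. has_stochastic_integral P F m \<mu> (\<lambda>s \<omega> z. G (left_limit (\<lambda>r. u r \<omega>) s) z) M \<and>
        (AE \<omega> in P. \<forall>t\<ge>0. \<exists>I.
           has_bochner_integral_normed (restrict_space lborel {0..t})
             (\<lambda>s. extend_op i A (u s \<omega>)) I \<and>
           dual_embed i (u t \<omega>) + I = dual_embed i x + dual_embed i (M t \<omega>)))"

definition bounded_borel :: "('h::topological_space \<Rightarrow> real) set" where
  "bounded_borel = {\<phi>. \<phi> \<in> borel_measurable borel \<and> bounded (range \<phi>)}"

definition transition ::
    "'w measure \<Rightarrow> ('h \<Rightarrow> real \<Rightarrow> 'w \<Rightarrow> 'h) \<Rightarrow> real \<Rightarrow> ('h \<Rightarrow> real) \<Rightarrow> 'h \<Rightarrow> real" where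
  "transition P u t \<phi> x = (\<integral>\<omega>. \<phi> (u x t \<omega>) \<partial>P)"

definition invariant_measure ::
    "(real \<Rightarrow> ('h::topological_space \<Rightarrow> real) \<Rightarrow> 'h \<Rightarrow> real) \<Rightarrow> 'h measure \<Rightarrow> bool" where
  "invariant_measure Pt \<nu> \<longleftrightarrow>
     prob_space \<nu> \<and> sets \<nu> = sets borel \<and>
     (\<forall>t\<ge>0. \<forall>\<phi>\<in>bounded_borel. (\<integral>x. Pt t \<phi> x \<partial>\<nu>) = (\<integral>x. \<phi> x \<partial>\<nu>))"

end

theory Submission
  imports Defs
begin

text \<open>
  Let \<open>M\<close> be the stochastic integral and \<open>t = r + h\<close>. Expanding the square of \<open>u t\<close> gives
  \<open>|u t|\<^sup>2 - |u r|\<^sup>2 \<le> - 2 \<integral>\<^sub>r\<^sup>t \<langle>A (u s), u t\<rangle> ds + 2 (u r, M t - M r) + |M t - M r|\<^sup>2\<close>. Taking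
  expectations, averaging over \<open>r \<in> [0, T]\<close> and letting \<open>h\<close> tend to \<open>0\<close> yields
  \<open>2 E \<integral>\<^sub>0\<^sup>T \<langle>A u, u\<rangle> ds \<le> K(x) + E \<integral>\<^sub>0\<^sup>T |G(u, \<cdot>)|\<^sub>m\<^sup>2 ds\<close>. Since \<open>p > 2\<close>, the term \<open>\<alpha>\<^sub>0 |u|\<^sub>H\<^sup>2\<close> of the
  coercivity condition is absorbed by \<open>|u|\<^sub>V\<^sup>p\<close>, so that
  \<open>E \<integral>\<^sub>0\<^sup>T (|u|\<^sub>H\<^sup>2 + |u|\<^sub>V\<^sup>p) ds \<le> K'(x) + C T\<close> with \<open>C\<close> independent of the initial value \<open>x\<close>.

  For bounded continuous \<open>0 \<le> \<psi> \<le> |x|\<^sub>H\<^sup>2 + |x|\<^sub>V\<^sup>p\<close>, the integral of \<open>\<psi>\<close> under \<open>\<nu>\<close> is that of the time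
  average of \<open>P\<^sub>t \<psi>\<close> over \<open>[0, T]\<close>, whose upper limit as \<open>T\<close> grows is at most \<open>C\<close> at every point; hence
  \<open>\<integral> \<psi> d\<nu> \<le> C\<close>. By reflexivity \<open>|x|\<^sub>V\<close> is a supremum of continuous functions on \<open>H\<close>, and the claim
  follows by monotone convergence.
\<close>

section \<open>Extension of linear functionals\<close>

text \<open>The limit \<open>h -> 0\<close> is the delicate point: \<open>u\<close> is
  right-continuous in the norm of \<open>H\<close> only, so a pairing of \<open>A u\<close> at one
  time with \<open>u\<close> slightly later need not converge pointwise. Time is therefore
  translated so that \<open>A u\<close> stays in place and only the window and the other factor
  move; \<open>A u\<close> is then replaced by values in \<open>H\<close>, with an error small in
  \<open>L^q(V')\<close>, \<open>q = p / (p - 1)\<close>, which Young's inequality controls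
  uniformly in the shift. The energy inequality must carry the integral of \<open>|G(u)|^2\<close>
  with constant exactly 1: coercivity contains the same term with coefficient -1, and the two
  cancel. Hence the stochastic integral is bounded with the sharp constant of the isometry. The
  constant \<open>K'(x)\<close> is not known to be integrable under \<open>\<nu>\<close>, so the
  ergodic step works with bounded test functions and dominated convergence. Hahn-Banach enters three
  times: to norm \<open>V\<close> by functionals, to separate a closed subspace (separability of
  \<open>V\<close>), and to extend a functional from \<open>H\<close> to \<open>V'\<close> so that
  reflexivity applies.\<close>

definition sublinear :: "('a::real_vector \<Rightarrow> real) \<Rightarrow> bool" where
  "sublinear q \<longleftrightarrow> (\<forall>x y. q (x + y) \<le> q x + q y) \<and> (\<forall>t>0. \<forall>x. q (t *\<^sub>R x) \<le> t * q x)"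

text \<open>The one-sided homogeneity of the definition is an equality, by applying it to
  \<open>t\<close> and to \<open>1 / t\<close>. Thus only inequalities have to be checked for the
  infima below.\<close>

lemma sublinearD:
  assumes "sublinear q"
  shows "q (x + y) \<le> q x + q y" "t \<ge> 0 \<Longrightarrow> q (t *\<^sub>R x) = t * q x" "q 0 = 0" "- q (- x) \<le> q x"
proof -
  show add: "q (x + y) \<le> q x + q y" for x y
    using assms by (simp add: sublinear_def)
  have le: "t > 0 \<Longrightarrow> q (t *\<^sub>R x) \<le> t * q x" for t x
    using assms by (simp add: sublinear_def)
  show zero: "q 0 = 0"
    using le[of 2 0] le[of "1/2" 0] by simp
  have eq: "q (t *\<^sub>R x) = t * q x" if "t > 0" for t x
    using le[of t x] le[of "1/t" "t *\<^sub>R x"] that by (simp add: field_simps)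
  show "q (t *\<^sub>R x) = t * q x" if "t \<ge> 0" for t x
    using eq[of t x] zero that by (cases "t = 0") auto
  show "- q (- x) \<le> q x"
    using add[of x "- x"] zero by simp
qed

text \<open>The index may change in both conditions, so the single members \<open>g a\<close> need
  not be sublinear. This covers three families: a chain of functionals, translates of one functional
  along a ray, and shifted multiples of the norm.\<close>

lemma sublinear_INF:
  assumes ne: "K \<noteq> {}"
    and bdd: "\<And>x. bdd_below ((\<lambda>a. g a x) ` K)"
    and add: "\<And>a b x y. a \<in> K \<Longrightarrow> b \<in> K \<Longrightarrow> \<exists>c\<in>K. g c (x + y) \<le> g a x + g b y"
    and scale: "\<And>t a x. t > 0 \<Longrightarrow> a \<in> K \<Longrightarrow> \<exists>c\<in>K. g c (t *\<^sub>R x) \<le> t * g a x"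
  shows "sublinear (\<lambda>x. INF a\<in>K. g a x)"
  unfolding sublinear_def
proof safe
  fix x y
  have *: "(INF a\<in>K. g a (x + y)) \<le> g a x + g b y" if "a \<in> K" "b \<in> K" for a b
    using add[OF that, of x y] cINF_lower[OF bdd] by (meson order_trans)
  have "(INF a\<in>K. g a (x + y)) - g b y \<le> (INF a\<in>K. g a x)" if "b \<in> K" for b
    using * that by (intro cINF_greatest[OF ne]) (simp add: diff_le_eq)
  then have "(INF a\<in>K. g a (x + y)) - (INF a\<in>K. g a x) \<le> (INF a\<in>K. g a y)"
    by (intro cINF_greatest[OF ne]) (simp add: algebra_simps)
  then show "(INF a\<in>K. g a (x + y)) \<le> (INF a\<in>K. g a x) + (INF a\<in>K. g a y)"
    by simp
next
  fix t :: real and x assume t: "t > 0"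
  have "(INF a\<in>K. g a (t *\<^sub>R x)) / t \<le> g a x" if "a \<in> K" for a
    using scale[OF t that, of x] cINF_lower[OF bdd] t
    by (simp add: pos_divide_le_eq mult.commute) (meson order_trans)
  then have "(INF a\<in>K. g a (t *\<^sub>R x)) / t \<le> (INF a\<in>K. g a x)"
    by (intro cINF_greatest[OF ne])
  then show "(INF a\<in>K. g a (t *\<^sub>R x)) \<le> t * (INF a\<in>K. g a x)"
    using t by (simp add: pos_divide_le_eq mult.commute)
qed

text \<open>Minimal sublinear functionals are linear.\<close>

lemma sublinear_dominates_linear:
  fixes q :: "'a::real_vector \<Rightarrow> real"
  assumes q: "sublinear q"
  obtains f where "linear f" "\<And>x. f x \<le> q x"
proof -
  define S where "S = {f. sublinear f \<and> (\<forall>x. f x \<le> q x)}"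
  \<comment> \<open>The order is reversed, so that the maximal element supplied by Zorn is minimal
    pointwise.\<close>
  define R where "R = (\<lambda>f g :: 'a \<Rightarrow> real. \<forall>x. g x \<le> f x)"
  \<comment> \<open>A lower bound common to all of \<open>S\<close>: it keeps the infimum over a
    chain finite.\<close>
  have lower: "- q (- x) \<le> f x" if "f \<in> S" for f x
    using that sublinearD(4)[of f x] by (force simp: S_def intro: order_trans[rotated])
  have "\<exists>m\<in>S. \<forall>a\<in>S. R m a \<longrightarrow> a = m"
  proof (rule predicate_Zorn)
    show "partial_order_on S (relation_of R S)"
      by (rule partial_order_on_relation_ofI)
         (auto simp: R_def intro: order_trans, meson antisym ext)
  next
    fix C assume C: "C \<in> Chains (relation_of R S)"
    then have CS: "C \<subseteq> S"
      by (auto simp: Chains_def relation_of_def)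
    show "\<exists>u\<in>S. \<forall>a\<in>C. R a u"
    proof (cases "C = {}")
      case True
      then show ?thesis using q by (auto simp: S_def)
    next
      case ne: False
      have bdd: "bdd_below ((\<lambda>f. f x) ` C)" for x
        using lower CS by (auto intro!: bdd_belowI[where m = "- q (- x)"])
      have sub: "sublinear f" if "f \<in> C" for f
        using that CS by (auto simp: S_def)
      have "sublinear (\<lambda>x. INF f\<in>C. f x)"
      proof (rule sublinear_INF[OF ne bdd])
        fix f g x y assume fg: "f \<in> C" "g \<in> C"
        then have "R f g \<or> R g f"
          using C by (auto simp: Chains_def relation_of_def)
        then show "\<exists>h\<in>C. h (x + y) \<le> f x + g y"
        proof
          assume "R f g"
          then show ?thesis
            using sublinearD(1)[OF sub[OF fg(2)], of x y] fg
            by (intro bexI[of _ g]) (auto simp: R_def intro: order_trans)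
        next
          assume "R g f"
          then show ?thesis
            using sublinearD(1)[OF sub[OF fg(1)], of x y] fg
            by (intro bexI[of _ f]) (auto simp: R_def intro: order_trans)
        qed
      next
        fix t :: real and f x assume "t > 0" "f \<in> C"
        then show "\<exists>h\<in>C. h (t *\<^sub>R x) \<le> t * f x"
          using sublinearD(2)[OF sub, of f t x] by (intro bexI[of _ f]) auto
      qed
      moreover have "(INF f\<in>C. f x) \<le> f x" if "f \<in> C" for f x
        using cINF_lower[OF bdd that] .
      moreover have "(INF f\<in>C. f x) \<le> q x" for x
        using ne CS calculation(2)[of _ x] by (force simp: S_def intro: order_trans)
      ultimately show ?thesis
        by (intro bexI[of _ "\<lambda>x. INF f\<in>C. f x"]) (auto simp: S_def R_def)
    qed
  qed
  then obtain m where mS: "m \<in> S" and min: "\<And>a. a \<in> S \<Longrightarrow> R m a \<Longrightarrow> a = m"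
    by blast
  have m: "sublinear m" using mS by (simp add: S_def)
  have add: "m x + m y \<le> m (x + y)" for x y
  proof -
    \<comment> \<open>The infimum over \<open>t\<close> is sublinear and lies below \<open>m\<close>
      (take \<open>t = 0\<close>), so minimality makes it equal to \<open>m\<close>. Then
      \<open>t = 1\<close> gives superadditivity of \<open>m\<close>.\<close>
    define g where "g = (\<lambda>t x. m (x + t *\<^sub>R y) - t * m y)"
    have bdd: "bdd_below ((\<lambda>t. g t x) ` {0..})" for x
    proof (rule bdd_belowI2)
      fix t :: real assume "t \<in> {0..}"
      then show "- m (- x) \<le> g t x"
        using sublinearD(1)[OF m, of "x + t *\<^sub>R y" "- x"] sublinearD(2)[OF m, of t y]
        by (simp add: g_def)
    qed
    have "sublinear (\<lambda>x. INF t\<in>{0..}. g t x)"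
    proof (rule sublinear_INF[OF _ bdd])
      fix a b :: real and x z assume "a \<in> {0..}" "b \<in> {0..}"
      then show "\<exists>c\<in>{0..}. g c (x + z) \<le> g a x + g b z"
        using sublinearD(1)[OF m, of "x + a *\<^sub>R y" "z + b *\<^sub>R y"]
        by (intro bexI[of _ "a + b"]) (auto simp: g_def algebra_simps)
    next
      fix t a :: real and x assume "t > 0" "a \<in> {0..}"
      then show "\<exists>c\<in>{0..}. g c (t *\<^sub>R x) \<le> t * g a x"
        using sublinearD(2)[OF m, of t "x + a *\<^sub>R y"]
        by (intro bexI[of _ "t * a"]) (auto simp: g_def algebra_simps)
    qed simp
    moreover have le: "(INF t\<in>{0..}. g t x) \<le> g t x" if "t \<ge> 0" for t x
      using cINF_lower[OF bdd, of t x] that by simp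
    have "(INF t\<in>{0..}. g t x) \<le> m x" for x
      using le[of 0 x] by (simp add: g_def)
    ultimately have "(\<lambda>x. INF t\<in>{0..}. g t x) = m"
      using mS by (intro min) (auto simp: S_def R_def intro: order_trans)
    then have "m x \<le> g 1 x"
      using le[of 1 x] by (metis zero_le_one)
    then show ?thesis by (simp add: g_def)
  qed
  then have add: "m (x + y) = m x + m y" for x y
    using sublinearD(1)[OF m] by (simp add: antisym)
  then have neg: "m (- x) = - m x" for x
    using add[of x "- x"] sublinearD(3)[OF m] by simp
  have "m (t *\<^sub>R x) = t * m x" for t x
    using sublinearD(2)[OF m, of t x] sublinearD(2)[OF m, of "- t" x] neg[of "t *\<^sub>R x"]
    by (cases "t \<ge> 0") auto
  then have "linear m"
    using add by (intro linearI) auto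
  then show ?thesis
    using that mS by (auto simp: S_def)
qed

text \<open>The subspace carrying the functional is presented as the image of \<open>K\<close> under a linear map.\<close>

theorem hahn_banach_extension:
  fixes L :: "'a::real_vector \<Rightarrow> 'b::real_normed_vector" and \<phi> :: "'a \<Rightarrow> real"
  assumes K: "subspace K" and L: "linear L" and \<phi>: "linear \<phi>" and c: "c \<ge> 0"
    and le: "\<And>a. a \<in> K \<Longrightarrow> \<phi> a \<le> c * norm (L a)"
  obtains \<xi> :: "'b \<Rightarrow>\<^sub>L real" where "norm \<xi> \<le> c" "\<And>a. a \<in> K \<Longrightarrow> \<xi> (L a) = \<phi> a"
proof -
  \<comment> \<open>At \<open>a = 0\<close> this is \<open>c * norm y\<close>, and at
    \<open>y = L a\<close> it is \<open>\<phi> a\<close>. A linear functional below the infimum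
    therefore has norm at most \<open>c\<close> and is at most \<open>\<phi>\<close> on the image;
    applying the latter to \<open>- a\<close> gives equality. Injectivity of \<open>L\<close> never
    enters.\<close>
  define g where "g = (\<lambda>a y. \<phi> a + c * norm (y - L a))"
  have bdd: "bdd_below ((\<lambda>a. g a y) ` K)" for y
  proof (rule bdd_belowI2)
    fix a assume "a \<in> K"
    then have "- \<phi> a \<le> c * norm (L a)"
      using le[of "- a"] K by (simp add: subspace_neg linear_neg[OF L] linear_neg[OF \<phi>])
    also have "\<dots> \<le> c * (norm y + norm (y - L a))"
      using c by (intro mult_left_mono) (metis add.commute norm_minus_commute norm_triangle_sub)
    finally show "- c * norm y \<le> g a y"
      by (simp add: g_def algebra_simps)
  qed
  have "sublinear (\<lambda>y. INF a\<in>K. g a y)"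
  proof (rule sublinear_INF[OF _ bdd])
    show "K \<noteq> {}" using subspace_0[OF K] by auto
  next
    fix a b x y assume ab: "a \<in> K" "b \<in> K"
    have "norm (x + y - L (a + b)) \<le> norm (x - L a) + norm (y - L b)"
      using norm_triangle_ineq[of "x - L a" "y - L b"] by (simp add: linear_add[OF L] algebra_simps)
    from mult_left_mono[OF this c] show "\<exists>d\<in>K. g d (x + y) \<le> g a x + g b y"
      using subspace_add[OF K ab] by (intro bexI[of _ "a + b"]) (auto simp: g_def linear_add[OF \<phi>] algebra_simps)
  next
    fix t :: real and a x assume t: "t > 0" and a: "a \<in> K"
    have "norm (t *\<^sub>R x - L (t *\<^sub>R a)) = t * norm (x - L a)"
      using t by (simp add: linear_scale[OF L] flip: scaleR_diff_right)
    then show "\<exists>d\<in>K. g d (t *\<^sub>R x) \<le> t * g a x"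
      using subspace_scale[OF K a]
      by (intro bexI[of _ "t *\<^sub>R a"]) (auto simp: g_def linear_scale[OF \<phi>] algebra_simps)
  qed
  then obtain f where f: "linear f" "\<And>y. f y \<le> (INF a\<in>K. g a y)"
    using sublinear_dominates_linear by blast
  have fg: "f y \<le> g a y" if "a \<in> K" for a y
    using f(2)[of y] cINF_lower[OF bdd that, of y] by simp
  have upper: "f y \<le> c * norm y" for y
    using fg[of 0 y] subspace_0[OF K] by (simp add: g_def linear_0[OF L] linear_0[OF \<phi>])
  have bound: "\<bar>f y\<bar> \<le> c * norm y" for y
    using upper[of y] upper[of "- y"] by (auto simp: linear_neg[OF f(1)])
  have bl: "bounded_linear f"
    using bound by (intro bounded_linear_intro[where K = c])
       (auto simp: linear_add[OF f(1)] linear_scale[OF f(1)] mult.commute)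
  have upK: "f (L a) \<le> \<phi> a" if "a \<in> K" for a
    using fg[OF that, of "L a"] by (simp add: g_def)
  have "f (L a) = \<phi> a" if "a \<in> K" for a
    using upK[OF that] upK[OF subspace_neg[OF K that]]
    by (simp add: linear_neg[OF L] linear_neg[OF \<phi>] linear_neg[OF f(1)])
  moreover have "norm (Blinfun f) \<le> c"
    using bound c by (intro norm_blinfun_bound) (auto simp: bounded_linear_Blinfun_apply[OF bl])
  ultimately show ?thesis
    using that[of "Blinfun f"] by (simp add: bounded_linear_Blinfun_apply[OF bl])
qed

lemma norming_functional:
  fixes v :: "'a::real_normed_vector"
  obtains f :: "'a \<Rightarrow>\<^sub>L real" where "norm f \<le> 1" "f v = norm v"
proof -
  have *: "linear (\<lambda>t. t *\<^sub>R v)" "linear (\<lambda>t. t * norm v)"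
    by (auto intro!: linearI simp: algebra_simps)
  have "t * norm v \<le> 1 * norm (t *\<^sub>R v)" for t :: real
    by (simp add: mult_right_mono)
  then obtain f :: "'a \<Rightarrow>\<^sub>L real" where "norm f \<le> 1" "\<And>t. f (t *\<^sub>R v) = t * norm v"
    using hahn_banach_extension[OF subspace_UNIV *, of 1] by auto
  then show ?thesis using that[of f] by (metis mult_1 scaleR_one)
qed

text \<open>The functional \<open>s + t v\<close> to \<open>t d\<close>, with \<open>d\<close> the
  distance from \<open>v\<close> to \<open>S\<close>, is bounded by the norm, because
  \<open>v + s / t\<close> has norm at least \<open>d\<close>.\<close>

lemma closed_subspace_separation:
  fixes S :: "'a::real_normed_vector set"
  assumes S: "subspace S" "closed S" and v: "v \<notin> S"
  obtains f :: "'a \<Rightarrow>\<^sub>L real" where "\<And>s. s \<in> S \<Longrightarrow> f s = 0" "f v \<noteq> 0"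
proof -
  have ne: "S \<noteq> {}" using subspace_0[OF S(1)] by auto
  define d where "d = infdist v S"
  have d: "d > 0"
    using v S(2) ne by (simp add: d_def infdist_pos_not_in_closed)
  have lin: "linear (\<lambda>(s, t). s + t *\<^sub>R v)" "linear (\<lambda>(s :: 'a, t). t * d)"
    by (auto intro!: linearI simp: algebra_simps)
  have sub: "subspace (S \<times> (UNIV :: real set))"
    using S(1) by (simp add: subspace_Times)
  have "t * d \<le> 1 * norm (s + t *\<^sub>R v)" if s: "s \<in> S" for s t
  proof (cases "t > 0")
    case True
    have "- (1 / t) *\<^sub>R s \<in> S" using s S(1) by (intro subspace_scale)
    then have "d \<le> dist v (- (1 / t) *\<^sub>R s)"
      unfolding d_def by (rule infdist_le)
    then have "t * d \<le> norm (t *\<^sub>R (v + (1 / t) *\<^sub>R s))"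
      using True by (simp add: dist_norm)
    then show ?thesis using True by (simp add: algebra_simps)
  next
    case False
    then have "t * d \<le> 0" using d by (simp add: mult_le_0_iff)
    then show ?thesis by (simp add: order_trans[OF _ norm_ge_zero])
  qed
  then obtain f :: "'a \<Rightarrow>\<^sub>L real" where f: "\<And>a. a \<in> S \<times> UNIV \<Longrightarrow> f ((\<lambda>(s, t). s + t *\<^sub>R v) a) = (\<lambda>(s, t). t * d) a"
    using hahn_banach_extension[OF sub lin, of 1] by (metis (no_types, lifting) case_prodE mem_Sigma_iff prod.case_eq_if zero_le_one split_pairs)
  show ?thesis
  proof
    show "f s = 0" if "s \<in> S" for s using f[of "(s, 0)"] that by simp
    show "f v \<noteq> 0" using f[of "(0, 1)"] subspace_0[OF S(1)] d by simp
  qed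
qed

section \<open>Separability and measurability in evolution triples\<close>

lemma closure_limit:
  fixes X :: "nat \<Rightarrow> 'a::first_countable_topology"
  shows "(\<And>n. X n \<in> S) \<Longrightarrow> X \<longlonglongrightarrow> x \<Longrightarrow> x \<in> closure S"
  unfolding closure_sequential by (intro exI[of _ X]) auto

lemma separable_subset:
  fixes S :: "'a::{metric_space, second_countable_topology} set"
  assumes "S \<noteq> {}"
  obtains f :: "nat \<Rightarrow> 'a" where "range f \<subseteq> S" "S \<subseteq> closure (range f)"
proof -
  obtain B :: "'a set set" where B: "countable B" "topological_basis B"
    using ex_countable_basis by blast
  obtain a where a: "a \<in> S" using assms by blast
  define g where "g = (\<lambda>b. if b \<inter> S = {} then a else (SOME x. x \<in> b \<inter> S))"
  have g: "g b \<in> S" for b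
    using a someI_ex[of "\<lambda>x. x \<in> b \<inter> S"] by (auto simp: g_def)
  have cnt: "countable (insert a (g ` B))" using B(1) by simp
  have ne: "insert a (g ` B) \<noteq> {}" by simp
  obtain f :: "nat \<Rightarrow> 'a" where f: "range f = insert a (g ` B)"
    using range_from_nat_into[OF ne cnt] by blast
  show ?thesis
  proof
    show "range f \<subseteq> S" using f g a by auto
    show "S \<subseteq> closure (range f)"
    proof (clarsimp simp: closure_approachable)
      fix x e assume x: "x \<in> S" and e: "(e::real) > 0"
      obtain b where b: "b \<in> B" "x \<in> b" "b \<subseteq> ball x e"
        using topological_basisE[OF B(2), of "ball x e" x] e by (metis centre_in_ball open_ball)
      then have "g b \<in> b" using x someI_ex[of "\<lambda>x. x \<in> b \<inter> S"] by (auto simp: g_def)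
      then have "dist (g b) x < e" using b(3) by (auto simp: dist_commute)
      then show "\<exists>n. dist (f n) x < e" using f b(1) by (metis imageI insertI2 rangeE)
    qed
  qed
qed

text \<open>Rational linear combinations are coded by lists of pairs, a countable type; appending
  lists adds the combinations. The closure of their set is a closed subspace containing every
  \<open>d j\<close>.\<close>

lemma separable_if_dense_span:
  fixes d :: "nat \<Rightarrow> 'a::real_normed_vector"
  assumes "closure (span (range d)) = UNIV"
  obtains E :: "nat \<Rightarrow> 'a" where "closure (range E) = UNIV"
proof -
  define C where "C = (\<lambda>l :: (nat \<times> rat) list. \<Sum>(j, q)\<leftarrow>l. real_of_rat q *\<^sub>R d j)"
  let ?S = "closure (range C)"
  have Cadd: "C l + C l' = C (l @ l')" for l l' by (simp add: C_def)
  have Cscale: "real_of_rat q *\<^sub>R C l = C (map (\<lambda>(j, r). (j, q * r)) l)" for q l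
    by (induction l) (auto simp: C_def scaleR_right_distrib of_rat_mult)
  have rat: "\<exists>q. (\<lambda>n. real_of_rat (q n)) \<longlonglongrightarrow> c" for c :: real
  proof -
    have "\<exists>q. \<bar>real_of_rat q - c\<bar> < inverse (real (Suc n))" for n
    proof -
      obtain q where "c < real_of_rat q" "real_of_rat q < c + inverse (real (Suc n))"
        using of_rat_dense[of c "c + inverse (real (Suc n))"] by auto
      then show ?thesis by (intro exI[of _ q]) simp
    qed
    then obtain q where "\<bar>real_of_rat (q n) - c\<bar> < inverse (real (Suc n))" for n by metis
    then have "(\<lambda>n. real_of_rat (q n) - c) \<longlonglongrightarrow> 0"
      by (intro Lim_null_comparison[OF _ LIMSEQ_inverse_real_of_nat] eventuallyI) (auto intro: less_imp_le)
    then show ?thesis using Lim_null by blast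
  qed
  have "subspace ?S"
  proof (rule subspaceI)
    have "C [] = 0" by (simp add: C_def)
    then show "0 \<in> ?S" by (metis closure_subset rangeI subsetD)
  next
    fix x y assume "x \<in> ?S" "y \<in> ?S"
    then obtain X Y where XY: "\<And>n. X n \<in> range C" "X \<longlonglongrightarrow> x" "\<And>n. Y n \<in> range C" "Y \<longlonglongrightarrow> y"
      by (auto simp: closure_sequential)
    then have "\<And>n. X n + Y n \<in> range C" using Cadd by (metis (no_types) rangeE rangeI)
    then show "x + y \<in> ?S" using tendsto_add[OF XY(2,4)] by (rule closure_limit)
  next
    fix c x assume "x \<in> ?S"
    then obtain X where X: "\<And>n. X n \<in> range C" "X \<longlonglongrightarrow> x"
      by (auto simp: closure_sequential)
    obtain q where q: "(\<lambda>n. real_of_rat (q n)) \<longlonglongrightarrow> c" using rat by blast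
    have "\<And>n. real_of_rat (q n) *\<^sub>R X n \<in> range C" using X(1) Cscale by (metis (no_types) rangeE rangeI)
    then show "c *\<^sub>R x \<in> ?S" using tendsto_scaleR[OF q X(2)] by (rule closure_limit)
  qed
  moreover have "d j \<in> ?S" for j
  proof -
    have "C [(j, 1)] = d j" by (simp add: C_def)
    then show ?thesis by (metis closure_subset rangeI subsetD)
  qed
  ultimately have "span (range d) \<subseteq> ?S" by (intro span_minimal) auto
  then have "?S = UNIV" using assms closure_minimal[of "span (range d)" ?S] by auto
  moreover have "range (C \<circ> from_nat) = range C"
    by (metis (no_types) comp_apply from_nat_to_nat image_comp rangeI surj_def)
  ultimately show ?thesis using that[of "C \<circ> from_nat"] by simp
qed

lemma closure_approach_norm:
  assumes "closure (range E) = (UNIV :: 'a::real_normed_vector set)" and "e > 0"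
  obtains n where "norm (x - E n) < e"
proof -
  have "x \<in> closure (range E)" using assms(1) by simp
  then show ?thesis using that assms(2) by (auto simp: closure_approachable dist_norm norm_minus_commute)
qed

text \<open>A bound on a dual norm becomes countably many scalar conditions. This is how
  measurability of norms in \<open>V'\<close> follows from measurability of pairings.\<close>

lemma norm_blinfun_le_iff_dense:
  fixes f :: "'v::real_normed_vector \<Rightarrow>\<^sub>L real" and E :: "nat \<Rightarrow> 'v"
  assumes E: "closure (range E) = UNIV" and c: "c \<ge> 0"
  shows "norm f \<le> c \<longleftrightarrow> (\<forall>n. f (E n) \<le> c * norm (E n))"
proof
  assume le: "norm f \<le> c"
  show "\<forall>n. f (E n) \<le> c * norm (E n)"
  proof
    fix n
    have "f (E n) \<le> norm f * norm (E n)"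
      using norm_blinfun[of f "E n"] by simp
    also have "\<dots> \<le> c * norm (E n)" using le by (simp add: mult_right_mono)
    finally show "f (E n) \<le> c * norm (E n)" .
  qed
next
  assume le: "\<forall>n. f (E n) \<le> c * norm (E n)"
  have upper: "f v \<le> c * norm v" for v
  proof -
    have "v \<in> closure (range E)" using E by simp
    then obtain X where X: "\<And>n. X n \<in> range E" "X \<longlonglongrightarrow> v" by (auto simp: closure_sequential)
    have "(\<lambda>n. f (X n)) \<longlonglongrightarrow> f v" "(\<lambda>n. c * norm (X n)) \<longlonglongrightarrow> c * norm v"
      by (intro tendsto_intros X)+
    moreover have "f (X n) \<le> c * norm (X n)" for n using X(1)[of n] le by auto
    ultimately show ?thesis by (meson LIMSEQ_le)
  qed
  have "\<bar>f v\<bar> \<le> c * norm v" for v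
    using upper[of v] upper[of "- v"] by (auto simp: blinfun.minus_right)
  then show "norm f \<le> c" using c by (intro norm_blinfun_bound) auto
qed

section \<open>The norm of \<open>V\<close> seen from \<open>H\<close>\<close>

locale reflexive_triple =
  fixes i :: "'v::banach \<Rightarrow> 'h::{real_inner, banach, second_countable_topology}"
  assumes triple: "evolution_triple i" and refl_V: "reflexive TYPE('v)"
begin

abbreviation "de \<equiv> dual_embed i"

lemma bounded_linear_i: "bounded_linear i" and inj_i: "inj i"
  and bounded_linear_de: "bounded_linear de" and inj_de: "inj de"
  and dense_de: "closure (range de) = UNIV"
  using triple by (auto simp: evolution_triple_def)

sublocale i: bounded_linear i by (rule bounded_linear_i)
sublocale de: bounded_linear de by (rule bounded_linear_de)

lemma de_apply [simp]: "blinfun_apply (de h) v = h \<bullet> i v"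
  unfolding dual_embed_def
  by (subst bounded_linear_Blinfun_apply)
     (auto intro: bounded_linear_compose[OF bounded_linear_inner_right bounded_linear_i, unfolded o_def])

lemma approx_de:
  assumes "e > 0"
  obtains h where "norm (f - de h) < e"
proof -
  have "f \<in> closure (range de)" using dense_de by simp
  then show ?thesis using that assms by (auto simp: closure_approachable dist_norm norm_minus_commute)
qed

text \<open>Pairings with these elements determine the norm of \<open>V\<close> on vectors of
  \<open>H\<close>, and are bounded above exactly on \<open>V\<close>. Density in the norm of
  \<open>H\<close> is the right one, since \<open>h \<bullet> x\<close> is continuous in
  \<open>h\<close> there.\<close>

definition unit_dual :: "nat \<Rightarrow> 'h" where
  "unit_dual = (SOME f. range f \<subseteq> {h. norm (de h) \<le> 1} \<and> {h. norm (de h) \<le> 1} \<subseteq> closure (range f))"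

lemma unit_dual: "range unit_dual \<subseteq> {h. norm (de h) \<le> 1}" "{h. norm (de h) \<le> 1} \<subseteq> closure (range unit_dual)"
proof -
  have "0 \<in> {h. norm (de h) \<le> 1}" by (simp add: de.zero)
  then have "\<exists>f :: nat \<Rightarrow> 'h. range f \<subseteq> {h. norm (de h) \<le> 1} \<and> {h. norm (de h) \<le> 1} \<subseteq> closure (range f)"
    using separable_subset by (metis empty_iff)
  from someI_ex[OF this]
  show "range unit_dual \<subseteq> {h. norm (de h) \<le> 1}" "{h. norm (de h) \<le> 1} \<subseteq> closure (range unit_dual)"
    unfolding unit_dual_def by auto
qed

lemma inner_le_if_unit_dual:
  assumes le: "\<And>n. unit_dual n \<bullet> x \<le> c" and h: "norm (de h) \<le> 1"
  shows "h \<bullet> x \<le> c"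
proof -
  have "h \<in> closure (range unit_dual)" using unit_dual(2) h by blast
  then obtain X where X: "\<And>n. X n \<in> range unit_dual" "X \<longlonglongrightarrow> h" by (auto simp: closure_sequential)
  have "(\<lambda>n. X n \<bullet> x) \<longlonglongrightarrow> h \<bullet> x" by (intro tendsto_intros X)
  moreover have "X n \<bullet> x \<le> c" for n using X(1)[of n] le by auto
  ultimately show ?thesis by (meson LIMSEQ_le_const2)
qed

lemma unit_dual_le_norm: "unit_dual n \<bullet> i v \<le> norm v"
proof -
  have "unit_dual n \<bullet> i v \<le> norm (de (unit_dual n)) * norm v"
    using norm_blinfun[of "de (unit_dual n)" v] by simp
  also have "\<dots> \<le> 1 * norm v"
    using unit_dual(1) by (intro mult_right_mono) auto
  finally show ?thesis by simp
qed

text \<open>A norming functional of \<open>v\<close> belongs to \<open>V'\<close> only. An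
  approximation \<open>de h\<close> of it has norm at most \<open>1 + e\<close>, so \<open>h\<close>
  is rescaled into the unit ball before the hypothesis applies; then \<open>e\<close> tends to
  0.\<close>

lemma norm_le_if_unit_dual:
  assumes le: "\<And>n. unit_dual n \<bullet> i v \<le> c"
  shows "norm v \<le> c"
proof -
  obtain f :: "'v \<Rightarrow>\<^sub>L real" where f: "norm f \<le> 1" "f v = norm v" by (rule norming_functional)
  have "norm v \<le> (1 + e) * c + e * norm v" if e: "e > 0" for e
  proof -
    obtain h where h: "norm (f - de h) < e" using approx_de e by blast
    have "norm (de h) \<le> norm f + norm (f - de h)"
      by (metis add.commute norm_minus_commute norm_triangle_sub)
    then have "norm (de h) \<le> 1 + e" using f(1) h by simp
    then have "norm (de ((1 / (1 + e)) *\<^sub>R h)) \<le> 1" using e by (simp add: de.scaleR)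
    from inner_le_if_unit_dual[OF le this] have "h \<bullet> i v \<le> (1 + e) * c"
      using e by (simp add: field_simps)
    moreover have "f v - de h v \<le> e * norm v"
    proof -
      have "(f - de h) v \<le> norm (f - de h) * norm v" using norm_blinfun[of "f - de h" v] by simp
      also have "\<dots> \<le> e * norm v" using h by (simp add: mult_right_mono)
      finally show ?thesis by (simp add: blinfun.diff_left)
    qed
    ultimately show ?thesis using f(2) by simp
  qed
  then have ev: "\<forall>\<^sub>F e in at_right 0. norm v \<le> (1 + e) * c + e * norm v"
    by (auto simp: eventually_at_filter)
  have "((\<lambda>e. (1 + e) * c + e * norm v) \<longlongrightarrow> (1 + 0) * c + 0 * norm v) (at_right 0)"
    by (intro tendsto_intros)
  then show ?thesis using tendsto_lowerbound[OF _ ev] by simp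
qed

text \<open>By reflexivity, the functional \<open>de h \<mapsto> h \<bullet> x\<close> is evaluation at a point of \<open>V\<close>.\<close>

lemma range_if_unit_dual:
  assumes le: "\<And>n. unit_dual n \<bullet> x \<le> c"
  shows "x \<in> range i"
proof -
  have c: "c \<ge> 0" using inner_le_if_unit_dual[OF le, of 0] by (simp add: de.zero)
  have lin: "linear de" "linear (\<lambda>h. h \<bullet> x)"
    by (auto intro!: linearI simp: de.add de.scaleR inner_add_left)
  have "h \<bullet> x \<le> c * norm (de h)" for h
  proof (cases "h = 0")
    case False
    then have "de h \<noteq> 0" using inj_de de.zero by (metis injD)
    moreover from this have "norm (de ((1 / norm (de h)) *\<^sub>R h)) \<le> 1" by (simp add: de.scaleR)
    from inner_le_if_unit_dual[OF le this] have "(h \<bullet> x) / norm (de h) \<le> c" by simp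
    ultimately show ?thesis by (simp add: divide_le_eq)
  qed (simp add: de.zero)
  then obtain \<xi> :: "('v \<Rightarrow>\<^sub>L real) \<Rightarrow>\<^sub>L real" where \<xi>: "\<And>h. \<xi> (de h) = h \<bullet> x"
    using hahn_banach_extension[OF subspace_UNIV lin c] by (metis UNIV_I)
  obtain v where "\<And>f. \<xi> f = blinfun_apply f v" using refl_V by (auto simp: reflexive_def)
  then have "h \<bullet> x = h \<bullet> i v" for h using \<xi> by simp
  then have "x = i v" using vector_eq_ldot by metis
  then show ?thesis by simp
qed

text \<open>A finite maximum is continuous on \<open>H\<close>, and in \<open>n\<close> it increases
  to the norm of \<open>V\<close>, or to infinity outside \<open>V\<close>. These are the continuous
  functions from which the test functions are built; the 0 in the maximum makes powers
  monotone.\<close>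

definition vgauge :: "nat \<Rightarrow> 'h \<Rightarrow> real" where
  "vgauge n x = Max ((\<lambda>k. max 0 (unit_dual k \<bullet> x)) ` {..n})"

lemma vgauge_nonneg: "0 \<le> vgauge n x"
  unfolding vgauge_def by (subst Max_ge_iff) auto

lemma vgauge_ge: "k \<le> n \<Longrightarrow> unit_dual k \<bullet> x \<le> vgauge n x"
  unfolding vgauge_def by (subst Max_ge_iff) (auto intro!: bexI[of _ k])

lemma vgauge_le_iff: "vgauge n x \<le> c \<longleftrightarrow> 0 \<le> c \<and> (\<forall>k\<le>n. unit_dual k \<bullet> x \<le> c)"
  unfolding vgauge_def by (subst Max_le_iff) auto

lemma vgauge_mono: "n \<le> n' \<Longrightarrow> vgauge n x \<le> vgauge n' x"
  unfolding vgauge_le_iff[of n] using vgauge_ge vgauge_nonneg order_trans by blast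

lemma vgauge_le_norm: "vgauge n (i v) \<le> norm v"
  unfolding vgauge_le_iff using unit_dual_le_norm by simp

lemma norm_le_iff_vgauge: "norm v \<le> c \<longleftrightarrow> (\<forall>n. vgauge n (i v) \<le> c)"
  using vgauge_le_norm norm_le_if_unit_dual[of v c] vgauge_ge[OF order_refl, of _ "i v"] by (meson order_trans)

lemma range_iff_vgauge: "x \<in> range i \<longleftrightarrow> (\<exists>c::nat. \<forall>n. vgauge n x \<le> c)"
proof
  assume "x \<in> range i"
  then obtain v where "x = i v" by blast
  then show "\<exists>c::nat. \<forall>n. vgauge n x \<le> c"
    using vgauge_le_norm[of _ v] real_arch_simple[of "norm v"] by (meson order_trans)
next
  assume "\<exists>c::nat. \<forall>n. vgauge n x \<le> c"
  then show "x \<in> range i"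
    using range_if_unit_dual vgauge_ge[OF order_refl, of _ x] by (meson order_trans)
qed

lemma continuous_vgauge: "continuous_on UNIV (vgauge n)"
proof (induction n)
  case 0
  then show ?case by (auto simp: vgauge_def intro!: continuous_intros)
next
  case (Suc n)
  have "vgauge (Suc n) = (\<lambda>x. max (max 0 (unit_dual (Suc n) \<bullet> x)) (vgauge n x))"
    by (simp add: vgauge_def atMost_Suc fun_eq_iff)
  then show ?case using Suc by (auto intro!: continuous_intros)
qed

lemma borel_vgauge [measurable]: "vgauge n \<in> borel_measurable borel"
  using continuous_vgauge by (rule borel_measurable_continuous_onI)

lemma sets_range_i [measurable]: "range i \<in> sets borel"
proof -
  have "range i = {x \<in> space borel. \<exists>c::nat. \<forall>n. vgauge n x \<le> c}"
    by (rule set_eqI, subst range_iff_vgauge) simp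
  then show ?thesis by simp
qed

text \<open>The inequality that needs an argument is the one for a finite supremum: a uniform bound
  on the gauges puts \<open>x\<close> into \<open>V\<close> by reflexivity, and then bounds its norm
  there.\<close>

lemma Vnorm_powr_SUP:
  assumes p: "p > 0"
  shows "Vnorm_powr i p x = (SUP n. ennreal (vgauge n x powr p))"
proof (rule antisym)
  show "(SUP n. ennreal (vgauge n x powr p)) \<le> Vnorm_powr i p x"
  proof (rule SUP_least)
    fix n
    show "ennreal (vgauge n x powr p) \<le> Vnorm_powr i p x"
      using p by (auto simp: Vnorm_powr_def inv_f_f[OF inj_i] vgauge_nonneg vgauge_le_norm
                  intro!: ennreal_leI powr_mono2)
  qed
next
  let ?S = "SUP n. ennreal (vgauge n x powr p)"
  show "Vnorm_powr i p x \<le> ?S"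
  proof (cases "?S = \<infinity>")
    case False
    then obtain r where r: "?S = ennreal r" "r \<ge> 0" by (metis ennreal_cases infinity_ennreal_def)
    have "vgauge n x \<le> r powr (1 / p)" for n
    proof -
      have "ennreal (vgauge n x powr p) \<le> ennreal r" using r(1) by (metis SUP_upper UNIV_I)
      then have "vgauge n x powr p \<le> r" using r(2) by simp
      then have "(vgauge n x powr p) powr (1 / p) \<le> r powr (1 / p)"
        using p by (intro powr_mono2) auto
      then show ?thesis using p vgauge_nonneg[of n x] by (simp add: powr_powr)
    qed
    note le = this
    have "x \<in> range i"
      using range_if_unit_dual vgauge_ge[OF order_refl, of _ x] le by (meson order_trans)
    then obtain v where v: "x = i v" by blast
    then have "norm v \<le> r powr (1 / p)" using le norm_le_iff_vgauge by blast
    then have "norm v powr p \<le> (r powr (1 / p)) powr p" using p by (intro powr_mono2) auto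
    then have "norm v powr p \<le> r" using p r(2) by (simp add: powr_powr)
    then show ?thesis using r v by (simp add: Vnorm_powr_def inv_f_f[OF inj_i] ennreal_leI)
  qed (metis infinity_ennreal_def top_greatest)
qed

text \<open>A total inverse of the embedding; the value 0 outside \<open>V\<close> makes estimates
  by \<open>norm (J x)\<close> harmless there.\<close>

definition J :: "'h \<Rightarrow> 'v" where
  "J x = (if x \<in> range i then inv i x else 0)"

lemma J_i [simp]: "J (i v) = v"
  by (simp add: J_def inv_f_f[OF inj_i])

lemma J_outside: "x \<notin> range i \<Longrightarrow> J x = 0"
  by (simp add: J_def)

text \<open>Closed balls of \<open>V\<close> are cut out by countably many inequalities between
  functions continuous on \<open>H\<close>.\<close>

lemma borel_norm_J_diff: "(\<lambda>x. norm (J x - w)) \<in> borel_measurable borel"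
proof (rule borel_measurableI_le)
  fix c
  have *: "norm (J x - w) \<le> c \<longleftrightarrow> (\<forall>n. vgauge n (x - i w) \<le> c)" if x: "x \<in> range i" for x
  proof -
    obtain v where "x = i v" using x by blast
    then show ?thesis by (simp add: norm_le_iff_vgauge[of _ c] i.diff)
  qed
  have "{x \<in> space borel. norm (J x - w) \<le> c} =
      {x \<in> space borel. if x \<in> range i then (\<forall>n. vgauge n (x - i w) \<le> c) else norm w \<le> c}"
  proof (rule Collect_cong, rule conj_cong[OF refl])
    fix x :: 'h
    show "norm (J x - w) \<le> c \<longleftrightarrow> (if x \<in> range i then (\<forall>n. vgauge n (x - i w) \<le> c) else norm w \<le> c)"
      using * by (cases "x \<in> range i") (simp_all add: J_outside)
  qed
  also have "\<dots> \<in> sets borel" by measurable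
  finally show "{x \<in> space borel. norm (J x - w) \<le> c} \<in> sets borel" .
qed

lemma borel_norm_J [measurable]: "(\<lambda>x. norm (J x)) \<in> borel_measurable borel"
  using borel_norm_J_diff[of 0] by simp

lemma Vnorm_powr_J: "x \<in> range i \<Longrightarrow> Vnorm_powr i p x = ennreal (norm (J x) powr p)"
  by (simp add: Vnorm_powr_def J_def)

text \<open>Mazur: a countable subset of the unit ball of \<open>V\<close> that is dense in the norm of \<open>H\<close> has no
  nonzero annihilator, because functionals on \<open>V\<close> are limits of elements of \<open>H\<close>.\<close>

lemma V_separable:
  obtains E :: "nat \<Rightarrow> 'v" where "closure (range E) = UNIV"
proof -
  have ne: "i ` cball 0 1 \<noteq> {}" by simp
  obtain e :: "nat \<Rightarrow> 'h" where e: "range e \<subseteq> i ` cball 0 1" "i ` cball 0 1 \<subseteq> closure (range e)"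
    by (rule separable_subset[OF ne])
  have "\<forall>n. \<exists>v. norm v \<le> 1 \<and> e n = i v"
  proof
    fix n
    have "e n \<in> i ` cball 0 1" using e(1) by blast
    then show "\<exists>v. norm v \<le> 1 \<and> e n = i v" by auto
  qed
  then obtain d where d: "\<And>n. norm (d n) \<le> 1" "\<And>n. e n = i (d n)" by metis
  let ?S = "closure (span (range d))"
  have S: "subspace ?S"
  proof (rule subspaceI)
    show "0 \<in> ?S" using span_0 closure_subset by blast
  next
    fix x y assume "x \<in> ?S" "y \<in> ?S"
    then obtain X Y where XY: "\<And>n. X n \<in> span (range d)" "X \<longlonglongrightarrow> x" "\<And>n. Y n \<in> span (range d)" "Y \<longlonglongrightarrow> y"
      by (auto simp: closure_sequential)
    then have "\<And>n. X n + Y n \<in> span (range d)" by (auto intro: span_add)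
    then show "x + y \<in> ?S" using tendsto_add[OF XY(2,4)] by (rule closure_limit)
  next
    fix c x assume "x \<in> ?S"
    then obtain X where X: "\<And>n. X n \<in> span (range d)" "X \<longlonglongrightarrow> x"
      by (auto simp: closure_sequential)
    then have "\<And>n. c *\<^sub>R X n \<in> span (range d)" by (auto intro: span_scale)
    then show "c *\<^sub>R x \<in> ?S" using tendsto_scaleR[OF tendsto_const X(2)] by (rule closure_limit)
  qed
  have "?S = UNIV"
  proof (rule ccontr)
    assume "?S \<noteq> UNIV"
    then obtain v where "v \<notin> ?S" by blast
    then obtain f :: "'v \<Rightarrow>\<^sub>L real" where f: "\<And>s. s \<in> ?S \<Longrightarrow> f s = 0" "f v \<noteq> 0"
      using closed_subspace_separation[OF S closed_closure] by metis
    have fd: "f (d n) = 0" for n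
      using f(1) span_base closure_subset by (metis rangeI subsetD)
    \<comment> \<open>First \<open>h\<close> approximates \<open>f\<close> in \<open>V'\<close>,
      then \<open>d n\<close> approximates \<open>w\<close> in the norm of \<open>H\<close> to a
      precision depending on \<open>norm h\<close>. Since \<open>f\<close> vanishes at
      \<open>d n\<close>, its value at \<open>w\<close> splits into \<open>f - de h\<close> at the
      bounded vector \<open>w - d n\<close> and an inner product in \<open>H\<close>.\<close>
    have small: "\<bar>f w\<bar> \<le> e'" if w: "norm w \<le> 1" and e': "e' > 0" for w e'
    proof -
      obtain h where h: "norm (f - de h) < e' / 4" using approx_de[of "e' / 4"] e' by auto
      have "i w \<in> closure (range e)" using e(2) w by auto
      moreover have "e' / (2 * (norm h + 1)) > 0" using e' by (simp add: add_nonneg_pos)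
      ultimately obtain n where n: "norm (i w - i (d n)) < e' / (2 * (norm h + 1))"
        by (auto simp: closure_approachable dist_norm norm_minus_commute d(2))
      have "\<bar>(f - de h) (w - d n)\<bar> \<le> norm (f - de h) * norm (w - d n)"
        using norm_blinfun[of "f - de h" "w - d n"] by simp
      also have "\<dots> \<le> e' / 4 * 2"
        using h w d(1)[of n] norm_triangle_ineq4[of w "d n"] e' by (intro mult_mono) auto
      finally have 1: "\<bar>(f - de h) (w - d n)\<bar> \<le> e' / 2" by simp
      have "\<bar>h \<bullet> (i w - i (d n))\<bar> \<le> norm h * norm (i w - i (d n))"
        by (rule Cauchy_Schwarz_ineq2)
      also have "\<dots> \<le> (norm h + 1) * (e' / (2 * (norm h + 1)))"
        using n by (intro mult_mono) auto
      also have "\<dots> = e' / 2"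
        using norm_ge_zero[of h] by (simp add: field_simps add_nonneg_eq_0_iff)
      finally have 2: "\<bar>h \<bullet> (i w - i (d n))\<bar> \<le> e' / 2" .
      have "f w = (f - de h) (w - d n) + h \<bullet> (i w - i (d n))"
        using fd[of n] by (simp add: blinfun.diff_left blinfun.diff_right i.diff inner_diff_right)
      then show ?thesis using 1 2 by linarith
    qed
    have zero: "f w = 0" if w: "norm w \<le> 1" for w
      using small[OF w, of "\<bar>f w\<bar> / 2"] by (cases "f w = 0") auto
    have "f ((1 / norm v) *\<^sub>R v) = 0"
      by (rule zero) (cases "v = 0"; simp)
    then show False using f(2) by (cases "v = 0") (auto simp: blinfun.scaleR_right)
  qed
  then show ?thesis using separable_if_dense_span that by blast
qed

text \<open>Separability of \<open>V\<close> writes an open set as a countable union of balls, whose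
  preimages are measurable by \<open>borel_norm_J_diff\<close>.\<close>

lemma borel_J [measurable]: "J \<in> borel_measurable borel"
proof (rule borel_measurableI)
  fix S :: "'v set" assume S: "open S"
  obtain E :: "nat \<Rightarrow> 'v" where E: "closure (range E) = UNIV" by (rule V_separable)
  let ?I = "{(n, k::nat). ball (E n) (1 / Suc k) \<subseteq> S}"
  have SU: "S = (\<Union>(n, k)\<in>?I. ball (E n) (1 / Suc k))"
  proof (intro equalityI subsetI)
    fix x assume "x \<in> S"
    then obtain e where e: "e > 0" "ball x e \<subseteq> S" using S by (meson open_contains_ball)
    obtain k where k: "1 / Suc k < e / 2" using e nat_approx_posE[of "e / 2"] by auto
    obtain n where n: "norm (x - E n) < 1 / Suc k" using closure_approach_norm[OF E, of "1 / Suc k" x] by auto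
    have "ball (E n) (1 / Suc k) \<subseteq> ball x e"
    proof
      fix y assume "y \<in> ball (E n) (1 / Suc k)"
      then have "dist x y < 1 / Suc k + 1 / Suc k"
        using n dist_triangle[of x y "E n"] by (auto simp: dist_norm)
      then show "y \<in> ball x e" using k by simp
    qed
    then have "(n, k) \<in> ?I" using e by auto
    moreover have "x \<in> ball (E n) (1 / Suc k)" using n by (simp add: dist_norm norm_minus_commute)
    ultimately show "x \<in> (\<Union>(n, k)\<in>?I. ball (E n) (1 / Suc k))" by blast
  qed auto
  have "J -` S \<inter> space borel = (\<Union>(n, k)\<in>?I. J -` ball (E n) (1 / Suc k) \<inter> space borel)"
    using SU by blast
  also have "\<dots> = (\<Union>(n, k)\<in>?I. {x \<in> space borel. norm (J x - E n) < 1 / Suc k})"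
    by (intro SUP_cong refl) (auto simp: dist_norm norm_minus_commute)
  also have "\<dots> \<in> sets borel"
  proof (intro sets.countable_UN'')
    note [measurable] = borel_norm_J_diff
    show "(case nk of (n, k) \<Rightarrow> {x \<in> space borel. norm (J x - E n) < 1 / Suc k}) \<in> sets borel" for nk
      by (cases nk) simp
  qed auto
  finally show "J -` S \<inter> space borel \<in> sets borel" .
qed

end

text \<open>Evaluation at \<open>w\<close> is an element of the bidual, so weak convergence in
  \<open>V'\<close> can be tested with it.\<close>

lemma demicontinuous_apply:
  fixes A :: "'v::real_normed_vector \<Rightarrow> ('v \<Rightarrow>\<^sub>L real)"
  assumes "demicontinuous A"
  shows "continuous_on UNIV (\<lambda>v. A v w)"
proof -
  have bl: "bounded_linear (\<lambda>f :: 'v \<Rightarrow>\<^sub>L real. blinfun_apply f w)" by (rule blinfun.bounded_linear_left)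
  have "(\<lambda>n. A (X n) w) \<longlonglongrightarrow> A x w" if X: "X \<longlonglongrightarrow> x" for X x
  proof -
    have "(\<lambda>n. Blinfun (\<lambda>f. blinfun_apply f w) (A (X n))) \<longlonglongrightarrow> Blinfun (\<lambda>f. blinfun_apply f w) (A x)"
      using assms X unfolding demicontinuous_def by blast
    then show ?thesis by (simp add: bounded_linear_Blinfun_apply[OF bl])
  qed
  then show ?thesis by (simp add: continuous_on_sequentially o_def)
qed

section \<open>The operator as a Borel map on \<open>H\<close>, and its approximation by values in
  \<open>H\<close>\<close>

locale triple_operator = reflexive_triple i
  for i :: "'v::banach \<Rightarrow> 'h::{real_inner, banach, second_countable_topology}" +
  fixes A :: "'v \<Rightarrow> ('v \<Rightarrow>\<^sub>L real)"
  assumes demi: "demicontinuous A"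
begin

abbreviation "B \<equiv> extend_op i A"

lemma B_eq: "B x = (if x \<in> range i then A (J x) else 0)"
  by (simp add: extend_op_def J_def)

lemma borel_B_apply [measurable]: "(\<lambda>x. B x v) \<in> borel_measurable borel"
proof -
  have [measurable]: "(\<lambda>w. A w v) \<in> borel_measurable borel"
    using demicontinuous_apply[OF demi] by (rule borel_measurable_continuous_onI)
  have "(\<lambda>x. B x v) = (\<lambda>x. if x \<in> range i then A (J x) v else 0)"
    by (auto simp: B_eq)
  then show ?thesis by simp
qed

lemma borel_norm_B_diff: "(\<lambda>x. norm (B x - f)) \<in> borel_measurable borel"
proof (rule borel_measurableI_le)
  fix c
  obtain E :: "nat \<Rightarrow> 'v" where E: "closure (range E) = UNIV" by (rule V_separable)
  have "{x \<in> space borel. norm (B x - f) \<le> c} =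
      (if c < 0 then {} else {x \<in> space borel. \<forall>n. B x (E n) - f (E n) \<le> c * norm (E n)})"
    using norm_blinfun_le_iff_dense[OF E, of c] norm_ge_zero
    by (auto simp: blinfun.diff_left intro: order_trans) (meson leD norm_ge_zero order_trans not_le)
  also have "\<dots> \<in> sets borel" by (cases "c < 0") simp_all
  finally show "{x \<in> space borel. norm (B x - f) \<le> c} \<in> sets borel" .
qed

definition dense_H :: "nat \<Rightarrow> 'h" where
  "dense_H = (SOME f. closure (range f) = UNIV)"

lemma dense_H: "closure (range dense_H) = UNIV"
proof -
  have "\<exists>f :: nat \<Rightarrow> 'h. closure (range f) = UNIV"
    using separable_subset[of "UNIV :: 'h set"] by (metis UNIV_not_empty top.extremum_uniqueI)
  then show ?thesis unfolding dense_H_def by (rule someI_ex)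
qed

text \<open>The approximations \<open>\<eta> n x\<close> of \<open>B x\<close> lie in \<open>H\<close>: pairings with them are continuous in the norm of
  \<open>H\<close>, in which solutions are right-continuous, while pairings with \<open>B x\<close> itself are not.\<close>

primrec \<eta> :: "nat \<Rightarrow> 'h \<Rightarrow> 'h" where
  "\<eta> 0 x = 0"
| "\<eta> (Suc n) x = (if norm (B x - de (dense_H n)) < norm (B x - de (\<eta> n x)) then dense_H n else \<eta> n x)"

lemma norm_B_eta_mono: "n \<le> n' \<Longrightarrow> norm (B x - de (\<eta> n' x)) \<le> norm (B x - de (\<eta> n x))"
  by (rule lift_Suc_antimono_le) auto

text \<open>The selection starts at 0 and never increases the error. This is the domination used
  later to send the errors to 0 in \<open>L^q\<close>.\<close>

lemma norm_B_eta_le: "norm (B x - de (\<eta> n x)) \<le> norm (B x)"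
  using norm_B_eta_mono[of 0 n x] by (simp add: de.zero)

lemma tendsto_B_eta: "(\<lambda>n. norm (B x - de (\<eta> n x))) \<longlonglongrightarrow> 0"
proof (rule LIMSEQ_I)
  fix e :: real assume e: "0 < e"
  obtain h where h: "norm (B x - de h) < e / 2" using approx_de[of "e / 2"] e by auto
  obtain C where C: "C > 0" "\<And>x. norm (de x) \<le> norm x * C" using de.pos_bounded by blast
  obtain k where k: "norm (h - dense_H k) < e / (2 * C)"
    using closure_approach_norm[OF dense_H, of "e / (2 * C)" h] e C by auto
  have "norm (de (h - dense_H k)) < e / 2"
    using k C(2)[of "h - dense_H k"] C(1) by (simp add: field_simps)
  then have "norm (B x - de (dense_H k)) < e"
    using h norm_triangle_ineq[of "B x - de h" "de h - de (dense_H k)"] by (simp add: de.diff)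
  then have "norm (B x - de (\<eta> (Suc k) x)) < e" by simp
  then have "norm (B x - de (\<eta> n x)) < e" if "n \<ge> Suc k" for n
    using norm_B_eta_mono[OF that, of x] by linarith
  then show "\<exists>no. \<forall>n\<ge>no. norm (norm (B x - de (\<eta> n x)) - 0) < e" by auto
qed

text \<open>For fixed \<open>n\<close> only finitely many values occur, namely 0 and the first
  \<open>n\<close> points of \<open>dense_H\<close>.\<close>

lemma eta_bounded: "\<exists>C. \<forall>x. norm (\<eta> n x) \<le> C"
proof (induction n)
  case (Suc n)
  then obtain C where "\<And>x. norm (\<eta> n x) \<le> C" by blast
  then have "norm (\<eta> (Suc n) x) \<le> max C (norm (dense_H n))" for x
    by (auto simp: max_def intro: order_trans)
  then show ?case by blast
qed auto

text \<open>The next choice compares two errors, so the measurability of the errors has to be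
  carried through the induction together with that of the choice.\<close>

lemma borel_eta_aux: "\<eta> n \<in> borel_measurable borel \<and> (\<lambda>x. norm (B x - de (\<eta> n x))) \<in> borel_measurable borel"
proof (induction n)
  case 0
  then show ?case using borel_norm_B_diff[of 0] by (simp add: de.zero)
next
  case (Suc n)
  then have [measurable]: "\<eta> n \<in> borel_measurable borel" "(\<lambda>x. norm (B x - de (\<eta> n x))) \<in> borel_measurable borel"
    by auto
  note [measurable] = borel_norm_B_diff
  have "(\<lambda>x. norm (B x - de (\<eta> (Suc n) x))) =
      (\<lambda>x. min (norm (B x - de (dense_H n))) (norm (B x - de (\<eta> n x))))"
    by (auto simp: fun_eq_iff)
  moreover have "\<eta> (Suc n) = (\<lambda>x. if norm (B x - de (dense_H n)) < norm (B x - de (\<eta> n x)) then dense_H n else \<eta> n x)"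
    by auto
  then have "\<eta> (Suc n) \<in> borel_measurable borel" by simp
  ultimately show ?case by simp
qed

lemma borel_eta [measurable]: "\<eta> n \<in> borel_measurable borel"
  and borel_norm_B_eta [measurable]: "(\<lambda>x. norm (B x - de (\<eta> n x))) \<in> borel_measurable borel"
  using borel_eta_aux by auto

lemma borel_norm_B [measurable]: "(\<lambda>x. norm (B x)) \<in> borel_measurable borel"
  using borel_norm_B_diff[of 0] by simp

lemma B_apply_J_bound: "y \<in> range i \<Longrightarrow> \<bar>B x (J y) - \<eta> n x \<bullet> y\<bar> \<le> norm (B x - de (\<eta> n x)) * norm (J y)"
  using norm_blinfun[of "B x - de (\<eta> n x)" "J y"] by (auto simp: blinfun.diff_left)

text \<open>For \<open>y\<close> in \<open>V\<close> the pairing is the limit of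
  \<open>\<eta> n x \<bullet> y\<close>, which is jointly measurable because it is an inner product
  in \<open>H\<close>.\<close>

lemma borel_pairing [measurable]: "(\<lambda>(x, y). B x (J y)) \<in> borel_measurable (borel \<Otimes>\<^sub>M borel)"
proof (rule borel_measurable_LIMSEQ_real)
  fix z :: "'h \<times> 'h"
  obtain x y where z: "z = (x, y)" by fastforce
  have "(\<lambda>n. \<eta> n x \<bullet> y) \<longlonglongrightarrow> B x (J y)" if y: "y \<in> range i"
  proof -
    have "(\<lambda>n. norm (B x - de (\<eta> n x)) * norm (J y)) \<longlonglongrightarrow> 0"
      using tendsto_mult_right[OF tendsto_B_eta, of x "norm (J y)"] by simp
    then have "(\<lambda>n. \<eta> n x \<bullet> y - B x (J y)) \<longlonglongrightarrow> 0"
      by (rule Lim_null_comparison[rotated])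
         (use B_apply_J_bound[OF y] in \<open>auto simp: abs_minus_commute\<close>)
    then show ?thesis using Lim_null by blast
  qed
  then show "(\<lambda>n. case z of (x, y) \<Rightarrow> if y \<in> range i then \<eta> n x \<bullet> y else 0) \<longlonglongrightarrow> (case z of (x, y) \<Rightarrow> B x (J y))"
    by (cases "y \<in> range i") (simp_all add: z J_outside del: image_iff)
next
  fix n
  show "(\<lambda>(x, y). if y \<in> range i then \<eta> n x \<bullet> y else 0) \<in> borel_measurable (borel \<Otimes>\<^sub>M borel)"
    by measurable
qed

end

section \<open>Moments and independence of Poisson random measures\<close>

definition sq_integrable :: "'a measure \<Rightarrow> ('a \<Rightarrow> 'b::{real_inner, second_countable_topology}) \<Rightarrow> bool" where
  "sq_integrable M f \<longleftrightarrow> f \<in> borel_measurable M \<and> integrable M (\<lambda>x. (norm (f x))\<^sup>2)"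

lemma sq_integrableD:
  assumes "sq_integrable M f"
  shows "f \<in> borel_measurable M" "integrable M (\<lambda>x. (norm (f x))\<^sup>2)"
  using assms by (auto simp: sq_integrable_def)

lemma inner_abs_le_half: "\<bar>x \<bullet> y\<bar> \<le> ((norm x)\<^sup>2 + (norm y)\<^sup>2) / 2" for x y :: "'a::real_inner"
proof -
  have "\<bar>x \<bullet> y\<bar> \<le> norm x * norm y" by (rule Cauchy_Schwarz_ineq2)
  also have "\<dots> \<le> ((norm x)\<^sup>2 + (norm y)\<^sup>2) / 2"
    using sum_squares_bound[of "norm x" "norm y"] by simp
  finally show ?thesis .
qed

lemma sq_integrable_inner:
  assumes "sq_integrable M f" "sq_integrable M g"
  shows "integrable M (\<lambda>x. f x \<bullet> g x)"
proof (rule Bochner_Integration.integrable_bound)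
  note [measurable] = sq_integrableD(1)[OF assms(1)] sq_integrableD(1)[OF assms(2)]
  show "integrable M (\<lambda>x. ((norm (f x))\<^sup>2 + (norm (g x))\<^sup>2) / 2)"
    using assms by (auto simp: sq_integrable_def)
  show "(\<lambda>x. f x \<bullet> g x) \<in> borel_measurable M" by measurable
  show "AE x in M. norm (f x \<bullet> g x) \<le> norm (((norm (f x))\<^sup>2 + (norm (g x))\<^sup>2) / 2)"
    using inner_abs_le_half by (intro AE_I2) (simp add: abs_le_iff)
qed

lemma sq_integrable_scaleR_const:
  assumes "sq_integrable M f" shows "sq_integrable M (\<lambda>x. c *\<^sub>R f x)"
  using assms unfolding sq_integrable_def by (auto simp: power_mult_distrib)

lemma sq_integrable_add:
  assumes "sq_integrable M f" "sq_integrable M g"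
  shows "sq_integrable M (\<lambda>x. f x + g x)"
proof -
  have "(norm (f x + g x))\<^sup>2 = (norm (f x))\<^sup>2 + 2 * (f x \<bullet> g x) + (norm (g x))\<^sup>2" for x
    by (simp add: power2_norm_eq_inner inner_add_left inner_add_right inner_commute)
  then show ?thesis
    using assms sq_integrable_inner[OF assms] unfolding sq_integrable_def by auto
qed

lemma sq_integrable_diff:
  assumes "sq_integrable M f" "sq_integrable M g"
  shows "sq_integrable M (\<lambda>x. f x - g x)"
  using sq_integrable_add[OF assms(1) sq_integrable_scaleR_const[OF assms(2), of "-1"]] by simp

lemma sq_integrable_sum:
  assumes "\<And>k. k \<in> I \<Longrightarrow> sq_integrable M (f k)"
  shows "sq_integrable M (\<lambda>x. \<Sum>k\<in>I. f k x)"
  using assms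
proof (induction I rule: infinite_finite_induct)
  case (insert k I)
  then show ?case by (simp add: sq_integrable_add)
qed (auto simp: sq_integrable_def)

lemma sq_integrableI_nn:
  fixes f :: "'a \<Rightarrow> 'b::{real_inner, second_countable_topology}"
  assumes "f \<in> borel_measurable M" "(\<integral>\<^sup>+x. ennreal ((norm (f x))\<^sup>2) \<partial>M) < \<infinity>"
  shows "sq_integrable M f"
  using assms unfolding sq_integrable_def by (auto intro!: integrableI_nonneg)

text \<open>Up to the factor \<open>exp (- x)\<close>, these are the total mass and the first two
  moments of the Poisson law with parameter \<open>x\<close>.\<close>

lemma sums_power_fact:
  fixes x :: real
  shows "(\<lambda>k. x ^ k / fact k) sums exp x"
    and "(\<lambda>k. real k * (x ^ k / fact k)) sums (x * exp x)"
    and "(\<lambda>k. (real k)\<^sup>2 * (x ^ k / fact k)) sums ((x\<^sup>2 + x) * exp x)"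
proof -
  show 0: "(\<lambda>k. x ^ k / fact k) sums exp x"
    using exp_converges[of x] by (simp add: scaleR_conv_of_real field_simps)
  have h: "real (Suc k) * (x ^ Suc k / fact (Suc k)) = x * (x ^ k / fact k)" for k
    by (simp add: fact_Suc del: of_nat_Suc)
  have "(\<lambda>k. real (Suc k) * (x ^ Suc k / fact (Suc k))) sums (x * exp x)"
    unfolding h by (rule sums_mult[OF 0])
  then show 1: "(\<lambda>k. real k * (x ^ k / fact k)) sums (x * exp x)"
    using sums_Suc_iff[of "\<lambda>k. real k * (x ^ k / fact k)"] by simp
  have h2: "(real (Suc k))\<^sup>2 * (x ^ Suc k / fact (Suc k)) = x * (real k * (x ^ k / fact k)) + x * (x ^ k / fact k)" for k
  proof -
    have "(real (Suc k))\<^sup>2 * (x ^ Suc k / fact (Suc k)) = real (Suc k) * (x * (x ^ k / fact k))"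
      by (simp only: power2_eq_square h mult.assoc)
    also have "\<dots> = x * (real k * (x ^ k / fact k)) + x * (x ^ k / fact k)"
      by (simp only: of_nat_Suc distrib_right distrib_left mult_1 mult.left_commute add.commute)
    finally show ?thesis .
  qed
  have "(\<lambda>k. (real (Suc k))\<^sup>2 * (x ^ Suc k / fact (Suc k))) sums (x * (x * exp x) + x * exp x)"
    unfolding h2 by (intro sums_add sums_mult 0 1)
  moreover have "x * (x * exp x) + x * exp x = (x\<^sup>2 + x) * exp x"
    by (simp add: power2_eq_square algebra_simps)
  ultimately show "(\<lambda>k. (real k)\<^sup>2 * (x ^ k / fact k)) sums ((x\<^sup>2 + x) * exp x)"
    using sums_Suc_iff[of "\<lambda>k. (real k)\<^sup>2 * (x ^ k / fact k)" "(x\<^sup>2 + x) * exp x"] by simp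
qed

locale prm = prob_space P
  for P :: "'w measure" +
  fixes F :: "real \<Rightarrow> 'w measure" and m :: "'z measure" and \<mu> :: "'w \<Rightarrow> (real \<times> 'z) measure"
  assumes filt: "usual_filtration P F" and sfm: "sigma_finite_measure m"
    and prm: "poisson_random_measure P F m \<mu>"
begin

abbreviation "\<Lambda> \<equiv> intensity m"
abbreviation "Nh X \<omega> \<equiv> compensated m \<mu> \<omega> X"

lemma subalg: "t \<ge> 0 \<Longrightarrow> subalgebra P (F t)"
  using filt unfolding usual_filtration_def by metis

lemma sets_F_mono: "0 \<le> s \<Longrightarrow> s \<le> t \<Longrightarrow> sets (F s) \<subseteq> sets (F t)"
  using filt unfolding usual_filtration_def by metis

lemma measurable_F_P: "f \<in> borel_measurable (F t) \<Longrightarrow> t \<ge> 0 \<Longrightarrow> f \<in> borel_measurable P"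
  using measurable_from_subalg[OF subalg] .

lemma measurable_F_mono: "f \<in> borel_measurable (F s) \<Longrightarrow> 0 \<le> s \<Longrightarrow> s \<le> t \<Longrightarrow> f \<in> borel_measurable (F t)"
  using sets_F_mono[of s t] subalg[of s] subalg[of t]
  by (auto simp: measurable_def subalgebra_def)

lemma mu_measurable [measurable]: "X \<in> sets \<Lambda> \<Longrightarrow> (\<lambda>\<omega>. emeasure (\<mu> \<omega>) X) \<in> borel_measurable P"
  using prm unfolding poisson_random_measure_def by simp

lemma Nh_measurable [measurable]: "X \<in> sets \<Lambda> \<Longrightarrow> (\<lambda>\<omega>. Nh X \<omega>) \<in> borel_measurable P"
  unfolding compensated_def measure_def
  by (intro borel_measurable_diff borel_measurable_enn2real mu_measurable borel_measurable_const)

lemma sets_mu: "\<omega> \<in> space P \<Longrightarrow> sets (\<mu> \<omega>) = sets \<Lambda>"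
  using prm unfolding poisson_random_measure_def by simp

lemma prob_count:
  assumes "X \<in> sets \<Lambda>" "emeasure \<Lambda> X < \<infinity>"
  shows "prob {\<omega> \<in> space P. emeasure (\<mu> \<omega>) X = of_nat k} = exp (- measure \<Lambda> X) * measure \<Lambda> X ^ k / fact k"
  using prm assms unfolding poisson_random_measure_def by blast

text \<open>The Poisson weights add up to 1, which leaves no mass for the value infinity.\<close>

lemma AE_count:
  assumes X: "X \<in> sets \<Lambda>" "emeasure \<Lambda> X < \<infinity>"
  shows "AE \<omega> in P. \<exists>k::nat. emeasure (\<mu> \<omega>) X = of_nat k"
proof -
  let ?A = "\<lambda>k. {\<omega> \<in> space P. emeasure (\<mu> \<omega>) X = of_nat k}"
  have sets: "?A k \<in> sets P" for k using X by measurable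
  have "(\<lambda>k. prob (?A k)) sums prob (\<Union>k. ?A k)"
    using sets by (intro finite_measure_UNION) (auto simp: disjoint_family_on_def)
  moreover have "(\<lambda>k. prob (?A k)) sums (exp (- measure \<Lambda> X) * exp (measure \<Lambda> X))"
    using sums_mult[OF sums_power_fact(1)[of "measure \<Lambda> X"], of "exp (- measure \<Lambda> X)"]
    by (simp add: prob_count[OF X])
  ultimately have "prob (\<Union>k. ?A k) = 1"
    using sums_unique2 by (simp add: exp_minus) blast
  moreover have "(\<Union>k. ?A k) \<in> sets P" using sets by auto
  ultimately have "AE \<omega> in P. \<omega> \<in> (\<Union>k. ?A k)" by (simp add: prob_eq_1)
  then show ?thesis by auto
qed

text \<open>The integral is a Poisson series over the possible counts. Nothing is asked of
  \<open>f\<close> where the count is infinite, since that event is null.\<close>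

lemma nn_integral_count:
  fixes g :: "nat \<Rightarrow> real"
  assumes X: "X \<in> sets \<Lambda>" "emeasure \<Lambda> X < \<infinity>" and g: "\<And>k. g k \<ge> 0"
    and s: "(\<lambda>k. g k * (measure \<Lambda> X ^ k / fact k)) sums (s * exp (measure \<Lambda> X))"
    and f: "\<And>\<omega> k. emeasure (\<mu> \<omega>) X = of_nat k \<Longrightarrow> f \<omega> = g k"
  shows "(\<integral>\<^sup>+\<omega>. ennreal (f \<omega>) \<partial>P) = ennreal s"
proof -
  let ?A = "\<lambda>k. {\<omega> \<in> space P. emeasure (\<mu> \<omega>) X = of_nat k}"
  have sets [measurable]: "?A k \<in> sets P" for k using X by measurable
  have "(\<integral>\<^sup>+\<omega>. ennreal (f \<omega>) \<partial>P) = (\<integral>\<^sup>+\<omega>. (\<Sum>k. ennreal (g k) * indicator (?A k) \<omega>) \<partial>P)"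
  proof (rule nn_integral_cong_AE)
    show "AE \<omega> in P. ennreal (f \<omega>) = (\<Sum>k. ennreal (g k) * indicator (?A k) \<omega>)"
      using AE_count[OF X] AE_space
    proof eventually_elim
      case (elim \<omega>)
      then obtain k where k: "emeasure (\<mu> \<omega>) X = of_nat k" by blast
      have "(\<Sum>j. ennreal (g j) * indicator (?A j) \<omega>) = (\<Sum>j\<in>{k}. ennreal (g j) * indicator (?A j) \<omega>)"
        by (rule suminf_finite) (use k in \<open>auto simp: indicator_def\<close>)
      then show ?case using k elim f[OF k] by (simp add: indicator_def)
    qed
  qed
  also have "\<dots> = (\<Sum>k. \<integral>\<^sup>+\<omega>. ennreal (g k) * indicator (?A k) \<omega> \<partial>P)"
    by (rule nn_integral_suminf) measurable
  also have "\<dots> = (\<Sum>k. ennreal (g k * (exp (- measure \<Lambda> X) * measure \<Lambda> X ^ k / fact k)))"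
    by (intro suminf_cong)
       (simp add: nn_integral_cmult emeasure_eq_measure prob_count[OF X] g flip: ennreal_mult)
  also have "\<dots> = ennreal s"
  proof (rule suminf_ennreal_eq)
    have "(\<lambda>k. exp (- measure \<Lambda> X) * (g k * (measure \<Lambda> X ^ k / fact k))) sums (exp (- measure \<Lambda> X) * (s * exp (measure \<Lambda> X)))"
      using s by (rule sums_mult)
    then show "(\<lambda>k. g k * (exp (- measure \<Lambda> X) * measure \<Lambda> X ^ k / fact k)) sums s"
      by (simp add: exp_minus field_simps)
  qed (simp add: g)
  finally show ?thesis .
qed

lemma count_moments:
  assumes X: "X \<in> sets \<Lambda>" "emeasure \<Lambda> X < \<infinity>"
  shows "integrable P (\<lambda>\<omega>. measure (\<mu> \<omega>) X)" "expectation (\<lambda>\<omega>. measure (\<mu> \<omega>) X) = measure \<Lambda> X"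
    and "integrable P (\<lambda>\<omega>. (measure (\<mu> \<omega>) X)\<^sup>2)"
    and "expectation (\<lambda>\<omega>. (measure (\<mu> \<omega>) X)\<^sup>2) = (measure \<Lambda> X)\<^sup>2 + measure \<Lambda> X"
proof -
  have [measurable]: "(\<lambda>\<omega>. measure (\<mu> \<omega>) X) \<in> borel_measurable P"
    using X unfolding measure_def by (intro borel_measurable_enn2real mu_measurable)
  have 1: "(\<integral>\<^sup>+\<omega>. ennreal (measure (\<mu> \<omega>) X) \<partial>P) = ennreal (measure \<Lambda> X)"
    by (rule nn_integral_count[OF X _ sums_power_fact(2)]) (auto simp: measure_def)
  have 2: "(\<integral>\<^sup>+\<omega>. ennreal ((measure (\<mu> \<omega>) X)\<^sup>2) \<partial>P) = ennreal ((measure \<Lambda> X)\<^sup>2 + measure \<Lambda> X)"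
    by (rule nn_integral_count[OF X _ sums_power_fact(3)]) (auto simp: measure_def)
  show i1: "integrable P (\<lambda>\<omega>. measure (\<mu> \<omega>) X)"
    using 1 by (intro integrableI_nonneg) auto
  show i2: "integrable P (\<lambda>\<omega>. (measure (\<mu> \<omega>) X)\<^sup>2)"
    using 2 by (intro integrableI_nonneg) auto
  show "expectation (\<lambda>\<omega>. measure (\<mu> \<omega>) X) = measure \<Lambda> X"
    using 1 by (simp add: integral_eq_nn_integral)
  show "expectation (\<lambda>\<omega>. (measure (\<mu> \<omega>) X)\<^sup>2) = (measure \<Lambda> X)\<^sup>2 + measure \<Lambda> X"
    using 2 by (simp add: integral_eq_nn_integral del: ennreal_plus)
qed

lemma Nh_moments:
  assumes X: "X \<in> sets \<Lambda>" "emeasure \<Lambda> X < \<infinity>"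
  shows "sq_integrable P (Nh X)" "integrable P (Nh X)" "expectation (Nh X) = 0"
    and "expectation (\<lambda>\<omega>. Nh X \<omega> * Nh X \<omega>) = measure \<Lambda> X"
proof -
  note c = count_moments[OF X]
  have sq: "Nh X \<omega> * Nh X \<omega> = (measure (\<mu> \<omega>) X)\<^sup>2 - 2 * measure \<Lambda> X * measure (\<mu> \<omega>) X + (measure \<Lambda> X)\<^sup>2" for \<omega>
    by (simp add: compensated_def power2_eq_square algebra_simps)
  have "(norm (Nh X \<omega>))\<^sup>2 = (measure (\<mu> \<omega>) X)\<^sup>2 - 2 * measure \<Lambda> X * measure (\<mu> \<omega>) X + (measure \<Lambda> X)\<^sup>2" for \<omega>
    using sq by (simp add: power2_eq_square)
  then show "sq_integrable P (Nh X)"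
    using c X unfolding sq_integrable_def by simp
  show "integrable P (Nh X)" "expectation (Nh X) = 0"
    using c unfolding compensated_def by (simp_all add: prob_space)
  show "expectation (\<lambda>\<omega>. Nh X \<omega> * Nh X \<omega>) = measure \<Lambda> X"
    unfolding sq using c by (simp add: prob_space power2_eq_square)
qed

lemma Nh_product_integrable:
  assumes "X \<in> sets \<Lambda>" "emeasure \<Lambda> X < \<infinity>" "Y \<in> sets \<Lambda>" "emeasure \<Lambda> Y < \<infinity>"
  shows "integrable P (\<lambda>\<omega>. Nh X \<omega> * Nh Y \<omega>)"
  using sq_integrable_inner[OF Nh_moments(1)[OF assms(1,2)] Nh_moments(1)[OF assms(3,4)]] by simp

lemma Nh_disjoint:
  assumes X: "X \<in> sets \<Lambda>" "emeasure \<Lambda> X < \<infinity>" and Y: "Y \<in> sets \<Lambda>" "emeasure \<Lambda> Y < \<infinity>"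
    and disj: "X \<inter> Y = {}"
  shows "expectation (\<lambda>\<omega>. Nh X \<omega> * Nh Y \<omega>) = 0"
proof -
  define Z where "Z = (\<lambda>k::nat. if k = 0 then X else Y)"
  have Z: "\<forall>k<2. Z k \<in> sets \<Lambda>" "disjoint_family_on Z {..<2}"
    using X Y disj by (auto simp: Z_def disjoint_family_on_def)
  have "indep_vars (\<lambda>_. borel) (\<lambda>k \<omega>. emeasure (\<mu> \<omega>) (Z k)) {..<2}"
    using prm Z unfolding poisson_random_measure_def by simp
  then have "indep_vars (\<lambda>_. borel) (\<lambda>k \<omega>. enn2real (emeasure (\<mu> \<omega>) (Z k)) - measure \<Lambda> (Z k)) {..<2}"
    by (rule indep_vars_compose2) measurable
  then have ind: "indep_vars (\<lambda>_. borel) (\<lambda>k \<omega>. Nh (Z k) \<omega>) {..<2}"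
    by (simp add: compensated_def measure_def)
  have "expectation (\<lambda>\<omega>. \<Prod>k\<in>{..<2}. Nh (Z k) \<omega>) = (\<Prod>k\<in>{..<2}. expectation (Nh (Z k)))"
    using Nh_moments(2)[OF X] Nh_moments(2)[OF Y]
    by (intro indep_vars_lebesgue_integral ind) (auto simp: Z_def)
  then show ?thesis
    by (simp add: numeral_2_eq_2 Z_def Nh_moments(3)[OF X])
qed

text \<open>Additivity holds only almost surely: \<open>measure\<close> takes the value 0 on sets of
  infinite mass, and such counts have to be excluded.\<close>

lemma AE_Nh_Un:
  assumes X: "X \<in> sets \<Lambda>" "emeasure \<Lambda> X < \<infinity>" and Y: "Y \<in> sets \<Lambda>" "emeasure \<Lambda> Y < \<infinity>"
    and disj: "X \<inter> Y = {}"
  shows "AE \<omega> in P. Nh (X \<union> Y) \<omega> = Nh X \<omega> + Nh Y \<omega>"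
  using AE_count[OF X] AE_count[OF Y] AE_space
proof eventually_elim
  case (elim \<omega>)
  have "measure (\<mu> \<omega>) (X \<union> Y) = measure (\<mu> \<omega>) X + measure (\<mu> \<omega>) Y"
    using elim X Y disj by (intro measure_Union) (auto simp: sets_mu)
  moreover have "measure \<Lambda> (X \<union> Y) = measure \<Lambda> X + measure \<Lambda> Y"
    using X Y disj by (intro measure_Union) auto
  ultimately show ?case by (simp add: compensated_def)
qed

text \<open>Both sets are split along their intersection. The cross terms belong to disjoint sets
  and vanish, and the variance on the intersection remains.\<close>

lemma Nh_covariance:
  assumes X: "X \<in> sets \<Lambda>" "emeasure \<Lambda> X < \<infinity>" and Y: "Y \<in> sets \<Lambda>" "emeasure \<Lambda> Y < \<infinity>"
  shows "expectation (\<lambda>\<omega>. Nh X \<omega> * Nh Y \<omega>) = measure \<Lambda> (X \<inter> Y)"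
proof -
  have sub: "Z \<in> sets \<Lambda> \<and> emeasure \<Lambda> Z < \<infinity>" if "Z \<in> sets \<Lambda>" "Z \<subseteq> X \<or> Z \<subseteq> Y" for Z
    using that X Y emeasure_mono[of Z X \<Lambda>] emeasure_mono[of Z Y \<Lambda>] by (auto intro: le_less_trans)
  have 1: "X \<inter> Y \<in> sets \<Lambda>" "emeasure \<Lambda> (X \<inter> Y) < \<infinity>"
    and 2: "X - Y \<in> sets \<Lambda>" "emeasure \<Lambda> (X - Y) < \<infinity>"
    and 3: "Y - X \<in> sets \<Lambda>" "emeasure \<Lambda> (Y - X) < \<infinity>"
    using sub[of "X \<inter> Y"] sub[of "X - Y"] sub[of "Y - X"] X Y by auto
  have "AE \<omega> in P. Nh (X \<inter> Y \<union> (X - Y)) \<omega> = Nh (X \<inter> Y) \<omega> + Nh (X - Y) \<omega>"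
    "AE \<omega> in P. Nh (X \<inter> Y \<union> (Y - X)) \<omega> = Nh (X \<inter> Y) \<omega> + Nh (Y - X) \<omega>"
    by (rule AE_Nh_Un; use 1 2 3 in auto)+
  moreover have "X \<inter> Y \<union> (X - Y) = X" "X \<inter> Y \<union> (Y - X) = Y" by auto
  ultimately have AE: "AE \<omega> in P. Nh X \<omega> = Nh (X \<inter> Y) \<omega> + Nh (X - Y) \<omega>"
    "AE \<omega> in P. Nh Y \<omega> = Nh (X \<inter> Y) \<omega> + Nh (Y - X) \<omega>" by simp_all
  have "expectation (\<lambda>\<omega>. Nh X \<omega> * Nh Y \<omega>) = expectation (\<lambda>\<omega>. Nh (X \<inter> Y) \<omega> * Nh (X \<inter> Y) \<omega>
     + Nh (X \<inter> Y) \<omega> * Nh (Y - X) \<omega> + Nh (X - Y) \<omega> * Nh (X \<inter> Y) \<omega> + Nh (X - Y) \<omega> * Nh (Y - X) \<omega>)"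
    using X(1) Y(1) 1(1) 2(1) 3(1) AE by (intro integral_cong_AE) (auto simp: algebra_simps)
  also have "\<dots> = measure \<Lambda> (X \<inter> Y)"
    using Nh_product_integrable[OF 1 1] Nh_product_integrable[OF 1 3] Nh_product_integrable[OF 2 1]
      Nh_product_integrable[OF 2 3] Nh_moments(4)[OF 1] Nh_disjoint[OF 1 3] Nh_disjoint[OF 2 1] Nh_disjoint[OF 2 3]
    by (simp add: Int_Diff Diff_Int_distrib2 disjoint_iff)
  finally show ?thesis .
qed

definition future :: "real \<Rightarrow> 'w measure" where
  "future t = sigma (space P) {(\<lambda>\<omega>. emeasure (\<mu> \<omega>) X) -` S \<inter> space P | X S.
     X \<in> sets \<Lambda> \<and> X \<subseteq> {t<..} \<times> space m \<and> S \<in> sets borel}"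

lemma space_future [simp]: "space (future t) = space P"
  unfolding future_def by (intro space_measure_of) auto

lemma sets_future: "sets (future t) = sigma_sets (space P) {(\<lambda>\<omega>. emeasure (\<mu> \<omega>) X) -` S \<inter> space P | X S.
     X \<in> sets \<Lambda> \<and> X \<subseteq> {t<..} \<times> space m \<and> S \<in> sets borel}"
  unfolding future_def by (intro sets_measure_of) auto

lemma Nh_measurable_future:
  assumes "X \<in> sets \<Lambda>" "X \<subseteq> {t<..} \<times> space m"
  shows "Nh X \<in> borel_measurable (future t)"
proof -
  have "(\<lambda>\<omega>. emeasure (\<mu> \<omega>) X) \<in> borel_measurable (future t)"
    unfolding measurable_def sets_future using assms by auto
  then show ?thesis unfolding compensated_def measure_def
    by (intro borel_measurable_diff borel_measurable_enn2real borel_measurable_const)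
qed

text \<open>The independence of \<open>F t\<close> and the later noise passes to real variables,
  because the sigma-algebras generated by \<open>Z\<close> and \<open>W\<close> are contained in
  those two.\<close>

lemma independent_of_past:
  fixes Z W :: "'w \<Rightarrow> real"
  assumes t: "t \<ge> 0" and Z: "Z \<in> borel_measurable (F t)" "integrable P Z"
    and W: "W \<in> borel_measurable (future t)" "integrable P W"
  shows "integrable P (\<lambda>\<omega>. Z \<omega> * W \<omega>)" "expectation (\<lambda>\<omega>. Z \<omega> * W \<omega>) = expectation Z * expectation W"
proof -
  have sp: "space (F t) = space P" using subalg[OF t] by (simp add: subalgebra_def)
  have "indep_set (sets (F t)) (sets (future t))"
    using prm t unfolding poisson_random_measure_def sets_future by simp
  moreover have "sigma_sets (space P) {Z -` A \<inter> space P | A. A \<in> sets borel} \<subseteq> sets (F t)"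
  proof (rule sets.sigma_sets_subset')
    show "{Z -` A \<inter> space P | A. A \<in> sets borel} \<subseteq> sets (F t)"
      using measurable_sets[OF Z(1)] sp by auto
    show "space P \<in> sets (F t)" using sets.top[of "F t"] sp by simp
  qed
  moreover have "sigma_sets (space P) {W -` A \<inter> space P | A. A \<in> sets borel} \<subseteq> sets (future t)"
  proof (rule sets.sigma_sets_subset')
    show "{W -` A \<inter> space P | A. A \<in> sets borel} \<subseteq> sets (future t)"
      using measurable_sets[OF W(1)] by auto
    show "space P \<in> sets (future t)" using sets.top[of "future t"] by simp
  qed
  ultimately have "indep_set (sigma_sets (space P) {Z -` A \<inter> space P | A. A \<in> sets borel})
      (sigma_sets (space P) {W -` A \<inter> space P | A. A \<in> sets borel})"
    unfolding indep_sets2_eq by (meson subset_trans subsetD)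
  then have "indep_var borel Z borel W"
    using Z(2) W(2) unfolding indep_var_eq by simp
  then show "integrable P (\<lambda>\<omega>. Z \<omega> * W \<omega>)" "expectation (\<lambda>\<omega>. Z \<omega> * W \<omega>) = expectation Z * expectation W"
    using Z W by (auto intro: indep_var_integrable indep_var_lebesgue_integral)
qed

end

section \<open>Elementary stochastic integrals\<close>

text \<open>The coefficient of \<open>norm b\<close> can be brought arbitrarily close to 1, at the
  price of a large coefficient on the difference, which tends to 0 in the application. The plain
  bound with factor 2 would spoil the constant 1 in \<open>M_bound\<close>.\<close>

lemma norm_sq_le_weighted:
  fixes a b :: "'a::real_normed_vector"
  assumes "\<delta> > 0"
  shows "(norm a)\<^sup>2 \<le> (1 + \<delta>) * (norm b)\<^sup>2 + (1 + 1 / \<delta>) * (norm (a - b))\<^sup>2"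
proof -
  have "(norm a)\<^sup>2 \<le> (norm b + norm (a - b))\<^sup>2"
    by (intro power_mono) (simp_all add: norm_triangle_sub)
  also have "\<dots> = (norm b)\<^sup>2 + (norm (a - b))\<^sup>2 + 2 * (sqrt \<delta> * norm b) * (norm (a - b) / sqrt \<delta>)"
    using assms by (simp add: power2_eq_square algebra_simps)
  also have "\<dots> \<le> (norm b)\<^sup>2 + (norm (a - b))\<^sup>2 + ((sqrt \<delta> * norm b)\<^sup>2 + (norm (a - b) / sqrt \<delta>)\<^sup>2)"
    by (intro add_left_mono sum_squares_bound)
  also have "\<dots> = (1 + \<delta>) * (norm b)\<^sup>2 + (1 + 1 / \<delta>) * (norm (a - b))\<^sup>2"
    using assms by (simp add: power_mult_distrib power_divide algebra_simps)
  finally show ?thesis .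
qed

lemma norm_sum_sq:
  fixes f :: "nat \<Rightarrow> 'a::real_inner"
  shows "(norm (\<Sum>k<n. f k))\<^sup>2 = (\<Sum>k<n. \<Sum>l<n. f k \<bullet> f l)"
  unfolding power2_norm_eq_inner by (subst inner_sum_left, subst inner_sum_right) (rule refl)

lemma integral_sum_sum:
  fixes f :: "nat \<Rightarrow> nat \<Rightarrow> 'a \<Rightarrow> real"
  assumes "\<And>k l. k < n \<Longrightarrow> l < n \<Longrightarrow> integrable M (f k l)"
  shows "integrable M (\<lambda>x. \<Sum>k<n. \<Sum>l<n. f k l x)"
    and "(\<integral>x. (\<Sum>k<n. \<Sum>l<n. f k l x) \<partial>M) = (\<Sum>k<n. \<Sum>l<n. \<integral>x. f k l x \<partial>M)"
proof -
  show "integrable M (\<lambda>x. \<Sum>k<n. \<Sum>l<n. f k l x)"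
    using assms by (intro Bochner_Integration.integrable_sum) auto
  have "(\<integral>x. (\<Sum>k<n. \<Sum>l<n. f k l x) \<partial>M) = (\<Sum>k<n. \<integral>x. (\<Sum>l<n. f k l x) \<partial>M)"
    using assms by (intro Bochner_Integration.integral_sum Bochner_Integration.integrable_sum) auto
  also have "\<dots> = (\<Sum>k<n. \<Sum>l<n. \<integral>x. f k l x \<partial>M)"
    using assms by (intro sum.cong refl Bochner_Integration.integral_sum) auto
  finally show "(\<integral>x. (\<Sum>k<n. \<Sum>l<n. f k l x) \<partial>M) = (\<Sum>k<n. \<Sum>l<n. \<integral>x. f k l x \<partial>M)" .
qed

context prm
begin

lemma sets_restrict_Ioc: "0 \<le> a \<Longrightarrow> {a<..b} \<in> sets (restrict_space lborel {0::real..})"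
  by (subst sets_restrict_space_iff) auto

lemma sets_rect [intro]: "0 \<le> a \<Longrightarrow> S \<in> sets m \<Longrightarrow> {a<..b} \<times> S \<in> sets \<Lambda>"
  unfolding intensity_def by (intro pair_measureI sets_restrict_Ioc)

lemma emeasure_rect:
  assumes "0 \<le> a" "S \<in> sets m"
  shows "emeasure \<Lambda> ({a<..b} \<times> S) = emeasure lborel {a<..b} * emeasure m S"
proof -
  have "emeasure (restrict_space lborel {0..}) {a<..b} = emeasure lborel {a<..b}"
    using assms(1) by (intro emeasure_restrict_space) auto
  then show ?thesis
    unfolding intensity_def
    using sigma_finite_measure.emeasure_pair_measure_Times[OF sfm sets_restrict_Ioc[OF assms(1)] assms(2)]
    by simp
qed

lemma emeasure_rect_finite:
  assumes "0 \<le> a" "S \<in> sets m" "emeasure m S < \<top>"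
  shows "emeasure \<Lambda> ({a<..b} \<times> S) < \<top>"
proof -
  have "emeasure lborel {a<..b} < \<top>" by (cases "a \<le> b") auto
  then show ?thesis using assms by (simp add: emeasure_rect ennreal_mult_less_top)
qed

lemma Nh_adapted:
  assumes "X \<in> sets \<Lambda>" "X \<subseteq> {0..t} \<times> space m" "t \<ge> 0"
  shows "Nh X \<in> borel_measurable (F t)"
proof -
  have "(\<lambda>\<omega>. emeasure (\<mu> \<omega>) X) \<in> borel_measurable (F t)"
    using prm assms unfolding poisson_random_measure_def by simp
  then show ?thesis unfolding compensated_def measure_def
    by (intro borel_measurable_diff borel_measurable_enn2real borel_measurable_const)
qed

end

text \<open>An \<open>elementary\<close> list in indexed form, so that squares become double sums
  over \<open>k\<close> and \<open>l\<close>. The results return to lists in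
  \<open>elementary_integral_facts\<close>.\<close>

locale elem_integrand = prm P F m \<mu>
  for P :: "'w measure" and F m and \<mu> :: "'w \<Rightarrow> (real \<times> 'z) measure" +
  fixes n :: nat and a b :: "nat \<Rightarrow> real"
    and \<xi> :: "nat \<Rightarrow> 'w \<Rightarrow> 'h::{real_inner, second_countable_topology}" and S :: "nat \<Rightarrow> 'z set"
  assumes a: "k < n \<Longrightarrow> 0 \<le> a k" and ab: "k < n \<Longrightarrow> a k \<le> b k"
    and \<xi>: "k < n \<Longrightarrow> \<xi> k \<in> borel_measurable (F (a k))" and bdd: "k < n \<Longrightarrow> bounded (\<xi> k ` space P)"
    and S [measurable]: "k < n \<Longrightarrow> S k \<in> sets m" and Sfin: "k < n \<Longrightarrow> emeasure m (S k) < \<infinity>"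
begin

definition R :: "nat \<Rightarrow> real \<Rightarrow> (real \<times> 'z) set" where
  "R k t = {min (a k) t<..min (b k) t} \<times> S k"

definition I :: "real \<Rightarrow> 'w \<Rightarrow> 'h" where
  "I t \<omega> = (\<Sum>k<n. Nh (R k t) \<omega> *\<^sub>R \<xi> k \<omega>)"

definition e :: "real \<Rightarrow> 'w \<Rightarrow> 'z \<Rightarrow> 'h" where
  "e s \<omega> z = (\<Sum>k<n. (indicator {a k<..b k} s * indicator (S k) z :: real) *\<^sub>R \<xi> k \<omega>)"

lemma xi_P [measurable]: "k < n \<Longrightarrow> \<xi> k \<in> borel_measurable P"
  using measurable_F_P[OF \<xi> a] .

lemma xi_bound: "k < n \<Longrightarrow> \<exists>C. \<forall>\<omega>\<in>space P. norm (\<xi> k \<omega>) \<le> C"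
  using bdd by (auto simp: bounded_iff)

lemma R_sets: "k < n \<Longrightarrow> t \<ge> 0 \<Longrightarrow> R k t \<in> sets \<Lambda>"
  and R_fin: "k < n \<Longrightarrow> t \<ge> 0 \<Longrightarrow> emeasure \<Lambda> (R k t) < \<infinity>"
  unfolding R_def using a[of k] S[of k] Sfin[of k] by (auto intro!: emeasure_rect_finite sets_rect)

lemma S_sub: "k < n \<Longrightarrow> S k \<subseteq> space m"
  using S sets.sets_into_space by blast

lemma sq_integrable_bounded_mult:
  assumes "sq_integrable P f" "g \<in> borel_measurable P" "\<forall>\<omega>\<in>space P. norm (g \<omega>) \<le> C"
  shows "sq_integrable P (\<lambda>\<omega>. (f \<omega> :: real) *\<^sub>R (g \<omega> :: 'h))"
  unfolding sq_integrable_def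
proof
  note [measurable] = assms(2) sq_integrableD(1)[OF assms(1)]
  show [measurable]: "(\<lambda>\<omega>. f \<omega> *\<^sub>R g \<omega>) \<in> borel_measurable P" by measurable
  show "integrable P (\<lambda>\<omega>. (norm (f \<omega> *\<^sub>R g \<omega>))\<^sup>2)"
  proof (rule Bochner_Integration.integrable_bound)
    show "integrable P (\<lambda>\<omega>. C\<^sup>2 * (norm (f \<omega>))\<^sup>2)"
      using sq_integrableD(2)[OF assms(1)] by simp
    have "(norm (f \<omega> *\<^sub>R g \<omega>))\<^sup>2 \<le> C\<^sup>2 * (norm (f \<omega>))\<^sup>2" if "\<omega> \<in> space P" for \<omega>
    proof -
      have "(norm (g \<omega>))\<^sup>2 \<le> C\<^sup>2" using assms(3) that by (intro power_mono) auto
      then show ?thesis by (simp add: power_mult_distrib mult.commute[of "(f \<omega>)\<^sup>2"] mult_right_mono)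
    qed
    then show "AE \<omega> in P. norm ((norm (f \<omega> *\<^sub>R g \<omega>))\<^sup>2) \<le> norm (C\<^sup>2 * (norm (f \<omega>))\<^sup>2)"
      by (intro AE_I2) simp
  qed measurable
qed

lemma term_sq_integrable: "k < n \<Longrightarrow> X \<in> sets \<Lambda> \<Longrightarrow> emeasure \<Lambda> X < \<infinity> \<Longrightarrow> sq_integrable P (\<lambda>\<omega>. Nh X \<omega> *\<^sub>R \<xi> k \<omega>)"
  using xi_bound[of k] sq_integrable_bounded_mult[OF Nh_moments(1) xi_P] by blast

lemma I_sq_integrable: "t \<ge> 0 \<Longrightarrow> sq_integrable P (I t)"
  unfolding I_def by (intro sq_integrable_sum term_sq_integrable R_sets R_fin) auto

lemma xi_sq_integrable: "k < n \<Longrightarrow> sq_integrable P (\<xi> k)"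
proof -
  assume k: "k < n"
  have "sq_integrable P (\<lambda>_. 1 :: real)" by (simp add: sq_integrable_def)
  then show ?thesis
    using xi_bound[OF k] sq_integrable_bounded_mult[OF _ xi_P[OF k], of "\<lambda>_. 1"] by auto
qed

lemma xi_inner_F:
  assumes "k < n" "l < n" "a k \<le> c" "a l \<le> c"
  shows "(\<lambda>\<omega>. \<xi> k \<omega> \<bullet> \<xi> l \<omega>) \<in> borel_measurable (F c)"
proof -
  have "\<xi> k \<in> borel_measurable (F c)" "\<xi> l \<in> borel_measurable (F c)"
    using assms measurable_F_mono \<xi> a by blast+
  then show ?thesis by measurable
qed

text \<open>Time is cut at \<open>c = a l\<close>, the later of the two starting times, at which
  both weights are known. The part \<open>R1\<close> before \<open>c\<close> joins the weights in
  the past and multiplies future noise of mean 0; the part \<open>R2\<close> after \<open>c\<close>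
  and \<open>R l t\<close> are both future noise, so their covariance factors out.\<close>

lemma covariance_aux:
  assumes k: "k < n" and l: "l < n" and kl: "a k \<le> a l" and t: "t \<ge> 0"
  shows "expectation (\<lambda>\<omega>. (Nh (R k t) \<omega> *\<^sub>R \<xi> k \<omega>) \<bullet> (Nh (R l t) \<omega> *\<^sub>R \<xi> l \<omega>)) =
    expectation (\<lambda>\<omega>. \<xi> k \<omega> \<bullet> \<xi> l \<omega>) * measure \<Lambda> (R k t \<inter> R l t)"
proof -
  define c where "c = a l"
  define R1 where "R1 = {min (a k) t<..min (min (b k) c) t} \<times> S k"
  define R2 where "R2 = {max c (min (a k) t)<..min (b k) t} \<times> S k"
  have c0: "c \<ge> 0" using a l by (simp add: c_def)
  have R1: "R1 \<in> sets \<Lambda>" "emeasure \<Lambda> R1 < \<infinity>" and R2: "R2 \<in> sets \<Lambda>" "emeasure \<Lambda> R2 < \<infinity>"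
    unfolding R1_def R2_def using a[OF k] c0 t S[OF k] Sfin[OF k] by (auto intro!: emeasure_rect_finite sets_rect)
  note Rl = R_sets[OF l t] R_fin[OF l t]
  have disj: "R1 \<inter> R2 = {}" "R1 \<inter> R l t = {}" and un: "R1 \<union> R2 = R k t"
    using kl by (auto simp: R1_def R2_def R_def c_def)
  have R1sub: "R1 \<subseteq> {0..c} \<times> space m"
    using S_sub[OF k] a[OF k] t by (auto simp: R1_def)
  have R2sub: "R2 \<subseteq> {c<..} \<times> space m" and Rlsub: "R l t \<subseteq> {c<..} \<times> space m"
    using S_sub[OF k] S_sub[OF l] by (auto simp: R2_def R_def c_def)
  have xiF: "(\<lambda>\<omega>. \<xi> k \<omega> \<bullet> \<xi> l \<omega>) \<in> borel_measurable (F c)"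
    using k l kl by (intro xi_inner_F) (auto simp: c_def)
  have xi_int: "integrable P (\<lambda>\<omega>. \<xi> k \<omega> \<bullet> \<xi> l \<omega>)"
    by (intro sq_integrable_inner xi_sq_integrable k l)
  have Nl: "Nh (R l t) \<in> borel_measurable (future c)"
    by (intro Nh_measurable_future Rl Rlsub)
  have "Nh R1 \<in> borel_measurable (F c)" by (intro Nh_adapted R1 R1sub c0)
  then have Z1F: "(\<lambda>\<omega>. Nh R1 \<omega> * (\<xi> k \<omega> \<bullet> \<xi> l \<omega>)) \<in> borel_measurable (F c)"
    using xiF by measurable
  have "integrable P (\<lambda>\<omega>. (Nh R1 \<omega> *\<^sub>R \<xi> k \<omega>) \<bullet> \<xi> l \<omega>)"
    by (intro sq_integrable_inner xi_sq_integrable term_sq_integrable k l R1)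
  then have Z1: "integrable P (\<lambda>\<omega>. Nh R1 \<omega> * (\<xi> k \<omega> \<bullet> \<xi> l \<omega>))" by simp
  note p1 = independent_of_past[OF c0 Z1F Z1 Nl Nh_moments(2)[OF Rl]]
  have "Nh R2 \<in> borel_measurable (future c)" by (intro Nh_measurable_future R2 R2sub)
  then have W2: "(\<lambda>\<omega>. Nh R2 \<omega> * Nh (R l t) \<omega>) \<in> borel_measurable (future c)"
    using Nl by measurable
  note p2 = independent_of_past[OF c0 xiF xi_int W2 Nh_product_integrable[OF R2 Rl]]
  have int: "R k t \<inter> R l t = R2 \<inter> R l t" using disj un by blast
  have "AE \<omega> in P. Nh (R k t) \<omega> = Nh R1 \<omega> + Nh R2 \<omega>"
    using AE_Nh_Un[OF R1 R2 disj(1)] by (simp add: un)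
  then have "expectation (\<lambda>\<omega>. (Nh (R k t) \<omega> *\<^sub>R \<xi> k \<omega>) \<bullet> (Nh (R l t) \<omega> *\<^sub>R \<xi> l \<omega>)) =
    expectation (\<lambda>\<omega>. Nh R1 \<omega> * (\<xi> k \<omega> \<bullet> \<xi> l \<omega>) * Nh (R l t) \<omega> + (\<xi> k \<omega> \<bullet> \<xi> l \<omega>) * (Nh R2 \<omega> * Nh (R l t) \<omega>))"
    using k l R1(1) R2(1) Rl(1) R_sets[OF k t] by (intro integral_cong_AE) (auto simp: algebra_simps)
  also have "\<dots> = expectation (\<lambda>\<omega>. \<xi> k \<omega> \<bullet> \<xi> l \<omega>) * measure \<Lambda> (R2 \<inter> R l t)"
    using p1 p2 Nh_moments(3)[OF Rl] Nh_covariance[OF R2 Rl] by simp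
  finally show ?thesis using int by simp
qed

lemma covariance:
  assumes k: "k < n" and l: "l < n" and t: "t \<ge> 0"
  shows "expectation (\<lambda>\<omega>. (Nh (R k t) \<omega> *\<^sub>R \<xi> k \<omega>) \<bullet> (Nh (R l t) \<omega> *\<^sub>R \<xi> l \<omega>)) =
    expectation (\<lambda>\<omega>. \<xi> k \<omega> \<bullet> \<xi> l \<omega>) * measure \<Lambda> (R k t \<inter> R l t)"
proof (cases "a k \<le> a l")
  case True
  then show ?thesis by (intro covariance_aux assms)
next
  case False
  then show ?thesis using covariance_aux[OF l k _ t] by (simp add: inner_commute Int_commute)
qed

text \<open>The right side is kept as the expectation of a pathwise double sum, because
  \<open>pathwise_isometry\<close> identifies that very sum with the squared norm of the
  integrand.\<close>

lemma I_isometry: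
  assumes t: "t \<ge> 0"
  shows "expectation (\<lambda>\<omega>. (norm (I t \<omega>))\<^sup>2) =
    expectation (\<lambda>\<omega>. \<Sum>k<n. \<Sum>l<n. (\<xi> k \<omega> \<bullet> \<xi> l \<omega>) * measure \<Lambda> (R k t \<inter> R l t))"
proof -
  have int: "integrable P (\<lambda>\<omega>. (Nh (R k t) \<omega> *\<^sub>R \<xi> k \<omega>) \<bullet> (Nh (R l t) \<omega> *\<^sub>R \<xi> l \<omega>))" if "k < n" "l < n" for k l
    by (intro sq_integrable_inner term_sq_integrable R_sets R_fin t that)
  have int2: "integrable P (\<lambda>\<omega>. \<xi> k \<omega> \<bullet> \<xi> l \<omega>)" if "k < n" "l < n" for k l
    by (intro sq_integrable_inner xi_sq_integrable that)
  have "expectation (\<lambda>\<omega>. (norm (I t \<omega>))\<^sup>2) =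
    expectation (\<lambda>\<omega>. \<Sum>k<n. \<Sum>l<n. (Nh (R k t) \<omega> *\<^sub>R \<xi> k \<omega>) \<bullet> (Nh (R l t) \<omega> *\<^sub>R \<xi> l \<omega>))"
    unfolding I_def norm_sum_sq ..
  also have "\<dots> = (\<Sum>k<n. \<Sum>l<n. expectation (\<lambda>\<omega>. \<xi> k \<omega> \<bullet> \<xi> l \<omega>) * measure \<Lambda> (R k t \<inter> R l t))"
    by (subst integral_sum_sum(2)[OF int]) (assumption, assumption, intro sum.cong refl covariance t, simp_all)
  also have "\<dots> = expectation (\<lambda>\<omega>. \<Sum>k<n. \<Sum>l<n. (\<xi> k \<omega> \<bullet> \<xi> l \<omega>) * measure \<Lambda> (R k t \<inter> R l t))"
    using int2 by (subst integral_sum_sum(2)) auto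
  finally show ?thesis .
qed

lemma R_inter_measure:
  assumes "k < n" "l < n" "t \<ge> 0"
  shows "measure \<Lambda> (R k t \<inter> R l t) =
    measure lborel ({0..t} \<inter> {a k<..b k} \<inter> {a l<..b l}) * measure m (S k \<inter> S l)"
proof -
  let ?c = "max (min (a k) t) (min (a l) t)" and ?d = "min (min (b k) t) (min (b l) t)"
  have "R k t \<inter> R l t = {?c<..?d} \<times> (S k \<inter> S l)"
    by (auto simp: R_def)
  moreover have "{0..t} \<inter> {a k<..b k} \<inter> {a l<..b l} = {?c<..?d}"
    using a[OF assms(1)] a[OF assms(2)] by auto
  moreover have "?c \<ge> 0" using a[OF assms(1)] assms(3) by simp
  ultimately show ?thesis
    using emeasure_rect[of ?c "S k \<inter> S l" ?d] assms by (simp add: measure_def enn2real_mult)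
qed

text \<open>For fixed \<open>\<omega>\<close> the square of the step function expands into products
  of indicators, and the integral of each product is the intensity of an intersection of
  rectangles.\<close>

lemma pathwise_isometry:
  assumes t: "t \<ge> 0"
  shows "(\<integral>\<^sup>+s\<in>{0..t}. (\<integral>\<^sup>+z. ennreal ((norm (e s \<omega> z))\<^sup>2) \<partial>m) \<partial>lborel) =
    ennreal (\<Sum>k<n. \<Sum>l<n. (\<xi> k \<omega> \<bullet> \<xi> l \<omega>) * measure \<Lambda> (R k t \<inter> R l t))"
    and "0 \<le> (\<Sum>k<n. \<Sum>l<n. (\<xi> k \<omega> \<bullet> \<xi> l \<omega>) * measure \<Lambda> (R k t \<inter> R l t))"
proof -
  define i where "i = (\<lambda>k l s. indicator ({a k<..b k} \<inter> {a l<..b l}) s :: real)"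
  define j where "j = (\<lambda>k l z. indicator (S k \<inter> S l) z :: real)"
  define g where "g = (\<lambda>s. \<Sum>k<n. \<Sum>l<n. (\<xi> k \<omega> \<bullet> \<xi> l \<omega>) * (i k l s * measure m (S k \<inter> S l)))"
  have e: "(norm (e s \<omega> z))\<^sup>2 = (\<Sum>k<n. \<Sum>l<n. (\<xi> k \<omega> \<bullet> \<xi> l \<omega>) * (i k l s * j k l z))" for s z
    unfolding e_def norm_sum_sq i_def j_def
    by (intro sum.cong refl) (simp add: indicator_inter_arith del: Int_greaterThanAtMost)
  have fin: "emeasure m (S k \<inter> S l) < \<infinity>" if "k < n" "l < n" for k l
    using emeasure_mono[of "S k \<inter> S l" "S k" m] S[OF that(1)] Sfin[OF that(1)] by (auto intro: le_less_trans)
  have jint: "integrable m (j k l)" if "k < n" "l < n" for k l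
    using S fin that unfolding j_def by (intro integrable_real_indicator) auto
  have jval: "(\<integral>z. j k l z \<partial>m) = measure m (S k \<inter> S l)" if "k < n" "l < n" for k l
    using S S_sub that unfolding j_def by (simp add: Int_absorb2 le_infI1)
  have int: "integrable m (\<lambda>z. (norm (e s \<omega> z))\<^sup>2)" for s
    unfolding e using jint by (intro integral_sum_sum(1)) auto
  have gval: "(\<integral>z. (norm (e s \<omega> z))\<^sup>2 \<partial>m) = g s" for s
    unfolding e g_def using jint jval by (subst integral_sum_sum(2)) auto
  have inner: "(\<integral>\<^sup>+z. ennreal ((norm (e s \<omega> z))\<^sup>2) \<partial>m) = ennreal (g s)" for s
    using int gval by (subst nn_integral_eq_integral) auto
  have g0: "g s \<ge> 0" for s
    unfolding gval[symmetric] by simp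
  have gi: "g s * indicator {0..t} s = (\<Sum>k<n. \<Sum>l<n. (\<xi> k \<omega> \<bullet> \<xi> l \<omega>) * measure m (S k \<inter> S l) *
      indicator ({0..t} \<inter> {a k<..b k} \<inter> {a l<..b l}) s)" for s
    unfolding g_def i_def sum_distrib_right
    by (intro sum.cong refl) (simp add: indicator_inter_arith ac_simps)
  have fin2: "emeasure lborel ({0..t} \<inter> {a k<..b k} \<inter> {a l<..b l}) < \<infinity>" for k l
  proof -
    have "emeasure lborel ({0..t} \<inter> {a k<..b k} \<inter> {a l<..b l}) \<le> emeasure lborel {0..t}"
      by (intro emeasure_mono) auto
    also have "\<dots> < \<top>" using t by simp
    finally show ?thesis by simp
  qed
  have ii: "integrable lborel (indicator ({0..t} \<inter> {a k<..b k} \<inter> {a l<..b l}) :: real \<Rightarrow> real)" for k l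
    using fin2 by (intro integrable_real_indicator) auto
  have gint: "integrable lborel (\<lambda>s. g s * indicator {0..t} s)"
    unfolding gi using ii by (intro integral_sum_sum(1)) auto
  have gI: "(\<integral>s. g s * indicator {0..t} s \<partial>lborel) = (\<Sum>k<n. \<Sum>l<n. (\<xi> k \<omega> \<bullet> \<xi> l \<omega>) * measure \<Lambda> (R k t \<inter> R l t))"
    unfolding gi using ii R_inter_measure t
    by (subst integral_sum_sum(2)) (auto intro!: sum.cong)
  have "(\<integral>\<^sup>+s\<in>{0..t}. (\<integral>\<^sup>+z. ennreal ((norm (e s \<omega> z))\<^sup>2) \<partial>m) \<partial>lborel) = (\<integral>\<^sup>+s. ennreal (g s * indicator {0..t} s) \<partial>lborel)"
    unfolding inner by (intro nn_integral_cong) (auto simp: indicator_def)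
  also have "\<dots> = ennreal (\<integral>s. g s * indicator {0..t} s \<partial>lborel)"
    using gint g0 by (intro nn_integral_eq_integral) auto
  finally show "(\<integral>\<^sup>+s\<in>{0..t}. (\<integral>\<^sup>+z. ennreal ((norm (e s \<omega> z))\<^sup>2) \<partial>m) \<partial>lborel) =
    ennreal (\<Sum>k<n. \<Sum>l<n. (\<xi> k \<omega> \<bullet> \<xi> l \<omega>) * measure \<Lambda> (R k t \<inter> R l t))"
    unfolding gI .
  \<comment> \<open>The double sum has no evident sign; it inherits one from the integral of the
    nonnegative function \<open>g\<close>.\<close>
  show "0 \<le> (\<Sum>k<n. \<Sum>l<n. (\<xi> k \<omega> \<bullet> \<xi> l \<omega>) * measure \<Lambda> (R k t \<inter> R l t))"
    unfolding gI[symmetric] using g0 by simp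
qed

lemma isometry:
  assumes t: "t \<ge> 0"
  shows "(\<integral>\<^sup>+\<omega>. ennreal ((norm (I t \<omega>))\<^sup>2) \<partial>P) =
    (\<integral>\<^sup>+\<omega>. (\<integral>\<^sup>+s\<in>{0..t}. (\<integral>\<^sup>+z. ennreal ((norm (e s \<omega> z))\<^sup>2) \<partial>m) \<partial>lborel) \<partial>P)"
proof -
  have "integrable P (\<lambda>\<omega>. \<Sum>k<n. \<Sum>l<n. (\<xi> k \<omega> \<bullet> \<xi> l \<omega>) * measure \<Lambda> (R k t \<inter> R l t))"
    by (intro Bochner_Integration.integrable_sum integrable_mult_left sq_integrable_inner xi_sq_integrable) auto
  then have "(\<integral>\<^sup>+\<omega>. (\<integral>\<^sup>+s\<in>{0..t}. (\<integral>\<^sup>+z. ennreal ((norm (e s \<omega> z))\<^sup>2) \<partial>m) \<partial>lborel) \<partial>P) =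
     ennreal (expectation (\<lambda>\<omega>. \<Sum>k<n. \<Sum>l<n. (\<xi> k \<omega> \<bullet> \<xi> l \<omega>) * measure \<Lambda> (R k t \<inter> R l t)))"
    unfolding pathwise_isometry(1)[OF t] using pathwise_isometry(2)[OF t]
    by (intro nn_integral_eq_integral) auto
  also have "\<dots> = ennreal (expectation (\<lambda>\<omega>. (norm (I t \<omega>))\<^sup>2))"
    unfolding I_isometry[OF t] ..
  also have "\<dots> = (\<integral>\<^sup>+\<omega>. ennreal ((norm (I t \<omega>))\<^sup>2) \<partial>P)"
    using sq_integrableD(2)[OF I_sq_integrable[OF t]] by (intro nn_integral_eq_integral[symmetric]) auto
  finally show ?thesis by simp
qed

text \<open>The increment of each term is its weight times noise on a rectangle \<open>D\<close>
  after \<open>c = max (a k) r\<close>. At time \<open>c\<close> both \<open>\<eta>\<close> and the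
  weight are known, so the factor of mean 0 splits off.\<close>

lemma I_martingale:
  fixes \<eta> :: "'w \<Rightarrow> 'h"
  assumes r: "0 \<le> r" "r \<le> t" and \<eta>: "\<eta> \<in> borel_measurable (F r)" "sq_integrable P \<eta>"
  shows "expectation (\<lambda>\<omega>. \<eta> \<omega> \<bullet> (I t \<omega> - I r \<omega>)) = 0"
proof -
  have t: "t \<ge> 0" using r by simp
  have eq: "\<eta> \<omega> \<bullet> (I t \<omega> - I r \<omega>) = (\<Sum>k<n. \<eta> \<omega> \<bullet> (Nh (R k t) \<omega> *\<^sub>R \<xi> k \<omega>) - \<eta> \<omega> \<bullet> (Nh (R k r) \<omega> *\<^sub>R \<xi> k \<omega>))" for \<omega>
    by (simp add: I_def inner_diff_right inner_sum_right sum_subtractf)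
  have int: "integrable P (\<lambda>\<omega>. \<eta> \<omega> \<bullet> (Nh (R k t) \<omega> *\<^sub>R \<xi> k \<omega>) - \<eta> \<omega> \<bullet> (Nh (R k r) \<omega> *\<^sub>R \<xi> k \<omega>))" if "k < n" for k
    using that r t by (intro Bochner_Integration.integrable_diff sq_integrable_inner \<eta> term_sq_integrable R_sets R_fin)
  have "expectation (\<lambda>\<omega>. \<eta> \<omega> \<bullet> (Nh (R k t) \<omega> *\<^sub>R \<xi> k \<omega>) - \<eta> \<omega> \<bullet> (Nh (R k r) \<omega> *\<^sub>R \<xi> k \<omega>)) = 0" if k: "k < n" for k
  proof -
    define c where "c = max (a k) r"
    \<comment> \<open>The maximum with \<open>r\<close> makes \<open>D\<close> empty if the interval
      of the term ends before \<open>r\<close>; the minima with \<open>t\<close> do so if it starts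
      after \<open>t\<close>.\<close>
    define D where "D = {min c t<..min (max (b k) r) t} \<times> S k"
    have c0: "c \<ge> 0" using r by (simp add: c_def)
    have D: "D \<in> sets \<Lambda>" "emeasure \<Lambda> D < \<infinity>"
      unfolding D_def using c0 t S[OF k] Sfin[OF k] by (auto intro!: emeasure_rect_finite sets_rect)
    have Dsub: "D \<subseteq> {c<..} \<times> space m" using S_sub[OF k] ab[OF k] by (auto simp: D_def c_def)
    have un: "R k r \<union> D = R k t" "R k r \<inter> D = {}"
      using r ab[OF k] by (auto simp: R_def D_def c_def min_def max_def split: if_splits)
    have AE: "AE \<omega> in P. Nh (R k t) \<omega> = Nh (R k r) \<omega> + Nh D \<omega>"
      using AE_Nh_Un[OF R_sets[OF k r(1)] R_fin[OF k r(1)] D un(2)] by (simp add: un)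
    have "\<eta> \<in> borel_measurable (F c)" "\<xi> k \<in> borel_measurable (F c)"
      using measurable_F_mono[OF \<eta>(1) r(1)] measurable_F_mono[OF \<xi>[OF k] a[OF k]] by (auto simp: c_def)
    then have Z: "(\<lambda>\<omega>. \<eta> \<omega> \<bullet> \<xi> k \<omega>) \<in> borel_measurable (F c)" by measurable
    have "integrable P (\<lambda>\<omega>. \<eta> \<omega> \<bullet> \<xi> k \<omega>)"
      by (intro sq_integrable_inner \<eta> xi_sq_integrable k)
    note p = independent_of_past[OF c0 Z this Nh_measurable_future[OF D(1) Dsub] Nh_moments(2)[OF D]]
    have "expectation (\<lambda>\<omega>. \<eta> \<omega> \<bullet> (Nh (R k t) \<omega> *\<^sub>R \<xi> k \<omega>) - \<eta> \<omega> \<bullet> (Nh (R k r) \<omega> *\<^sub>R \<xi> k \<omega>)) =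
      expectation (\<lambda>\<omega>. (\<eta> \<omega> \<bullet> \<xi> k \<omega>) * Nh D \<omega>)"
      using k R_sets[OF k r(1)] R_sets[OF k t] D(1) AE sq_integrableD(1)[OF \<eta>(2)]
      by (intro integral_cong_AE) (auto simp: algebra_simps)
    then show ?thesis using p(2) Nh_moments(3)[OF D] by simp
  qed
  then show ?thesis unfolding eq using int by (simp add: Bochner_Integration.integral_sum)
qed

lemma e_measurable: "(\<lambda>((\<omega>, s), z). e s \<omega> z) \<in> borel_measurable ((P \<Otimes>\<^sub>M lborel) \<Otimes>\<^sub>M m)"
  unfolding e_def case_prod_beta
proof (intro borel_measurable_sum)
  fix k assume "k \<in> {..<n}"
  then have [measurable]: "S k \<in> sets m" "\<xi> k \<in> borel_measurable P" by auto
  show "(\<lambda>p. (indicator {a k<..b k} (snd (fst p)) * indicator (S k) (snd p) :: real) *\<^sub>R \<xi> k (fst (fst p)))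
    \<in> borel_measurable ((P \<Otimes>\<^sub>M lborel) \<Otimes>\<^sub>M m)"
    by measurable
qed

end

section \<open>The stochastic integral as a square-integrable martingale\<close>

lemma ennreal_norm_sq_le_weighted:
  fixes a b :: "'a::real_normed_vector"
  assumes "\<delta> > 0"
  shows "ennreal ((norm a)\<^sup>2) \<le> ennreal (1 + \<delta>) * ennreal ((norm b)\<^sup>2) + ennreal (1 + 1 / \<delta>) * ennreal ((norm (a - b))\<^sup>2)"
  using norm_sq_le_weighted[OF assms, of a b] assms
  by (simp flip: ennreal_mult ennreal_plus)

lemma nn_integral_iterated_linear:
  fixes f g :: "'a \<Rightarrow> real \<Rightarrow> ennreal"
  assumes [measurable]: "(\<lambda>(\<omega>, s). f \<omega> s) \<in> borel_measurable (M \<Otimes>\<^sub>M lborel)"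
    "(\<lambda>(\<omega>, s). g \<omega> s) \<in> borel_measurable (M \<Otimes>\<^sub>M lborel)"
  shows "(\<integral>\<^sup>+\<omega>. (\<integral>\<^sup>+s. c * f \<omega> s + d * g \<omega> s \<partial>lborel) \<partial>M) =
    c * (\<integral>\<^sup>+\<omega>. (\<integral>\<^sup>+s. f \<omega> s \<partial>lborel) \<partial>M) + d * (\<integral>\<^sup>+\<omega>. (\<integral>\<^sup>+s. g \<omega> s \<partial>lborel) \<partial>M)"
proof -
  have fst: "(\<integral>\<^sup>+\<omega>. (\<integral>\<^sup>+s. h (\<omega>, s) \<partial>lborel) \<partial>M) = integral\<^sup>N (M \<Otimes>\<^sub>M lborel) h"
    if "h \<in> borel_measurable (M \<Otimes>\<^sub>M lborel)" for h
    using lborel.nn_integral_fst[OF that] .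
  let ?f = "\<lambda>(\<omega>, s). f \<omega> s" and ?g = "\<lambda>(\<omega>, s). g \<omega> s"
  have "(\<integral>\<^sup>+x. c * ?f x + d * ?g x \<partial>(M \<Otimes>\<^sub>M lborel)) =
      c * integral\<^sup>N (M \<Otimes>\<^sub>M lborel) ?f + d * integral\<^sup>N (M \<Otimes>\<^sub>M lborel) ?g"
    using assms by (subst nn_integral_add) (auto simp: nn_integral_cmult)
  then show ?thesis
    using fst[of "\<lambda>x. c * ?f x + d * ?g x"] fst[of ?f] fst[of ?g] assms by simp
qed

context prm
begin

lemma elementary_integral_facts:
  fixes es :: "('w, 'h::{real_inner, second_countable_topology}, 'z) elementary"
  assumes el: "elementary P F m es"
  shows elementary_sq_integrable: "\<And>t. t \<ge> 0 \<Longrightarrow> sq_integrable P (elementary_integral m \<mu> es t)"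
    and elementary_isometry: "\<And>t. t \<ge> 0 \<Longrightarrow> (\<integral>\<^sup>+\<omega>. ennreal ((norm (elementary_integral m \<mu> es t \<omega>))\<^sup>2) \<partial>P) =
      (\<integral>\<^sup>+\<omega>. (\<integral>\<^sup>+s\<in>{0..t}. (\<integral>\<^sup>+z. ennreal ((norm (elementary_fun es s \<omega> z))\<^sup>2) \<partial>m) \<partial>lborel) \<partial>P)"
    and elementary_martingale: "\<And>r t \<eta>. 0 \<le> r \<Longrightarrow> r \<le> t \<Longrightarrow> \<eta> \<in> borel_measurable (F r) \<Longrightarrow> sq_integrable P \<eta> \<Longrightarrow>
      expectation (\<lambda>\<omega>. \<eta> \<omega> \<bullet> (elementary_integral m \<mu> es t \<omega> - elementary_integral m \<mu> es r \<omega>)) = 0"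
    and elementary_fun_measurable: "(\<lambda>((\<omega>, s), z). elementary_fun es s \<omega> z) \<in> borel_measurable ((P \<Otimes>\<^sub>M lborel) \<Otimes>\<^sub>M m)"
proof -
  define n where "n = length es"
  define a where "a k = fst (es ! k)" for k
  define b where "b k = fst (snd (es ! k))" for k
  define \<xi> where "\<xi> k = fst (snd (snd (es ! k)))" for k
  define S where "S k = snd (snd (snd (es ! k)))" for k
  have es: "es ! k \<in> set es" if "k < n" for k using that by (simp add: n_def)
  have props: "0 \<le> a k \<and> a k \<le> b k \<and> \<xi> k \<in> borel_measurable (F (a k)) \<and> bounded (\<xi> k ` space P) \<and> S k \<in> sets m \<and> emeasure m (S k) < \<infinity>"
    if "k < n" for k
    using el[unfolded elementary_def, rule_format, OF es[OF that]]
    unfolding a_def b_def \<xi>_def S_def by (simp add: split_beta)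
  interpret E: elem_integrand P F m \<mu> n a b \<xi> S
    by unfold_locales (use props in blast)+
  have I: "elementary_integral m \<mu> es = E.I"
    unfolding elementary_integral_def E.I_def E.R_def
    by (auto simp: fun_eq_iff sum_list_sum_nth n_def atLeast0LessThan split_beta a_def b_def \<xi>_def S_def intro!: sum.cong)
  have e: "elementary_fun es = E.e"
    unfolding elementary_fun_def E.e_def
    by (auto simp: fun_eq_iff sum_list_sum_nth n_def atLeast0LessThan split_beta a_def b_def \<xi>_def S_def intro!: sum.cong)
  show "\<And>t. t \<ge> 0 \<Longrightarrow> sq_integrable P (elementary_integral m \<mu> es t)"
    unfolding I by (rule E.I_sq_integrable)
  show "\<And>t. t \<ge> 0 \<Longrightarrow> (\<integral>\<^sup>+\<omega>. ennreal ((norm (elementary_integral m \<mu> es t \<omega>))\<^sup>2) \<partial>P) =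
      (\<integral>\<^sup>+\<omega>. (\<integral>\<^sup>+s\<in>{0..t}. (\<integral>\<^sup>+z. ennreal ((norm (elementary_fun es s \<omega> z))\<^sup>2) \<partial>m) \<partial>lborel) \<partial>P)"
    unfolding I e by (rule E.isometry)
  show "\<And>r t \<eta>. 0 \<le> r \<Longrightarrow> r \<le> t \<Longrightarrow> \<eta> \<in> borel_measurable (F r) \<Longrightarrow> sq_integrable P \<eta> \<Longrightarrow>
      expectation (\<lambda>\<omega>. \<eta> \<omega> \<bullet> (elementary_integral m \<mu> es t \<omega> - elementary_integral m \<mu> es r \<omega>)) = 0"
    unfolding I by (rule E.I_martingale)
  show "(\<lambda>((\<omega>, s), z). elementary_fun es s \<omega> z) \<in> borel_measurable ((P \<Otimes>\<^sub>M lborel) \<Otimes>\<^sub>M m)"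
    unfolding e by (rule E.e_measurable)
qed

end

locale stoch_int = prm P F m \<mu>
  for P :: "'w measure" and F m and \<mu> :: "'w \<Rightarrow> (real \<times> 'z) measure" +
  fixes \<Phi> :: "real \<Rightarrow> 'w \<Rightarrow> 'z \<Rightarrow> 'h::{real_inner, second_countable_topology}" and M :: "real \<Rightarrow> 'w \<Rightarrow> 'h"
  assumes int: "has_stochastic_integral P F m \<mu> \<Phi> M"
begin

lemma M_adapted: "t \<ge> 0 \<Longrightarrow> M t \<in> borel_measurable (F t)"
  using int unfolding has_stochastic_integral_def adapted_def by blast

lemma M_measurable: "t \<ge> 0 \<Longrightarrow> M t \<in> borel_measurable P"
  using measurable_F_P[OF M_adapted] .

lemma M_cadlag: "\<omega> \<in> space P \<Longrightarrow> cadlag (\<lambda>t. M t \<omega>)"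
  using int unfolding has_stochastic_integral_def by blast

definition es :: "nat \<Rightarrow> ('w, 'h, 'z) elementary" where
  "es = (SOME es. (\<forall>n. elementary P F m (es n)) \<and>
        (\<forall>T\<ge>0. (\<lambda>n. \<integral>\<^sup>+\<omega>. (\<integral>\<^sup>+s\<in>{0..T}. (\<integral>\<^sup>+z.
            ennreal ((norm (\<Phi> s \<omega> z - elementary_fun (es n) s \<omega> z))\<^sup>2) \<partial>m) \<partial>lborel) \<partial>P)
          \<longlonglongrightarrow> 0) \<and>
        (\<forall>t\<ge>0. (\<lambda>n. \<integral>\<^sup>+\<omega>.
            ennreal ((norm (M t \<omega> - elementary_integral m \<mu> (es n) t \<omega>))\<^sup>2) \<partial>P)
          \<longlonglongrightarrow> 0))"

lemma
  shows es: "elementary P F m (es n)"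
    and es_fun: "T \<ge> 0 \<Longrightarrow> (\<lambda>n. \<integral>\<^sup>+\<omega>. (\<integral>\<^sup>+s\<in>{0..T}. (\<integral>\<^sup>+z.
            ennreal ((norm (\<Phi> s \<omega> z - elementary_fun (es n) s \<omega> z))\<^sup>2) \<partial>m) \<partial>lborel) \<partial>P) \<longlonglongrightarrow> 0"
    and es_integral: "t \<ge> 0 \<Longrightarrow> (\<lambda>n. \<integral>\<^sup>+\<omega>.
            ennreal ((norm (M t \<omega> - elementary_integral m \<mu> (es n) t \<omega>))\<^sup>2) \<partial>P) \<longlonglongrightarrow> 0"
proof -
  note ex = int[unfolded has_stochastic_integral_def, THEN conjunct2, THEN conjunct2, THEN conjunct2, THEN conjunct2]
  note * = someI_ex[OF ex, folded es_def]
  show "elementary P F m (es n)" using * by simp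
  show "T \<ge> 0 \<Longrightarrow> (\<lambda>n. \<integral>\<^sup>+\<omega>. (\<integral>\<^sup>+s\<in>{0..T}. (\<integral>\<^sup>+z.
            ennreal ((norm (\<Phi> s \<omega> z - elementary_fun (es n) s \<omega> z))\<^sup>2) \<partial>m) \<partial>lborel) \<partial>P) \<longlonglongrightarrow> 0"
    using *[THEN conjunct2, THEN conjunct1] by simp
  show "t \<ge> 0 \<Longrightarrow> (\<lambda>n. \<integral>\<^sup>+\<omega>.
            ennreal ((norm (M t \<omega> - elementary_integral m \<mu> (es n) t \<omega>))\<^sup>2) \<partial>P) \<longlonglongrightarrow> 0"
    using *[THEN conjunct2, THEN conjunct2] by simp
qed

lemma M_sq_integrable:
  assumes t: "t \<ge> 0"
  shows "sq_integrable P (M t)"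
proof -
  have "\<forall>\<^sub>F n in sequentially. (\<integral>\<^sup>+\<omega>. ennreal ((norm (M t \<omega> - elementary_integral m \<mu> (es n) t \<omega>))\<^sup>2) \<partial>P) < 1"
    using es_integral[OF t] by (rule order_tendstoD) simp
  then obtain n where n: "(\<integral>\<^sup>+\<omega>. ennreal ((norm (M t \<omega> - elementary_integral m \<mu> (es n) t \<omega>))\<^sup>2) \<partial>P) < 1"
    by (meson eventually_happens sequentially_bot)
  note I = elementary_sq_integrable[OF es[of n] t]
  note [measurable] = M_measurable[OF t] sq_integrableD(1)[OF I]
  have "sq_integrable P (\<lambda>\<omega>. M t \<omega> - elementary_integral m \<mu> (es n) t \<omega>)"
    using n by (intro sq_integrableI_nn) (auto intro: less_trans)
  from sq_integrable_add[OF this I] show ?thesis by simp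
qed

text \<open>The elementary integrals have this property, and the errors at both times tend to 0 in
  mean square. Young's inequality with a parameter replaces Cauchy-Schwarz: first \<open>n\<close>
  tends to infinity, then the parameter to 0.\<close>

lemma M_martingale:
  assumes r: "0 \<le> r" "r \<le> t" and \<eta>: "\<eta> \<in> borel_measurable (F r)" "sq_integrable P \<eta>"
  shows "expectation (\<lambda>\<omega>. \<eta> \<omega> \<bullet> (M t \<omega> - M r \<omega>)) = 0"
proof -
  have t: "t \<ge> 0" using r by simp
  define d where "d t n \<omega> = M t \<omega> - elementary_integral m \<mu> (es n) t \<omega>" for t n \<omega>
  have dsq: "sq_integrable P (d t n)" if "t \<ge> 0" for t n
    unfolding d_def by (intro sq_integrable_diff M_sq_integrable elementary_sq_integrable es that)
  have dlim: "(\<lambda>n. expectation (\<lambda>\<omega>. (norm (d t n \<omega>))\<^sup>2)) \<longlonglongrightarrow> 0" if "t \<ge> 0" for t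
  proof -
    have "(\<integral>\<^sup>+\<omega>. ennreal ((norm (d t n \<omega>))\<^sup>2) \<partial>P) = ennreal (expectation (\<lambda>\<omega>. (norm (d t n \<omega>))\<^sup>2))" for n
      using sq_integrableD(2)[OF dsq[OF that]] by (intro nn_integral_eq_integral) auto
    then have "(\<lambda>n. ennreal (expectation (\<lambda>\<omega>. (norm (d t n \<omega>))\<^sup>2))) \<longlonglongrightarrow> ennreal 0"
      using es_integral[OF that] by (simp add: d_def)
    then show ?thesis by (subst (asm) tendsto_ennreal_iff) auto
  qed
  let ?L = "expectation (\<lambda>\<omega>. \<eta> \<omega> \<bullet> (M t \<omega> - M r \<omega>))" and ?E = "expectation (\<lambda>\<omega>. (norm (\<eta> \<omega>))\<^sup>2)"
  let ?d = "\<lambda>t n. expectation (\<lambda>\<omega>. (norm (d t n \<omega>))\<^sup>2)"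
  have bound: "\<bar>?L\<bar> \<le> \<epsilon> * ?E + (1 / \<epsilon>) * (?d t n + ?d r n)" if \<epsilon>: "\<epsilon> > 0" for \<epsilon> n
  proof -
    have i1: "integrable P (\<lambda>\<omega>. \<eta> \<omega> \<bullet> (elementary_integral m \<mu> (es n) t \<omega> - elementary_integral m \<mu> (es n) r \<omega>))"
      by (intro sq_integrable_inner sq_integrable_diff elementary_sq_integrable es t r \<eta>)
    have i2: "integrable P (\<lambda>\<omega>. \<eta> \<omega> \<bullet> d t n \<omega> - \<eta> \<omega> \<bullet> d r n \<omega>)"
      by (intro Bochner_Integration.integrable_diff sq_integrable_inner dsq t r \<eta>)
    have "?L = expectation (\<lambda>\<omega>. \<eta> \<omega> \<bullet> (elementary_integral m \<mu> (es n) t \<omega> - elementary_integral m \<mu> (es n) r \<omega>)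
        + (\<eta> \<omega> \<bullet> d t n \<omega> - \<eta> \<omega> \<bullet> d r n \<omega>))"
      by (intro Bochner_Integration.integral_cong) (auto simp: d_def inner_diff_right)
    also have "\<dots> = expectation (\<lambda>\<omega>. \<eta> \<omega> \<bullet> d t n \<omega> - \<eta> \<omega> \<bullet> d r n \<omega>)"
      using i1 i2 elementary_martingale[OF es r \<eta>] by simp
    also have "\<bar>\<dots>\<bar> \<le> expectation (\<lambda>\<omega>. \<bar>\<eta> \<omega> \<bullet> d t n \<omega> - \<eta> \<omega> \<bullet> d r n \<omega>\<bar>)"
      by (rule integral_abs_bound)
    also have "\<dots> \<le> expectation (\<lambda>\<omega>. \<epsilon> * (norm (\<eta> \<omega>))\<^sup>2 + (1 / \<epsilon>) * ((norm (d t n \<omega>))\<^sup>2 + (norm (d r n \<omega>))\<^sup>2))"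
    proof (rule integral_mono)
      show "integrable P (\<lambda>\<omega>. \<epsilon> * (norm (\<eta> \<omega>))\<^sup>2 + (1 / \<epsilon>) * ((norm (d t n \<omega>))\<^sup>2 + (norm (d r n \<omega>))\<^sup>2))"
        using sq_integrableD(2)[OF \<eta>(2)] sq_integrableD(2)[OF dsq[OF t]] sq_integrableD(2)[OF dsq[OF r(1)]] by auto
      fix \<omega>
      have *: "\<bar>\<eta> \<omega> \<bullet> x\<bar> \<le> \<epsilon> * (norm (\<eta> \<omega>))\<^sup>2 / 2 + (1 / \<epsilon>) * (norm x)\<^sup>2" for x
      proof -
        have "\<bar>\<eta> \<omega> \<bullet> x\<bar> = \<bar>(sqrt \<epsilon> *\<^sub>R \<eta> \<omega>) \<bullet> ((1 / sqrt \<epsilon>) *\<^sub>R x)\<bar>" using \<epsilon> by simp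
        also have "\<dots> \<le> ((norm (sqrt \<epsilon> *\<^sub>R \<eta> \<omega>))\<^sup>2 + (norm ((1 / sqrt \<epsilon>) *\<^sub>R x))\<^sup>2) / 2"
          by (rule inner_abs_le_half)
        also have "\<dots> = \<epsilon> * (norm (\<eta> \<omega>))\<^sup>2 / 2 + (1 / \<epsilon>) * (norm x)\<^sup>2 / 2"
          using \<epsilon> by (simp add: power_mult_distrib power_divide add_divide_distrib)
        also have "\<dots> \<le> \<epsilon> * (norm (\<eta> \<omega>))\<^sup>2 / 2 + (1 / \<epsilon>) * (norm x)\<^sup>2"
          using \<epsilon> by (simp add: field_simps)
        finally show ?thesis .
      qed
      show "\<bar>\<eta> \<omega> \<bullet> d t n \<omega> - \<eta> \<omega> \<bullet> d r n \<omega>\<bar> \<le> \<epsilon> * (norm (\<eta> \<omega>))\<^sup>2 + (1 / \<epsilon>) * ((norm (d t n \<omega>))\<^sup>2 + (norm (d r n \<omega>))\<^sup>2)"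
        using *[of "d t n \<omega>"] *[of "d r n \<omega>"] by (simp add: distrib_left)
    qed (use i2 in auto)
    also have "\<dots> = \<epsilon> * ?E + (1 / \<epsilon>) * (?d t n + ?d r n)"
      using sq_integrableD(2)[OF \<eta>(2)] sq_integrableD(2)[OF dsq[OF t]] sq_integrableD(2)[OF dsq[OF r(1)]] by simp
    finally show ?thesis .
  qed
  have "\<bar>?L\<bar> \<le> \<epsilon> * ?E" if \<epsilon>: "\<epsilon> > 0" for \<epsilon>
  proof -
    have "(\<lambda>n. \<epsilon> * ?E + (1 / \<epsilon>) * (?d t n + ?d r n)) \<longlonglongrightarrow> \<epsilon> * ?E + (1 / \<epsilon>) * (0 + 0)"
      by (intro tendsto_intros dlim t r)
    then show ?thesis using bound[OF \<epsilon>] by (intro LIMSEQ_le_const) auto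
  qed
  then have ev: "\<forall>\<^sub>F \<epsilon> in at_right 0. \<bar>?L\<bar> \<le> \<epsilon> * ?E" by (auto simp: eventually_at_filter)
  have "((\<lambda>\<epsilon>. \<epsilon> * ?E) \<longlongrightarrow> 0 * ?E) (at_right 0)" by (intro tendsto_intros)
  from tendsto_lowerbound[OF this ev] show ?thesis by simp
qed

text \<open>This is the isometry as an inequality with constant 1. The integrand
  \<open>\<Phi>\<close> is replaced by a version \<open>\<Phi>'\<close> that is measurable for the
  product of \<open>P\<close>, Lebesgue measure and \<open>m\<close>, as iterated integration
  requires; in the application \<open>\<Phi>\<close> contains left limits and \<open>\<Phi>'\<close>
  the values themselves.\<close>

lemma M_bound:
  fixes \<Phi>' :: "real \<Rightarrow> 'w \<Rightarrow> 'z \<Rightarrow> 'h"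
  assumes t: "t \<ge> 0"
    and meas [measurable]: "(\<lambda>((\<omega>, s), z). \<Phi>' s \<omega> z) \<in> borel_measurable ((P \<Otimes>\<^sub>M lborel) \<Otimes>\<^sub>M m)"
    and eq: "\<And>\<omega>. \<omega> \<in> space P \<Longrightarrow> AE s in lborel. 0 \<le> s \<longrightarrow> (\<forall>z\<in>space m. \<Phi> s \<omega> z = \<Phi>' s \<omega> z)"
  shows "ennreal (expectation (\<lambda>\<omega>. (norm (M t \<omega>))\<^sup>2)) \<le>
    (\<integral>\<^sup>+\<omega>. (\<integral>\<^sup>+s\<in>{0..t}. (\<integral>\<^sup>+z. ennreal ((norm (\<Phi>' s \<omega> z))\<^sup>2) \<partial>m) \<partial>lborel) \<partial>P)" (is "?L \<le> ?X")
proof -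
  interpret m: sigma_finite_measure m by (rule sfm)
  define I where "I n = elementary_integral m \<mu> (es n) t" for n
  define e where "e n = elementary_fun (es n)" for n
  have I [measurable]: "I n \<in> borel_measurable P" for n
    unfolding I_def using sq_integrableD(1)[OF elementary_sq_integrable[OF es t]] .
  have e [measurable]: "(\<lambda>((\<omega>, s), z). e n s \<omega> z) \<in> borel_measurable ((P \<Otimes>\<^sub>M lborel) \<Otimes>\<^sub>M m)" for n
    unfolding e_def by (rule elementary_fun_measurable[OF es])
  note [measurable] = M_measurable[OF t]
  have inner: "(\<lambda>(\<omega>, s). (\<integral>\<^sup>+z. ennreal ((norm (f s \<omega> z))\<^sup>2) \<partial>m) * indicator {0..t} s) \<in> borel_measurable (P \<Otimes>\<^sub>M lborel)"
    if f: "(\<lambda>((\<omega>, s), z). f s \<omega> z) \<in> borel_measurable ((P \<Otimes>\<^sub>M lborel) \<Otimes>\<^sub>M m)" for f :: "real \<Rightarrow> 'w \<Rightarrow> 'z \<Rightarrow> 'h"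
  proof -
    have "(\<lambda>(x, z). ennreal ((norm (f (snd x) (fst x) z))\<^sup>2)) \<in> borel_measurable ((P \<Otimes>\<^sub>M lborel) \<Otimes>\<^sub>M m)"
      using measurable_compose[OF f, of "\<lambda>y. ennreal ((norm y)\<^sup>2)" borel] by (simp add: split_beta)
    then have "(\<lambda>x. \<integral>\<^sup>+z. ennreal ((norm (f (snd x) (fst x) z))\<^sup>2) \<partial>m) \<in> borel_measurable (P \<Otimes>\<^sub>M lborel)"
      by (rule m.borel_measurable_nn_integral)
    moreover have "(\<lambda>x. indicator {0..t} (snd x) :: ennreal) \<in> borel_measurable (P \<Otimes>\<^sub>M lborel)"
      by (rule measurable_compose[OF measurable_snd]) simp
    ultimately show ?thesis by (simp add: split_beta borel_measurable_times_ennreal)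
  qed
  have meas_diff: "(\<lambda>((\<omega>, s), z). \<Phi>' s \<omega> z - e n s \<omega> z) \<in> borel_measurable ((P \<Otimes>\<^sub>M lborel) \<Otimes>\<^sub>M m)" for n
    using borel_measurable_diff[OF meas e[of n]] unfolding case_prod_beta .
  define N where "N f = (\<integral>\<^sup>+\<omega>. (\<integral>\<^sup>+s\<in>{0..t}. (\<integral>\<^sup>+z. ennreal ((norm (f s \<omega> z :: 'h))\<^sup>2) \<partial>m) \<partial>lborel) \<partial>P)" for f
  have mz: "(\<lambda>z. f s \<omega> z) \<in> borel_measurable m"
    if "(\<lambda>((\<omega>, s), z). f s \<omega> z) \<in> borel_measurable ((P \<Otimes>\<^sub>M lborel) \<Otimes>\<^sub>M m)" "\<omega> \<in> space P"
    for f :: "real \<Rightarrow> 'w \<Rightarrow> 'z \<Rightarrow> 'h" and s \<omega>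
    using measurable_compose[OF measurable_Pair1'[of "(\<omega>, s)" "P \<Otimes>\<^sub>M lborel" m] that(1)] that(2)
    by (simp add: space_pair_measure)
  have diff: "N (\<lambda>s \<omega> z. \<Phi> s \<omega> z - e n s \<omega> z) = N (\<lambda>s \<omega> z. \<Phi>' s \<omega> z - e n s \<omega> z)" for n
    unfolding N_def
  proof (rule nn_integral_cong, rule nn_integral_cong_AE)
    fix \<omega> assume "\<omega> \<in> space P"
    from eq[OF this] show "AE s in lborel. (\<integral>\<^sup>+z. ennreal ((norm (\<Phi> s \<omega> z - e n s \<omega> z))\<^sup>2) \<partial>m) * indicator {0..t} s =
        (\<integral>\<^sup>+z. ennreal ((norm (\<Phi>' s \<omega> z - e n s \<omega> z))\<^sup>2) \<partial>m) * indicator {0..t} s"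
    proof eventually_elim
      case (elim s)
      then show ?case
        by (cases "s \<in> {0..t}") (auto intro!: nn_integral_cong arg_cong2[where f = "(*)"])
    qed
  qed
  have dlim: "(\<lambda>n. N (\<lambda>s \<omega> z. \<Phi>' s \<omega> z - e n s \<omega> z)) \<longlonglongrightarrow> 0"
    unfolding diff[symmetric] unfolding N_def e_def by (rule es_fun[OF t])
  have Ilim: "(\<lambda>n. \<integral>\<^sup>+\<omega>. ennreal ((norm (M t \<omega> - I n \<omega>))\<^sup>2) \<partial>P) \<longlonglongrightarrow> 0"
    using es_integral[OF t] unfolding I_def .
  have L: "?L = (\<integral>\<^sup>+\<omega>. ennreal ((norm (M t \<omega>))\<^sup>2) \<partial>P)"
    using sq_integrableD(2)[OF M_sq_integrable[OF t]] by (intro nn_integral_eq_integral[symmetric]) auto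
  have step1: "?L \<le> ennreal (1 + \<delta>) * N (e n) + ennreal (1 + 1 / \<delta>) * (\<integral>\<^sup>+\<omega>. ennreal ((norm (M t \<omega> - I n \<omega>))\<^sup>2) \<partial>P)"
    if "\<delta> > 0" for \<delta> n
  proof -
    have "?L \<le> (\<integral>\<^sup>+\<omega>. ennreal (1 + \<delta>) * ennreal ((norm (I n \<omega>))\<^sup>2) + ennreal (1 + 1 / \<delta>) * ennreal ((norm (M t \<omega> - I n \<omega>))\<^sup>2) \<partial>P)"
      unfolding L by (intro nn_integral_mono ennreal_norm_sq_le_weighted that)
    also have "\<dots> = ennreal (1 + \<delta>) * (\<integral>\<^sup>+\<omega>. ennreal ((norm (I n \<omega>))\<^sup>2) \<partial>P) + ennreal (1 + 1 / \<delta>) * (\<integral>\<^sup>+\<omega>. ennreal ((norm (M t \<omega> - I n \<omega>))\<^sup>2) \<partial>P)"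
      by (simp add: nn_integral_add nn_integral_cmult)
    finally show ?thesis
      unfolding I_def elementary_isometry[OF es t] N_def e_def .
  qed
  have step2: "N (e n) \<le> ennreal (1 + \<delta>) * ?X + ennreal (1 + 1 / \<delta>) * N (\<lambda>s \<omega> z. \<Phi>' s \<omega> z - e n s \<omega> z)"
    if \<delta>: "\<delta> > 0" for \<delta> n
  proof -
    have pt: "ennreal ((norm (e n s \<omega> z))\<^sup>2) \<le> ennreal (1 + \<delta>) * ennreal ((norm (\<Phi>' s \<omega> z))\<^sup>2) +
        ennreal (1 + 1 / \<delta>) * ennreal ((norm (\<Phi>' s \<omega> z - e n s \<omega> z))\<^sup>2)" for s \<omega> z
      using ennreal_norm_sq_le_weighted[OF \<delta>, of "e n s \<omega> z" "\<Phi>' s \<omega> z"] by (simp add: norm_minus_commute)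
    have "N (e n) \<le> (\<integral>\<^sup>+\<omega>. (\<integral>\<^sup>+s\<in>{0..t}. (\<integral>\<^sup>+z. ennreal (1 + \<delta>) * ennreal ((norm (\<Phi>' s \<omega> z))\<^sup>2) +
        ennreal (1 + 1 / \<delta>) * ennreal ((norm (\<Phi>' s \<omega> z - e n s \<omega> z))\<^sup>2) \<partial>m) \<partial>lborel) \<partial>P)"
      unfolding N_def by (intro nn_integral_mono mult_right_mono pt) simp
    also have "\<dots> = (\<integral>\<^sup>+\<omega>. (\<integral>\<^sup>+s\<in>{0..t}. (ennreal (1 + \<delta>) * (\<integral>\<^sup>+z. ennreal ((norm (\<Phi>' s \<omega> z))\<^sup>2) \<partial>m) +
        ennreal (1 + 1 / \<delta>) * (\<integral>\<^sup>+z. ennreal ((norm (\<Phi>' s \<omega> z - e n s \<omega> z))\<^sup>2) \<partial>m)) \<partial>lborel) \<partial>P)"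
    proof (intro nn_integral_cong arg_cong2[where f = "(*)"] refl)
      fix \<omega> s assume "\<omega> \<in> space P"
      note [measurable] = mz[OF meas this, of s] mz[OF e this, of n s]
      show "(\<integral>\<^sup>+z. ennreal (1 + \<delta>) * ennreal ((norm (\<Phi>' s \<omega> z))\<^sup>2) +
          ennreal (1 + 1 / \<delta>) * ennreal ((norm (\<Phi>' s \<omega> z - e n s \<omega> z))\<^sup>2) \<partial>m) =
        ennreal (1 + \<delta>) * (\<integral>\<^sup>+z. ennreal ((norm (\<Phi>' s \<omega> z))\<^sup>2) \<partial>m) +
          ennreal (1 + 1 / \<delta>) * (\<integral>\<^sup>+z. ennreal ((norm (\<Phi>' s \<omega> z - e n s \<omega> z))\<^sup>2) \<partial>m)"
        by (simp add: nn_integral_add nn_integral_cmult)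
    qed
    also have "\<dots> = (\<integral>\<^sup>+\<omega>. (\<integral>\<^sup>+s. ennreal (1 + \<delta>) * ((\<integral>\<^sup>+z. ennreal ((norm (\<Phi>' s \<omega> z))\<^sup>2) \<partial>m) * indicator {0..t} s) +
        ennreal (1 + 1 / \<delta>) * ((\<integral>\<^sup>+z. ennreal ((norm (\<Phi>' s \<omega> z - e n s \<omega> z))\<^sup>2) \<partial>m) * indicator {0..t} s) \<partial>lborel) \<partial>P)"
      by (intro nn_integral_cong) (simp add: distrib_right mult.assoc)
    also have "\<dots> = ennreal (1 + \<delta>) * ?X + ennreal (1 + 1 / \<delta>) * N (\<lambda>s \<omega> z. \<Phi>' s \<omega> z - e n s \<omega> z)"
      unfolding N_def by (rule nn_integral_iterated_linear) (intro inner meas, intro inner meas_diff)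
    finally show ?thesis .
  qed
  \<comment> \<open>The weighted inequality is used twice, from \<open>M t\<close> to the elementary
    integral and from the elementary integrand to \<open>\<Phi>'\<close>. Both error terms vanish as
    \<open>n\<close> grows, and two factors \<open>1 + \<delta>\<close> remain, which tend to 1
    afterwards.\<close>
  have main: "?L \<le> ennreal (1 + \<delta>) * (ennreal (1 + \<delta>) * ?X)" if \<delta>: "\<delta> > 0" for \<delta>
  proof -
    have lim: "(\<lambda>n. ennreal (1 + \<delta>) * (ennreal (1 + \<delta>) * ?X + ennreal (1 + 1 / \<delta>) * N (\<lambda>s \<omega> z. \<Phi>' s \<omega> z - e n s \<omega> z))
        + ennreal (1 + 1 / \<delta>) * (\<integral>\<^sup>+\<omega>. ennreal ((norm (M t \<omega> - I n \<omega>))\<^sup>2) \<partial>P)) \<longlonglongrightarrow>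
        ennreal (1 + \<delta>) * (ennreal (1 + \<delta>) * ?X + ennreal (1 + 1 / \<delta>) * 0) + ennreal (1 + 1 / \<delta>) * 0"
      by (intro tendsto_add ennreal_tendsto_cmult tendsto_const dlim Ilim) auto
    have "?L \<le> ennreal (1 + \<delta>) * (ennreal (1 + \<delta>) * ?X + ennreal (1 + 1 / \<delta>) * N (\<lambda>s \<omega> z. \<Phi>' s \<omega> z - e n s \<omega> z))
        + ennreal (1 + 1 / \<delta>) * (\<integral>\<^sup>+\<omega>. ennreal ((norm (M t \<omega> - I n \<omega>))\<^sup>2) \<partial>P)" for n
      using step1[OF \<delta>, of n] step2[OF \<delta>, of n]
      by (meson add_right_mono mult_left_mono order_trans zero_le)
    with lim show ?thesis by (intro LIMSEQ_le_const[OF lim[simplified]]) auto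
  qed
  show ?thesis
  proof (cases ?X)
    case (real x)
    then have x: "?X = ennreal x" "x \<ge> 0" by auto
    let ?l = "expectation (\<lambda>\<omega>. (norm (M t \<omega>))\<^sup>2)"
    have "?l \<le> (1 + \<delta>) * ((1 + \<delta>) * x)" if \<delta>: "\<delta> > 0" for \<delta>
    proof -
      have "ennreal ?l \<le> ennreal ((1 + \<delta>) * ((1 + \<delta>) * x))"
        using main[OF \<delta>] \<delta> x by (simp add: ennreal_mult)
      then show ?thesis using \<delta> x by (subst (asm) ennreal_le_iff) auto
    qed
    then have ev: "\<forall>\<^sub>F \<delta> in at_right 0. ?l \<le> (1 + \<delta>) * ((1 + \<delta>) * x)" by (auto simp: eventually_at_filter)
    have "((\<lambda>\<delta>. (1 + \<delta>) * ((1 + \<delta>) * x)) \<longlongrightarrow> (1 + 0) * ((1 + 0) * x)) (at_right 0)"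
      by (intro tendsto_intros)
    from tendsto_lowerbound[OF this ev] show ?thesis using x by (simp add: ennreal_leI)
  qed simp
qed

end

section \<open>Right-continuous paths\<close>

text \<open>Time is rounded to a grid point strictly to its right, so that right-continuity gives
  convergence; the \<open>+ 1\<close> after the floor ensures strictness. Each approximation takes
  countably many times.\<close>

lemma right_cont_jointly_measurable:
  fixes f :: "real \<Rightarrow> 'a \<Rightarrow> 'b::{metric_space, second_countable_topology}"
  assumes meas: "\<And>t. t \<ge> 0 \<Longrightarrow> f t \<in> borel_measurable N"
    and cont: "\<And>a t. a \<in> space N \<Longrightarrow> t \<ge> 0 \<Longrightarrow> ((\<lambda>s. f s a) \<longlongrightarrow> f t a) (at_right t)"
  shows "(\<lambda>(a, t). f (max 0 t) a) \<in> borel_measurable (N \<Otimes>\<^sub>M lborel)"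
proof (rule borel_measurable_LIMSEQ_metric)
  define \<tau> where "\<tau> n t = (real (nat \<lfloor>real (Suc n) * max 0 t\<rfloor>) + 1) / real (Suc n)" for n and t :: real
  fix n
  let ?k = "\<lambda>x :: 'a \<times> real. nat \<lfloor>real (Suc n) * max 0 (snd x)\<rfloor>"
  have "(\<lambda>x. f ((real (?k x) + 1) / real (Suc n)) (fst x)) \<in> borel_measurable (N \<Otimes>\<^sub>M lborel)"
  proof (rule measurable_compose_countable[where f = "\<lambda>k x. f ((real k + 1) / real (Suc n)) (fst x)" and g = ?k])
    show "(\<lambda>x. f ((real k + 1) / real (Suc n)) (fst x)) \<in> borel_measurable (N \<Otimes>\<^sub>M lborel)" for k
      by (rule measurable_compose[OF measurable_fst meas]) simp
    have "(\<lambda>t :: real. nat \<lfloor>real (Suc n) * max 0 t\<rfloor>) \<in> measurable lborel (count_space UNIV)"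
      by measurable
    then show "?k \<in> measurable (N \<Otimes>\<^sub>M lborel) (count_space UNIV)"
      by (rule measurable_compose[OF measurable_snd])
  qed
  then show "(\<lambda>(a, t). f (\<tau> n t) a) \<in> borel_measurable (N \<Otimes>\<^sub>M lborel)"
    by (simp add: \<tau>_def split_beta)
next
  define \<tau> where "\<tau> n t = (real (nat \<lfloor>real (Suc n) * max 0 t\<rfloor>) + 1) / real (Suc n)" for n and t :: real
  fix x assume "x \<in> space (N \<Otimes>\<^sub>M (lborel :: real measure))"
  then obtain a t where x: "x = (a, t)" "a \<in> space N" by (auto simp: space_pair_measure)
  define y where "y = max 0 t"
  have gt: "max 0 t < \<tau> n t" and le: "\<tau> n t \<le> max 0 t + 1 / real (Suc n)" for n
  proof -
    have "y \<ge> 0" by (simp add: y_def)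
    then have fl: "real (nat \<lfloor>real (Suc n) * y\<rfloor>) = of_int \<lfloor>real (Suc n) * y\<rfloor>"
      by (simp add: of_nat_nat)
    have "real (Suc n) * y < real (nat \<lfloor>real (Suc n) * y\<rfloor>) + 1"
      unfolding fl by linarith
    then show "max 0 t < \<tau> n t" unfolding \<tau>_def y_def[symmetric] by (simp add: pos_less_divide_eq mult.commute del: of_nat_Suc)
    have "real (nat \<lfloor>real (Suc n) * y\<rfloor>) \<le> real (Suc n) * y"
      unfolding fl by linarith
    then show "\<tau> n t \<le> max 0 t + 1 / real (Suc n)"
      unfolding \<tau>_def y_def[symmetric] add_divide_distrib
      by (simp add: pos_divide_le_eq mult.commute del: of_nat_Suc)
  qed
  have "(\<lambda>n. \<tau> n t) \<longlonglongrightarrow> max 0 t"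
  proof (rule tendsto_sandwich[OF _ _ tendsto_const])
    show "\<forall>\<^sub>F n in sequentially. max 0 t \<le> \<tau> n t" using gt by (intro eventuallyI less_imp_le)
    show "\<forall>\<^sub>F n in sequentially. \<tau> n t \<le> max 0 t + 1 / real (Suc n)" using le by (intro eventuallyI)
    show "(\<lambda>n. max 0 t + 1 / real (Suc n)) \<longlonglongrightarrow> max 0 t"
      using tendsto_add[OF tendsto_const LIMSEQ_inverse_real_of_nat, of "max 0 t"] by (simp add: inverse_eq_divide)
  qed
  then have "filterlim (\<lambda>n. \<tau> n t) (at_right (max 0 t)) sequentially"
    unfolding filterlim_at using gt by (intro conjI eventuallyI) (auto simp: less_imp_neq[OF gt, symmetric])
  then have "(\<lambda>n. f (\<tau> n t) a) \<longlonglongrightarrow> f (max 0 t) a"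
    by (rule filterlim_compose[OF cont[OF x(2)], rotated]) simp
  then show "(\<lambda>n. case x of (a, t) \<Rightarrow> f ((real (nat \<lfloor>real (Suc n) * max 0 t\<rfloor>) + 1) / real (Suc n)) a) \<longlonglongrightarrow> (case x of (a, t) \<Rightarrow> f (max 0 t) a)"
    by (simp add: x \<tau>_def)
qed

lemma cadlag_left_limit:
  assumes "cadlag f" "t > 0"
  shows "(f \<longlongrightarrow> left_limit f t) (at_left t)"
proof -
  obtain l where "(f \<longlongrightarrow> l) (at_left t)" using assms by (auto simp: cadlag_def)
  then show ?thesis using assms(2) by (simp add: left_limit_def tendsto_Lim)
qed

text \<open>To the left of a jump of size at least \<open>\<epsilon>\<close> there is an interval without such jumps.\<close>

lemma cadlag_big_jumps_countable:
  fixes f :: "real \<Rightarrow> 'b::metric_space"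
  assumes f: "cadlag f" and \<epsilon>: "\<epsilon> > 0"
  shows "countable {s. s > 0 \<and> dist (f s) (left_limit f s) > \<epsilon>}"
proof -
  define S where "S = {s. s > 0 \<and> dist (f s) (left_limit f s) > \<epsilon>}"
  have ex: "\<exists>d. d > 0 \<and> (\<forall>r\<in>{s-d<..<s}. r \<notin> S)" if s: "s \<in> S" for s
  proof -
    have "\<forall>\<^sub>F r in at_left s. dist (f r) (left_limit f s) < \<epsilon> / 2"
      using cadlag_left_limit[OF f, of s] s \<epsilon> by (intro tendstoD) (auto simp: S_def)
    then obtain b where b: "b < s" "\<And>r. b < r \<Longrightarrow> r < s \<Longrightarrow> dist (f r) (left_limit f s) < \<epsilon> / 2"
      by (auto simp: eventually_at_left_field)
    have "r \<notin> S" if r: "b < r" "r < s" for r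
    proof
      assume "r \<in> S"
      then have r0: "r > 0" "dist (f r) (left_limit f r) > \<epsilon>" by (auto simp: S_def)
      have ev: "\<forall>\<^sub>F q in at_left r. dist (f q) (f r) \<le> \<epsilon>"
        unfolding eventually_at_left_field
      proof (intro exI[of _ b] conjI allI impI)
        fix q assume q: "b < q" "q < r"
        show "dist (f q) (f r) \<le> \<epsilon>"
          using dist_triangle2[of "f q" "f r" "left_limit f s"] b(2)[of q] b(2)[of r] q r by simp
      qed (rule r)
      have "((\<lambda>q. dist (f q) (f r)) \<longlongrightarrow> dist (left_limit f r) (f r)) (at_left r)"
        by (intro tendsto_intros cadlag_left_limit f r0)
      from tendsto_upperbound[OF this ev] show False using r0(2) by (simp add: dist_commute)
    qed
    then show ?thesis using b(1) by (intro exI[of _ "s - b"]) auto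
  qed
  obtain d where d: "\<forall>s\<in>S. d s > 0 \<and> (\<forall>r\<in>{s - d s<..<s}. r \<notin> S)"
    using bchoice[of S "\<lambda>s d. d > 0 \<and> (\<forall>r\<in>{s-d<..<s}. r \<notin> S)"] ex by blast
  \<comment> \<open>A rational number in the jump-free interval to the left of \<open>s\<close>
    increases strictly with \<open>s\<close>, so it labels the elements of \<open>S\<close>
    injectively.\<close>
  have "\<forall>s\<in>S. \<exists>q. q \<in> \<rat> \<and> s - d s < q \<and> q < s"
  proof
    fix s assume "s \<in> S"
    then have "s - d s < s" using d by simp
    from Rats_dense_in_real[OF this] show "\<exists>q. q \<in> \<rat> \<and> s - d s < q \<and> q < s" by blast
  qed
  then obtain q where q: "\<forall>s\<in>S. q s \<in> \<rat> \<and> s - d s < q s \<and> q s < s" by (rule bchoice[THEN exE])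
  have less: "q s < q s'" if "s \<in> S" "s' \<in> S" "s < s'" for s s'
  proof -
    have "s \<le> s' - d s'"
    proof (rule ccontr)
      assume "\<not> s \<le> s' - d s'"
      then have "s \<in> {s' - d s'<..<s'}" using that(3) by auto
      then show False using d that(1,2) by blast
    qed
    then show ?thesis using bspec[OF q that(1)] bspec[OF q that(2)] by linarith
  qed
  have "inj_on q S"
    by (rule linorder_inj_onI') (use less in \<open>metis less_irrefl\<close>)
  moreover have "countable (q ` S)"
    using q countable_rat by (auto intro: countable_subset)
  ultimately have "countable S" by (rule countable_image_inj_on[rotated])
  then show ?thesis by (simp add: S_def)
qed

text \<open>The exceptional times are countably many by \<open>cadlag_big_jumps_countable\<close>
  along \<open>1 / Suc n\<close>; time 0 is harmless since \<open>left_limit f 0\<close> is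
  \<open>f 0\<close>. In time integrals, left limits can thus be exchanged for values.\<close>

lemma cadlag_AE_continuous:
  fixes f :: "real \<Rightarrow> 'b::metric_space"
  assumes f: "cadlag f"
  shows "AE s in lborel. 0 \<le> s \<longrightarrow> left_limit f s = f s"
proof -
  have "{s. 0 \<le> s \<and> left_limit f s \<noteq> f s} \<subseteq> (\<Union>n. {s. s > 0 \<and> dist (f s) (left_limit f s) > 1 / real (Suc n)})"
  proof
    fix s assume s: "s \<in> {s. 0 \<le> s \<and> left_limit f s \<noteq> f s}"
    then have "s > 0" by (auto simp: left_limit_def order.order_iff_strict)
    moreover have "dist (f s) (left_limit f s) > 0" using s by auto
    then obtain n where "1 / real (Suc n) < dist (f s) (left_limit f s)" by (rule nat_approx_posE)
    ultimately show "s \<in> (\<Union>n. {s. s > 0 \<and> dist (f s) (left_limit f s) > 1 / real (Suc n)})" by auto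
  qed
  moreover have "countable (\<Union>n. {s. s > 0 \<and> dist (f s) (left_limit f s) > 1 / real (Suc n)})"
    using cadlag_big_jumps_countable[OF f] by auto
  ultimately have "{s. 0 \<le> s \<and> left_limit f s \<noteq> f s} \<in> null_sets lborel"
    by (intro countable_imp_null_set_lborel) (rule countable_subset)
  then show ?thesis by (rule AE_I') auto
qed

text \<open>Evaluation at \<open>v\<close> is bounded and linear, hence commutes with integrals of
  simple functions and with the limit. It reduces the equation in \<open>V'\<close> to real
  integrals.\<close>

lemma has_bochner_integral_normed_apply:
  fixes f :: "'a \<Rightarrow> ('v::real_normed_vector \<Rightarrow>\<^sub>L real)"
  assumes "has_bochner_integral_normed M f I"
  shows "has_bochner_integral M (\<lambda>x. f x v) (I v)"
proof -
  obtain s where f [measurable]: "f \<in> borel_measurable M"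
    and s: "\<And>n. Bochner_Integration.simple_bochner_integrable M (s n)"
    and lim: "(\<lambda>n. \<integral>\<^sup>+x. ennreal (norm (f x - s n x)) \<partial>M) \<longlonglongrightarrow> 0"
    and I: "(\<lambda>n. Bochner_Integration.simple_bochner_integral M (s n)) \<longlonglongrightarrow> I"
    using assms unfolding has_bochner_integral_normed_def by blast
  have ev: "(\<lambda>g :: 'v \<Rightarrow>\<^sub>L real. blinfun_apply g v) \<in> borel_measurable borel"
    by (intro borel_measurable_continuous_onI continuous_intros)
  have simp_f: "simple_function M (s n)" for n
    using s[of n] by (auto elim: simple_bochner_integrable.cases)
  show ?thesis
  proof (rule has_bochner_integral.intros)
    show "(\<lambda>x. f x v) \<in> borel_measurable M"
      using measurable_compose[OF f ev] .
    show "Bochner_Integration.simple_bochner_integrable M (\<lambda>x. s n x v)" for n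
      by (rule simple_bochner_integrable_compose2[where p = "\<lambda>g h. blinfun_apply g v", OF _ s s]) simp
    have "(\<integral>\<^sup>+x. ennreal (norm (f x v - s n x v)) \<partial>M) \<le> ennreal (norm v) * (\<integral>\<^sup>+x. ennreal (norm (f x - s n x)) \<partial>M)" for n
    proof -
      \<comment> \<open>Without second countability, differences of measurable maps need a separate
        argument: on each of the finitely many level sets of \<open>s n\<close> the expression is
        the distance of \<open>f\<close> to a constant.\<close>
      have [measurable]: "(\<lambda>x. norm (f x - s n x)) \<in> borel_measurable M"
      proof -
        have "(\<lambda>x. \<Sum>y\<in>s n ` space M. indicator (s n -` {y} \<inter> space M) x * norm (f x - y)) \<in> borel_measurable M"
        proof (intro borel_measurable_sum borel_measurable_times borel_measurable_indicator)
          fix y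
          show "s n -` {y} \<inter> space M \<in> sets M" using simp_f by (rule simple_functionD)
          have "(\<lambda>g :: 'v \<Rightarrow>\<^sub>L real. norm (g - y)) \<in> borel_measurable borel"
            by (intro borel_measurable_continuous_onI continuous_intros)
          then show "(\<lambda>x. norm (f x - y)) \<in> borel_measurable M" by (rule measurable_compose[OF f])
        qed
        moreover have "norm (f x - s n x) = (\<Sum>y\<in>s n ` space M. indicator (s n -` {y} \<inter> space M) x * norm (f x - y))"
          if x: "x \<in> space M" for x
        proof -
          have "(\<Sum>y\<in>s n ` space M. indicator (s n -` {y} \<inter> space M) x * norm (f x - y)) =
              (\<Sum>y\<in>s n ` space M. if y = s n x then norm (f x - y) else 0)"
            using x by (intro sum.cong) (auto simp: indicator_def)
          also have "\<dots> = norm (f x - s n x)"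
            using simple_functionD(1)[OF simp_f] x by simp
          finally show ?thesis by simp
        qed
        ultimately show ?thesis by (simp cong: measurable_cong)
      qed
      have "(\<integral>\<^sup>+x. ennreal (norm (f x v - s n x v)) \<partial>M) \<le> (\<integral>\<^sup>+x. ennreal (norm v) * ennreal (norm (f x - s n x)) \<partial>M)"
      proof (rule nn_integral_mono)
        fix x
        show "ennreal (norm (f x v - s n x v)) \<le> ennreal (norm v) * ennreal (norm (f x - s n x))"
          using norm_blinfun[of "f x - s n x" v]
          by (simp add: blinfun.diff_left mult.commute ennreal_leI flip: ennreal_mult)
      qed
      then show ?thesis by (simp add: nn_integral_cmult)
    qed
    note le = this
    have "(\<lambda>n. ennreal (norm v) * (\<integral>\<^sup>+x. ennreal (norm (f x - s n x)) \<partial>M)) \<longlonglongrightarrow> ennreal (norm v) * 0"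
      by (intro ennreal_tendsto_cmult lim) simp
    then show "(\<lambda>n. \<integral>\<^sup>+x. ennreal (norm (f x v - s n x v)) \<partial>M) \<longlonglongrightarrow> 0"
      by (intro tendsto_sandwich[OF always_eventually always_eventually tendsto_const, rule_format, OF zero_le le]) simp
    have "Bochner_Integration.simple_bochner_integral M (\<lambda>x. s n x v) = Bochner_Integration.simple_bochner_integral M (s n) v" for n
      by (rule simple_bochner_integral_linear[where f = "\<lambda>g. blinfun_apply g v", OF _ s])
         (rule bounded_linear.linear[OF blinfun.bounded_linear_left])
    then show "(\<lambda>n. Bochner_Integration.simple_bochner_integral M (\<lambda>x. s n x v)) \<longlonglongrightarrow> I v"
      by (simp add: tendsto_intros I)
  qed
qed

text \<open>Comparing \<open>a\<close> with \<open>\<delta> * b powr (p - 1)\<close> shows that one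
  of the two terms alone dominates the product. No optimal constants are sought, only an arbitrarily
  small factor at \<open>b powr p\<close>.\<close>

lemma young_scaled:
  fixes a b :: real
  assumes "a \<ge> 0" "b \<ge> 0" "\<delta> > 0" "p > 1"
  shows "a * b \<le> \<delta> * b powr p + \<delta> powr (- 1 / (p - 1)) * a powr (p / (p - 1))"
proof (cases "b = 0 \<or> a \<le> \<delta> * b powr (p - 1)")
  case True
  show ?thesis
  proof (cases "b = 0")
    case False
    then have "a * b \<le> (\<delta> * b powr (p - 1)) * b"
      using True assms by (intro mult_right_mono) auto
    also have "\<dots> = \<delta> * b powr p"
      using False assms by (simp add: powr_diff)
    finally show ?thesis by (smt (verit) powr_ge_zero mult_nonneg_nonneg)
  qed (use assms in simp)
next
  case False
  then have b: "b > 0" and a: "a > \<delta> * b powr (p - 1)" using assms by auto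
  then have "(b powr (p - 1)) powr (1 / (p - 1)) \<le> (a / \<delta>) powr (1 / (p - 1))"
    using assms by (intro powr_mono2) (auto simp: field_simps)
  then have "b \<le> (a / \<delta>) powr (1 / (p - 1))" using b assms by (simp add: powr_powr)
  then have "a * b \<le> a * (a / \<delta>) powr (1 / (p - 1))" using assms by (intro mult_left_mono) auto
  also have "\<dots> = \<delta> powr (- 1 / (p - 1)) * (a powr 1 * a powr (1 / (p - 1)))"
    using assms by (simp add: powr_divide powr_minus field_simps)
  also have "a powr 1 * a powr (1 / (p - 1)) = a powr (p / (p - 1))"
    unfolding powr_add[symmetric] using assms by (simp add: field_simps)
  finally show ?thesis using assms by (smt (verit) powr_ge_zero mult_nonneg_nonneg)
qed

text \<open>Beyond \<open>L = (\<kappa> / \<epsilon>) powr (1 / (p - 2))\<close> the power dominates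
  the square, and below \<open>L\<close> the square is at most the constant
  \<open>\<kappa> * L^2\<close>.\<close>

lemma square_le_powr:
  fixes \<kappa> \<epsilon> p :: real
  assumes "\<kappa> \<ge> 0" "\<epsilon> > 0" "p > 2"
  obtains C where "C \<ge> 0" "\<And>a. a \<ge> 0 \<Longrightarrow> \<kappa> * a\<^sup>2 \<le> \<epsilon> * a powr p + C"
proof -
  define L where "L = (\<kappa> / \<epsilon>) powr (1 / (p - 2))"
  have "\<kappa> * a\<^sup>2 \<le> \<epsilon> * a powr p + \<kappa> * L\<^sup>2" if a: "a \<ge> 0" for a
  proof (cases "a \<le> L")
    case True
    then have "\<kappa> * a\<^sup>2 \<le> \<kappa> * L\<^sup>2" using a assms by (intro mult_left_mono power_mono) auto
    then show ?thesis using assms by (smt (verit) powr_ge_zero mult_nonneg_nonneg)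
  next
    case False
    then have a0: "a > 0" unfolding L_def by (smt (verit) powr_ge_zero)
    have "L powr (p - 2) \<le> a powr (p - 2)" using False assms by (intro powr_mono2) (auto simp: L_def)
    then have "\<kappa> / \<epsilon> \<le> a powr (p - 2)" using assms by (simp add: L_def powr_powr)
    then have "\<kappa> \<le> \<epsilon> * a powr (p - 2)" using assms by (simp add: field_simps)
    then have "\<kappa> * a\<^sup>2 \<le> \<epsilon> * a powr (p - 2) * a\<^sup>2" by (intro mult_right_mono) auto
    also have "\<dots> = \<epsilon> * (a powr (p - 2) * a powr 2)" using a0 by (simp add: powr_numeral)
    also have "\<dots> = \<epsilon> * a powr p" unfolding powr_add[symmetric] by simp
    finally show ?thesis using assms by (smt (verit) zero_le_power2 mult_nonneg_nonneg)
  qed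
  then show ?thesis using that[of "\<kappa> * L\<^sup>2"] assms by auto
qed

text \<open>Translation invariance of Lebesgue measure, slice by slice. It moves null sets and
  integrals between processes at time \<open>r\<close> and at time \<open>r + c\<close>.\<close>

lemma distr_shift_pair:
  assumes "sigma_finite_measure M"
  shows "distr (M \<Otimes>\<^sub>M lborel) (M \<Otimes>\<^sub>M lborel) (\<lambda>(\<omega>, r). (\<omega>, r + c :: real)) = M \<Otimes>\<^sub>M lborel"
proof -
  have shift [measurable]: "(\<lambda>(\<omega>, r). (\<omega>, r + c)) \<in> measurable (M \<Otimes>\<^sub>M lborel) (M \<Otimes>\<^sub>M lborel)"
    by measurable
  show ?thesis
  proof (rule measure_eqI)
    fix X assume "X \<in> sets (distr (M \<Otimes>\<^sub>M lborel) (M \<Otimes>\<^sub>M lborel) (\<lambda>(\<omega>, r). (\<omega>, r + c :: real)))"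
    then have X: "X \<in> sets (M \<Otimes>\<^sub>M lborel)" by simp
    let ?Y = "(\<lambda>(\<omega>, r). (\<omega>, r + c)) -` X \<inter> space (M \<Otimes>\<^sub>M lborel)"
    have Y: "?Y \<in> sets (M \<Otimes>\<^sub>M lborel)" using shift X by (rule measurable_sets)
    have slice: "emeasure lborel (Pair \<omega> -` ?Y) = emeasure lborel (Pair \<omega> -` X)" if "\<omega> \<in> space M" for \<omega>
    proof -
      have "Pair \<omega> -` ?Y = (\<lambda>r. r + c) -` (Pair \<omega> -` X) \<inter> space lborel"
        using that by (auto simp: space_pair_measure)
      moreover have "Pair \<omega> -` X \<in> sets lborel" using X by (rule sets_Pair1)
      ultimately have "emeasure lborel (Pair \<omega> -` ?Y) = emeasure (distr lborel borel (\<lambda>r. r + c)) (Pair \<omega> -` X)"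
        by (subst emeasure_distr) auto
      also have "distr lborel borel (\<lambda>r. r + c) = lborel"
      proof -
        have "(\<lambda>r. r + c) = (+) c" by (auto simp: add.commute)
        then show ?thesis using lborel_distr_plus[of c] by simp
      qed
      finally show ?thesis .
    qed
    have "emeasure (distr (M \<Otimes>\<^sub>M lborel) (M \<Otimes>\<^sub>M lborel) (\<lambda>(\<omega>, r). (\<omega>, r + c :: real))) X = emeasure (M \<Otimes>\<^sub>M lborel) ?Y"
      by (rule emeasure_distr[OF shift X])
    also have "\<dots> = (\<integral>\<^sup>+\<omega>. emeasure lborel (Pair \<omega> -` ?Y) \<partial>M)"
      using Y by (rule lborel.emeasure_pair_measure_alt)
    also have "\<dots> = (\<integral>\<^sup>+\<omega>. emeasure lborel (Pair \<omega> -` X) \<partial>M)"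
      by (intro nn_integral_cong slice)
    also have "\<dots> = emeasure (M \<Otimes>\<^sub>M lborel) X"
      using X by (rule lborel.emeasure_pair_measure_alt[symmetric])
    finally show "emeasure (distr (M \<Otimes>\<^sub>M lborel) (M \<Otimes>\<^sub>M lborel) (\<lambda>(\<omega>, r). (\<omega>, r + c :: real))) X = emeasure (M \<Otimes>\<^sub>M lborel) X" .
  qed simp
qed

section \<open>The energy inequality\<close>

locale energy = triple_operator i A + prm P F m \<mu>
  for i :: "'v::banach \<Rightarrow> 'h::{real_inner, banach, second_countable_topology}"
    and A :: "'v \<Rightarrow> ('v \<Rightarrow>\<^sub>L real)"
    and P :: "'w measure" and F m and \<mu> :: "'w \<Rightarrow> (real \<times> 'z) measure" +
  fixes G :: "'h \<Rightarrow> 'z \<Rightarrow> 'h" and p C\<^sub>1 C\<^sub>2 :: real and x :: 'h and u :: "real \<Rightarrow> 'w \<Rightarrow> 'h"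
  assumes G_meas: "(\<lambda>(x, z). G x z) \<in> borel_measurable (borel \<Otimes>\<^sub>M m)"
    and G_int: "\<And>x. integrable m (\<lambda>z. (norm (G x z))\<^sup>2)"
    and p2: "p > 2" and C1: "C\<^sub>1 > 0"
    and growth: "\<And>v. norm (A v) \<le> C\<^sub>1 * norm v powr (p - 1) + C\<^sub>2"
    and solution: "strong_solution P F m \<mu> i p A G x u"
begin

abbreviation "Q \<equiv> P \<Otimes>\<^sub>M (lborel :: real measure)"
abbreviation "q \<equiv> p / (p - 1)"

definition M :: "real \<Rightarrow> 'w \<Rightarrow> 'h" where
  "M = (SOME M. has_stochastic_integral P F m \<mu> (\<lambda>s \<omega> z. G (left_limit (\<lambda>r. u r \<omega>) s) z) M \<and>
        (AE \<omega> in P. \<forall>t\<ge>0. \<exists>I.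
           has_bochner_integral_normed (restrict_space lborel {0..t})
             (\<lambda>s. extend_op i A (u s \<omega>)) I \<and>
           dual_embed i (u t \<omega>) + I = dual_embed i x + dual_embed i (M t \<omega>)))"

lemma M_int: "has_stochastic_integral P F m \<mu> (\<lambda>s \<omega> z. G (left_limit (\<lambda>r. u r \<omega>) s) z) M"
  and M_eq: "AE \<omega> in P. \<forall>t\<ge>0. \<exists>I.
           has_bochner_integral_normed (restrict_space lborel {0..t}) (\<lambda>s. B (u s \<omega>)) I \<and>
           de (u t \<omega>) + I = de x + de (M t \<omega>)"
proof -
  note ex = solution[unfolded strong_solution_def, THEN conjunct2, THEN conjunct2, THEN conjunct2,
      THEN conjunct2, THEN conjunct2]
  note * = someI_ex[OF ex, folded M_def]
  show "has_stochastic_integral P F m \<mu> (\<lambda>s \<omega> z. G (left_limit (\<lambda>r. u r \<omega>) s) z) M"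
    "AE \<omega> in P. \<forall>t\<ge>0. \<exists>I.
           has_bochner_integral_normed (restrict_space lborel {0..t}) (\<lambda>s. B (u s \<omega>)) I \<and>
           de (u t \<omega>) + I = de x + de (M t \<omega>)"
    using *[THEN conjunct1] *[THEN conjunct2] by simp_all
qed

sublocale SI: stoch_int P F m \<mu> "\<lambda>s \<omega> z. G (left_limit (\<lambda>r. u r \<omega>) s) z" M
  by unfold_locales (rule M_int)

section \<open>Measurability and integrability of the solution on \<open>Q\<close>\<close>

lemma u_adapted: "t \<ge> 0 \<Longrightarrow> u t \<in> borel_measurable (F t)"
  using solution unfolding strong_solution_def adapted_def by simp

lemma u_measurable: "t \<ge> 0 \<Longrightarrow> u t \<in> borel_measurable P"
  using measurable_F_P[OF u_adapted] .

lemma u_cadlag: "\<omega> \<in> space P \<Longrightarrow> cadlag (\<lambda>t. u t \<omega>)"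
  using solution unfolding strong_solution_def by simp

lemma u_right_cont: "\<omega> \<in> space P \<Longrightarrow> t \<ge> 0 \<Longrightarrow> ((\<lambda>s. u s \<omega>) \<longlongrightarrow> u t \<omega>) (at_right t)"
  using u_cadlag by (simp add: cadlag_def)

lemma u_moments:
  assumes "T \<ge> 0"
  shows "(\<integral>\<^sup>+\<omega>. (SUP t\<in>{0..T}. ennreal ((norm (u t \<omega>))\<^sup>2)) \<partial>P) < \<infinity>"
    and "(\<integral>\<^sup>+\<omega>. (\<integral>\<^sup>+t\<in>{0..T}. Vnorm_powr i p (u t \<omega>) \<partial>lborel) \<partial>P) < \<infinity>"
  using solution assms unfolding strong_solution_def by auto

lemma u_sq: 
  assumes t: "t \<ge> 0" shows "sq_integrable P (u t)"
proof (rule sq_integrableI_nn[OF u_measurable[OF t]])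
  have "(\<integral>\<^sup>+\<omega>. ennreal ((norm (u t \<omega>))\<^sup>2) \<partial>P) \<le> (\<integral>\<^sup>+\<omega>. (SUP t\<in>{0..t}. ennreal ((norm (u t \<omega>))\<^sup>2)) \<partial>P)"
    using t by (intro nn_integral_mono SUP_upper) auto
  then show "(\<integral>\<^sup>+\<omega>. ennreal ((norm (u t \<omega>))\<^sup>2) \<partial>P) < \<infinity>"
    using u_moments(1)[OF t] by (rule le_less_trans)
qed

text \<open>Extending the processes by constants to negative times makes them measurable on all of \<open>Q\<close>.\<close>

definition U :: "'w \<times> real \<Rightarrow> 'h" where "U y = u (max 0 (snd y)) (fst y)"
definition MM :: "'w \<times> real \<Rightarrow> 'h" where "MM y = M (max 0 (snd y)) (fst y)"

lemma U_eq: "t \<ge> 0 \<Longrightarrow> U (\<omega>, t) = u t \<omega>" and MM_eq: "t \<ge> 0 \<Longrightarrow> MM (\<omega>, t) = M t \<omega>"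
  by (simp_all add: U_def MM_def)

lemma sets_Q: "sets Q = sets (P \<Otimes>\<^sub>M borel)"
  by (intro sets_pair_measure_cong) auto

lemma borel_U [measurable]: "U \<in> borel_measurable (P \<Otimes>\<^sub>M borel)"
proof -
  have "(\<lambda>(\<omega>, t). u (max 0 t) \<omega>) \<in> borel_measurable Q"
    by (rule right_cont_jointly_measurable[OF u_measurable u_right_cont])
  then show ?thesis
    by (simp add: U_def[abs_def] split_beta measurable_cong_sets[OF sets_Q refl])
qed

lemma borel_MM [measurable]: "MM \<in> borel_measurable (P \<Otimes>\<^sub>M borel)"
proof -
  have "(\<lambda>(\<omega>, t). M (max 0 t) \<omega>) \<in> borel_measurable Q"
    by (rule right_cont_jointly_measurable[OF SI.M_measurable])
       (use SI.M_cadlag in \<open>auto simp: cadlag_def\<close>)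
  then show ?thesis
    by (simp add: MM_def[abs_def] split_beta measurable_cong_sets[OF sets_Q refl])
qed

sublocale PL: pair_sigma_finite P "lborel :: real measure" ..

lemma shift_AE:
  assumes "AE y in Q. R y"
  shows "AE y in Q. R (fst y, snd y + c)"
proof -
  have T: "(\<lambda>(\<omega>, r). (\<omega>, r + c)) \<in> measurable Q Q" by measurable
  have "AE y in distr Q Q (\<lambda>(\<omega>, r). (\<omega>, r + c)). R y"
    unfolding distr_shift_pair[OF sigma_finite_measure_axioms, of c] by (rule assms(1))
  from AE_distrD[OF T this] show ?thesis by (simp add: split_beta)
qed

lemma shift_integral:
  fixes f :: "'w \<times> real \<Rightarrow> real"
  assumes [measurable]: "f \<in> borel_measurable Q"
  shows "(\<integral>y. f (fst y, snd y + c) \<partial>Q) = integral\<^sup>L Q f"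
    and "integrable Q (\<lambda>y. f (fst y, snd y + c)) \<longleftrightarrow> integrable Q f"
proof -
  have T: "(\<lambda>(\<omega>, r). (\<omega>, r + c)) \<in> measurable Q Q" by measurable
  note D = distr_shift_pair[OF sigma_finite_measure_axioms, of c]
  show "(\<integral>y. f (fst y, snd y + c) \<partial>Q) = integral\<^sup>L Q f"
    using integral_distr[OF T assms] unfolding D by (simp add: split_beta)
  show "integrable Q (\<lambda>y. f (fst y, snd y + c)) \<longleftrightarrow> integrable Q f"
    using integrable_distr_eq[OF T assms] unfolding D by (simp add: split_beta)
qed

lemma range_AE: "AE y in Q. 0 \<le> snd y \<longrightarrow> U y \<in> range i"
proof -
  have meas: "{y \<in> space Q. 0 \<le> snd y \<longrightarrow> U y \<in> range i} \<in> sets Q"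
    by measurable
  have "AE t in lborel. AE \<omega> in P. 0 \<le> t \<longrightarrow> U (\<omega>, t) \<in> range i"
  proof -
    have "AE t in lborel. 0 \<le> t \<longrightarrow> (AE \<omega> in P. u t \<omega> \<in> range i)"
      using solution unfolding strong_solution_def by simp
    then show ?thesis
      by eventually_elim (auto simp: U_eq)
  qed
  then have "AE \<omega> in P. AE t in lborel. 0 \<le> t \<longrightarrow> U (\<omega>, t) \<in> range i"
    by (subst PL.AE_commute) (use meas in \<open>auto\<close>)
  then show ?thesis
    using meas by (intro PL.AE_pair_measure) auto
qed

lemma norm_J_le_Vnorm: "p > 0 \<Longrightarrow> ennreal (norm (J y) powr p) \<le> Vnorm_powr i p y"
  by (cases "y \<in> range i") (auto simp: Vnorm_powr_J J_outside simp del: image_iff)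

lemma V_integrable: "integrable Q (\<lambda>y. indicator {0..T} (snd y) * norm (J (U y)) powr p)"
proof (rule integrableI_nonneg)
  show "(\<integral>\<^sup>+y. ennreal (indicator {0..T} (snd y) * norm (J (U y)) powr p) \<partial>Q) < \<infinity>"
  proof (cases "T \<ge> 0")
    case True
    have "(\<integral>\<^sup>+y. ennreal (indicator {0..T} (snd y) * norm (J (U y)) powr p) \<partial>Q) =
       (\<integral>\<^sup>+\<omega>. (\<integral>\<^sup>+t. ennreal (indicator {0..T} t * norm (J (U (\<omega>, t))) powr p) \<partial>lborel) \<partial>P)"
      by (subst lborel.nn_integral_fst[symmetric]) auto
    also have "\<dots> \<le> (\<integral>\<^sup>+\<omega>. (\<integral>\<^sup>+t\<in>{0..T}. Vnorm_powr i p (u t \<omega>) \<partial>lborel) \<partial>P)"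
      using p2 norm_J_le_Vnorm by (intro nn_integral_mono) (auto simp: indicator_def U_eq)
    finally show ?thesis using u_moments(2)[OF True] by (rule le_less_trans)
  qed simp
qed auto

text \<open>The exponent \<open>q\<close> is conjugate to \<open>p\<close>, so
  \<open>(p - 1) * q = p\<close>: the growth condition puts \<open>A u\<close> into
  \<open>L^q(V')\<close> as soon as \<open>u\<close> is in \<open>L^p(V)\<close>.\<close>

lemma B_growth: "\<exists>K\<ge>0. \<forall>y. norm (B y) powr q \<le> K * (norm (J y) powr p + 1)"
proof -
  \<comment> \<open>The sign of \<open>C\<^sub>2\<close> is free, while powers need a nonnegative
    base.\<close>
  let ?c = "\<bar>C\<^sub>2\<bar>"
  have q: "q > 0" using p2 by simp
  have "norm (B y) powr q \<le> (2 powr q * (C\<^sub>1 powr q + ?c powr q)) * (norm (J y) powr p + 1)" for y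
  proof -
    let ?a = "C\<^sub>1 * norm (J y) powr (p - 1)"
    have "norm (B y) \<le> ?a + ?c"
      using growth[of "J y"] C1 by (auto simp: B_eq)
    also have "\<dots> \<le> 2 * max ?a ?c" by simp
    finally have "norm (B y) powr q \<le> (2 * max ?a ?c) powr q"
      using q by (intro powr_mono2) auto
    also have "\<dots> = 2 powr q * max ?a ?c powr q" using C1 by (simp add: powr_mult)
    also have "max ?a ?c powr q \<le> ?a powr q + ?c powr q"
      by (auto simp: max_def)
    also have "?a powr q = C\<^sub>1 powr q * norm (J y) powr p"
      using C1 p2 by (simp add: powr_mult powr_powr)
    also have "C\<^sub>1 powr q * norm (J y) powr p + ?c powr q \<le> (C\<^sub>1 powr q + ?c powr q) * (norm (J y) powr p + 1)"
      by (simp add: algebra_simps)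
    finally show ?thesis by (simp add: mult.assoc)
  qed
  then show ?thesis by (intro exI[of _ "2 powr q * (C\<^sub>1 powr q + ?c powr q)"]) auto
qed

lemma indicator_integrable: "integrable Q (\<lambda>y. indicator {a..b} (snd y) :: real)"
proof -
  have "emeasure Q (space P \<times> {a..b}) < \<infinity>"
    by (subst lborel.emeasure_pair_measure_Times) (auto simp: emeasure_space_1 emeasure_lborel_Icc_eq)
  then have "integrable Q (indicator (space P \<times> {a..b}) :: _ \<Rightarrow> real)"
    by (intro integrable_real_indicator) auto
  then show ?thesis
    by (rule Bochner_Integration.integrable_cong[THEN iffD1, OF refl, rotated])
       (auto simp: space_pair_measure indicator_def)
qed

lemma W_integrable: "integrable Q (\<lambda>y. indicator {0..T} (snd y) * norm (B (U y)) powr q)"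
proof -
  obtain K where K: "K \<ge> 0" "\<And>y. norm (B y) powr q \<le> K * (norm (J y) powr p + 1)"
    using B_growth by blast
  show ?thesis
  proof (rule Bochner_Integration.integrable_bound)
    show "integrable Q (\<lambda>y. K * (indicator {0..T} (snd y) * norm (J (U y)) powr p + indicator {0..T} (snd y)))"
      using V_integrable indicator_integrable by auto
    show "AE y in Q. norm (indicator {0..T} (snd y) * norm (B (U y)) powr q) \<le>
        norm (K * (indicator {0..T} (snd y) * norm (J (U y)) powr p + indicator {0..T} (snd y)))"
      using K by (intro AE_I2) (auto simp: indicator_def)
  qed measurable
qed

definition pairing :: "'h \<times> 'h \<Rightarrow> real" where "pairing z = B (fst z) (J (snd z))"

lemma borel_pairing' [measurable]: "pairing \<in> borel_measurable (borel \<Otimes>\<^sub>M borel)"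
  using borel_pairing by (simp add: pairing_def[abs_def] split_beta)

lemma young_B:
  assumes "\<delta> > 0" "a \<ge> 0"
  shows "a * norm (J y) \<le> \<delta> * norm (J y) powr p + \<delta> powr (- 1 / (p - 1)) * a powr q"
  using young_scaled[OF assms(2) norm_ge_zero assms(1), of p "J y"] p2 by simp

lemma pairing_bound: "\<bar>pairing (y, z)\<bar> \<le> norm (J z) powr p + norm (B y) powr q"
  using norm_blinfun[of "B y" "J z"] young_B[of 1 "norm (B y)" z] by (simp add: pairing_def)

section \<open>The noise intensity along the solution\<close>

definition gsq :: "'h \<Rightarrow> real" where "gsq y = msq m (G y)"

lemma gsq_nonneg: "gsq y \<ge> 0"
  by (simp add: gsq_def msq_def)

lemma nn_gsq: "(\<integral>\<^sup>+z. ennreal ((norm (G y z))\<^sup>2) \<partial>m) = ennreal (gsq y)"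
  unfolding gsq_def msq_def using G_int by (intro nn_integral_eq_integral) auto

lemma borel_gsq [measurable]: "gsq \<in> borel_measurable borel"
proof -
  interpret m: sigma_finite_measure m by (rule sfm)
  have "(\<lambda>(y, z). (norm (G y z))\<^sup>2) \<in> borel_measurable (borel \<Otimes>\<^sub>M m)"
    using measurable_compose[OF G_meas, of "\<lambda>v. (norm v)\<^sup>2" borel] by (simp add: split_beta)
  then have "(\<lambda>y. \<integral>z. (norm (G y z))\<^sup>2 \<partial>m) \<in> borel_measurable borel"
    by (rule m.borel_measurable_lebesgue_integral)
  then show ?thesis by (simp add: gsq_def[abs_def] msq_def)
qed

text \<open>Square integrability is part of the notion of stochastic integral; the left limit in its
  integrand agrees with the value for almost every time.\<close>

lemma gsq_nn_finite:
  assumes "T \<ge> 0"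
  shows "(\<integral>\<^sup>+\<omega>. (\<integral>\<^sup>+s\<in>{0..T}. ennreal (gsq (U (\<omega>, s))) \<partial>lborel) \<partial>P) < \<infinity>"
proof -
  have "(\<integral>\<^sup>+\<omega>. (\<integral>\<^sup>+s\<in>{0..T}. ennreal (gsq (U (\<omega>, s))) \<partial>lborel) \<partial>P) =
    (\<integral>\<^sup>+\<omega>. (\<integral>\<^sup>+s\<in>{0..T}. (\<integral>\<^sup>+z. ennreal ((norm (G (left_limit (\<lambda>r. u r \<omega>) s) z))\<^sup>2) \<partial>m) \<partial>lborel) \<partial>P)"
  proof (rule nn_integral_cong, rule nn_integral_cong_AE)
    fix \<omega> assume "\<omega> \<in> space P"
    from cadlag_AE_continuous[OF u_cadlag[OF this]]
    show "AE s in lborel. ennreal (gsq (U (\<omega>, s))) * indicator {0..T} s =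
       (\<integral>\<^sup>+z. ennreal ((norm (G (left_limit (\<lambda>r. u r \<omega>) s) z))\<^sup>2) \<partial>m) * indicator {0..T} s"
      by eventually_elim (auto simp: indicator_def nn_gsq U_eq)
  qed
  also have "\<dots> < \<infinity>"
    using M_int assms unfolding has_stochastic_integral_def by simp
  finally show ?thesis .
qed

lemma gsq_integrable: "integrable Q (\<lambda>y. indicator {0..T} (snd y) * gsq (U y))"
  and gsq_nn: "(\<integral>\<^sup>+\<omega>. (\<integral>\<^sup>+s\<in>{0..T}. ennreal (gsq (U (\<omega>, s))) \<partial>lborel) \<partial>P) =
      ennreal (\<integral>y. indicator {0..T} (snd y) * gsq (U y) \<partial>Q)"
proof -
  have eq: "(\<integral>\<^sup>+y. ennreal (indicator {0..T} (snd y) * gsq (U y)) \<partial>Q) =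
     (\<integral>\<^sup>+\<omega>. (\<integral>\<^sup>+s\<in>{0..T}. ennreal (gsq (U (\<omega>, s))) \<partial>lborel) \<partial>P)"
    by (subst lborel.nn_integral_fst[symmetric]) (auto intro!: nn_integral_cong simp: indicator_def)
  show int: "integrable Q (\<lambda>y. indicator {0..T} (snd y) * gsq (U y))"
  proof (rule integrableI_nonneg)
    show "(\<integral>\<^sup>+y. ennreal (indicator {0..T} (snd y) * gsq (U y)) \<partial>Q) < \<infinity>"
      unfolding eq using gsq_nn_finite[of T] by (cases "T \<ge> 0") auto
  qed (auto simp: gsq_nonneg)
  show "(\<integral>\<^sup>+\<omega>. (\<integral>\<^sup>+s\<in>{0..T}. ennreal (gsq (U (\<omega>, s))) \<partial>lborel) \<partial>P) =
      ennreal (\<integral>y. indicator {0..T} (snd y) * gsq (U y) \<partial>Q)"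
    unfolding eq[symmetric] using int by (intro nn_integral_eq_integral) (auto simp: gsq_nonneg)
qed

text \<open>The value that the isometry assigns to the second moment of \<open>M T\<close>. The same
  quantity appears with a minus sign when coercivity is integrated.\<close>

definition X :: "real \<Rightarrow> real" where "X T = (\<integral>y. indicator {0..T} (snd y) * gsq (U y) \<partial>Q)"

lemma X_nonneg: "X T \<ge> 0"
  unfolding X_def by (intro integral_nonneg_AE AE_I2) (simp add: gsq_nonneg)

lemma X_mono: "S \<le> T \<Longrightarrow> X S \<le> X T"
  unfolding X_def by (intro integral_mono gsq_integrable) (auto simp: indicator_def gsq_nonneg)

lemma M_le_X:
  assumes t: "t \<ge> 0"
  shows "expectation (\<lambda>\<omega>. (norm (M t \<omega>))\<^sup>2) \<le> X t"
proof -
  have [measurable]: "(\<lambda>y. U (fst y)) \<in> borel_measurable (Q \<Otimes>\<^sub>M m)" by measurable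
  have "(\<lambda>y. (U (fst y), snd y)) \<in> measurable (Q \<Otimes>\<^sub>M m) (borel \<Otimes>\<^sub>M m)" by measurable
  then have meas: "(\<lambda>((\<omega>, s), z). G (U (\<omega>, s)) z) \<in> borel_measurable (Q \<Otimes>\<^sub>M m)"
    using measurable_compose[OF _ G_meas, of "\<lambda>y. (U (fst y), snd y)" "Q \<Otimes>\<^sub>M m"]
    by (simp add: case_prod_beta' cong: measurable_cong)
  have "ennreal (expectation (\<lambda>\<omega>. (norm (M t \<omega>))\<^sup>2)) \<le>
    (\<integral>\<^sup>+\<omega>. (\<integral>\<^sup>+s\<in>{0..t}. (\<integral>\<^sup>+z. ennreal ((norm (G (U (\<omega>, s)) z))\<^sup>2) \<partial>m) \<partial>lborel) \<partial>P)"
  proof (rule SI.M_bound[OF t meas])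
    fix \<omega> assume "\<omega> \<in> space P"
    from cadlag_AE_continuous[OF u_cadlag[OF this]]
    show "AE s in lborel. 0 \<le> s \<longrightarrow> (\<forall>z\<in>space m. G (left_limit (\<lambda>r. u r \<omega>) s) z = G (U (\<omega>, s)) z)"
      by eventually_elim (auto simp: U_eq)
  qed
  also have "\<dots> = ennreal (X t)"
    unfolding nn_gsq gsq_nn X_def ..
  finally show ?thesis using X_nonneg by simp
qed

text \<open>The second factor is the drift accumulated from \<open>r\<close> to \<open>t\<close>,
  written through the equation. In this form it lies in \<open>H\<close>, so the product is defined
  at every time and integrable by second moments.\<close>

definition D :: "real \<Rightarrow> real \<Rightarrow> 'w \<Rightarrow> real" where
  "D r t \<omega> = u t \<omega> \<bullet> (u r \<omega> + M t \<omega> - M r \<omega> - u t \<omega>)"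

text \<open>The equation at times \<open>t\<close> and \<open>r\<close> is tested with the vector of
  \<open>V\<close> that represents \<open>u t\<close>. The null set is that of the equation and does
  not depend on \<open>r\<close> and \<open>t\<close>, so \<open>r\<close> may later be
  integrated.\<close>

lemma D_eq: "AE \<omega> in P. \<forall>r t. 0 \<le> r \<longrightarrow> r \<le> t \<longrightarrow> u t \<omega> \<in> range i \<longrightarrow>
   D r t \<omega> = (\<integral>s. indicator {r<..t} s * pairing (u s \<omega>, u t \<omega>) \<partial>lborel)"
  using M_eq
proof eventually_elim
  case (elim \<omega>)
  show ?case
  proof (intro allI impI)
    fix r t assume r: "0 \<le> r" "r \<le> t" and "u t \<omega> \<in> range i"
    then obtain v where v: "u t \<omega> = i v" by blast
    have t: "t \<ge> 0" using r by simp
    define g where "g s = B (u s \<omega>) v" for s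
    from elim[rule_format, OF t] obtain I1 where
      I1: "has_bochner_integral_normed (restrict_space lborel {0..t}) (\<lambda>s. B (u s \<omega>)) I1" "de (u t \<omega>) + I1 = de x + de (M t \<omega>)"
      by (elim exE conjE)
    from elim[rule_format, OF r(1)] obtain I2 where
      I2: "has_bochner_integral_normed (restrict_space lborel {0..r}) (\<lambda>s. B (u s \<omega>)) I2" "de (u r \<omega>) + I2 = de x + de (M r \<omega>)"
      by (elim exE conjE)
    have b: "has_bochner_integral (restrict_space lborel {0..t}) g (I1 v)"
      "has_bochner_integral (restrict_space lborel {0..r}) g (I2 v)"
      unfolding g_def by (intro has_bochner_integral_normed_apply I1 I2)+
    then have i: "integrable lborel (\<lambda>s. indicator {0..t} s *\<^sub>R g s)" "(\<integral>s. indicator {0..t} s *\<^sub>R g s \<partial>lborel) = I1 v"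
      "integrable lborel (\<lambda>s. indicator {0..r} s *\<^sub>R g s)" "(\<integral>s. indicator {0..r} s *\<^sub>R g s \<partial>lborel) = I2 v"
      by (auto simp: has_bochner_integral_iff integrable_restrict_space integral_restrict_space)
    have "D r t \<omega> = (de (u r \<omega>) + de (M t \<omega>) - de (M r \<omega>) - de (u t \<omega>)) v"
      by (simp add: D_def v blinfun.diff_left blinfun.add_left inner_commute inner_diff_right inner_add_right)
    also have "de (u r \<omega>) + de (M t \<omega>) - de (M r \<omega>) - de (u t \<omega>) = I1 - I2"
    proof -
      have "I1 = de x + de (M t \<omega>) - de (u t \<omega>)" "I2 = de x + de (M r \<omega>) - de (u r \<omega>)"
        using I1(2) I2(2) by (metis add_diff_cancel_left')+
      then show ?thesis by simp
    qed
    also have "(I1 - I2) v = (\<integral>s. indicator {0..t} s *\<^sub>R g s - indicator {0..r} s *\<^sub>R g s \<partial>lborel)"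
      using i by (simp add: blinfun.diff_left)
    also have "\<dots> = (\<integral>s. indicator {r<..t} s * pairing (u s \<omega>, u t \<omega>) \<partial>lborel)"
      using r by (intro Bochner_Integration.integral_cong) (auto simp: indicator_def g_def pairing_def v)
    finally show "D r t \<omega> = (\<integral>s. indicator {r<..t} s * pairing (u s \<omega>, u t \<omega>) \<partial>lborel)" .
  qed
qed

text \<open>By the martingale property the second moment of \<open>M t - M r\<close> is a difference
  of second moments. Subtracting that of \<open>M\<close> thus turns the energy estimate into a
  bound by increments of one function of time.\<close>

definition Y :: "real \<Rightarrow> real" where
  "Y t = expectation (\<lambda>\<omega>. (norm (u t \<omega>))\<^sup>2) - expectation (\<lambda>\<omega>. (norm (M t \<omega>))\<^sup>2)"

lemma D_integrable: "0 \<le> r \<Longrightarrow> 0 \<le> t \<Longrightarrow> integrable P (D r t)"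
  unfolding D_def by (intro sq_integrable_inner sq_integrable_diff sq_integrable_add u_sq SI.M_sq_integrable)

text \<open>This step replaces the Ito formula: the discarded square is \<open>\<bar>u r + M t - M r - u t\<bar>\<^sup>2\<close>, and the cross
  terms vanish in expectation since \<open>M\<close> is a martingale.\<close>

lemma energy_step:
  assumes r: "0 \<le> r" "r \<le> t"
  shows "2 * expectation (D r t) \<le> Y r - Y t"
proof -
  have t: "t \<ge> 0" using r by simp
  note sq = u_sq[OF r(1)] u_sq[OF t] SI.M_sq_integrable[OF r(1)] SI.M_sq_integrable[OF t]
  note n = sq[THEN sq_integrableD(2)]
  have mart: "expectation (\<lambda>\<omega>. u r \<omega> \<bullet> (M t \<omega> - M r \<omega>)) = 0" "expectation (\<lambda>\<omega>. M r \<omega> \<bullet> (M t \<omega> - M r \<omega>)) = 0"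
    by (intro SI.M_martingale r u_adapted SI.M_adapted sq)+
  have i: "integrable P (\<lambda>\<omega>. u r \<omega> \<bullet> (M t \<omega> - M r \<omega>))" "integrable P (\<lambda>\<omega>. M r \<omega> \<bullet> (M t \<omega> - M r \<omega>))"
    by (intro sq_integrable_inner sq_integrable_diff sq)+
  have "2 * D r t \<omega> \<le> (norm (u r \<omega>))\<^sup>2 - (norm (u t \<omega>))\<^sup>2 + 2 * (u r \<omega> \<bullet> (M t \<omega> - M r \<omega>))
     + ((norm (M t \<omega>))\<^sup>2 - (norm (M r \<omega>))\<^sup>2 - 2 * (M r \<omega> \<bullet> (M t \<omega> - M r \<omega>)))" for \<omega>
  proof -
    have "0 \<le> (norm (u r \<omega> + M t \<omega> - M r \<omega> - u t \<omega>))\<^sup>2" by simp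
    then show ?thesis
      unfolding D_def power2_norm_eq_inner by (simp add: inner_simps inner_commute)
  qed
  then have "expectation (\<lambda>\<omega>. 2 * D r t \<omega>) \<le> expectation (\<lambda>\<omega>. (norm (u r \<omega>))\<^sup>2 - (norm (u t \<omega>))\<^sup>2 + 2 * (u r \<omega> \<bullet> (M t \<omega> - M r \<omega>))
     + ((norm (M t \<omega>))\<^sup>2 - (norm (M r \<omega>))\<^sup>2 - 2 * (M r \<omega> \<bullet> (M t \<omega> - M r \<omega>))))"
    using n i D_integrable[OF r(1) t] by (intro integral_mono) auto
  then show ?thesis
    using n i mart D_integrable[OF r(1) t] by (simp add: Y_def)
qed


text \<open>A supremum over rational times is measurable. By right-continuity it bounds every
  \<open>t < T\<close>; the strict inequality is the reason for the margins in later uses, such as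
  \<open>KS 2\<close> for times up to 1.\<close>

definition Wsup :: "real \<Rightarrow> 'w \<Rightarrow> ennreal" where
  "Wsup T \<omega> = (SUP t\<in>\<rat> \<inter> {0..T}. ennreal ((norm (u t \<omega>))\<^sup>2))"

definition sup_sq :: "real \<Rightarrow> 'w \<Rightarrow> real" where "sup_sq T \<omega> = enn2real (Wsup T \<omega>)"

lemma borel_Wsup [measurable]: "Wsup T \<in> borel_measurable P"
  unfolding Wsup_def using countable_rat u_measurable
  by (intro borel_measurable_SUP) auto

lemma borel_sup_sq [measurable]: "sup_sq T \<in> borel_measurable P"
  unfolding sup_sq_def by measurable

lemma Wsup_finite: "T \<ge> 0 \<Longrightarrow> (\<integral>\<^sup>+\<omega>. Wsup T \<omega> \<partial>P) < \<infinity>"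
proof -
  assume T: "T \<ge> 0"
  have "(\<integral>\<^sup>+\<omega>. Wsup T \<omega> \<partial>P) \<le> (\<integral>\<^sup>+\<omega>. (SUP t\<in>{0..T}. ennreal ((norm (u t \<omega>))\<^sup>2)) \<partial>P)"
    unfolding Wsup_def by (intro nn_integral_mono SUP_subset_mono) auto
  then show ?thesis using u_moments(1)[OF T] by (rule le_less_trans)
qed

lemma Wsup_AE: "T \<ge> 0 \<Longrightarrow> AE \<omega> in P. Wsup T \<omega> = ennreal (sup_sq T \<omega>)"
proof -
  assume T: "T \<ge> 0"
  have "AE \<omega> in P. Wsup T \<omega> \<noteq> \<infinity>"
    using Wsup_finite[OF T] by (intro nn_integral_PInf_AE) auto
  then show ?thesis by eventually_elim (simp add: sup_sq_def less_top)
qed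

lemma sup_sq_integrable: "T \<ge> 0 \<Longrightarrow> integrable P (sup_sq T)"
proof (rule integrableI_nonneg)
  assume T: "T \<ge> 0"
  have "(\<integral>\<^sup>+\<omega>. ennreal (sup_sq T \<omega>) \<partial>P) = (\<integral>\<^sup>+\<omega>. Wsup T \<omega> \<partial>P)"
    using Wsup_AE[OF T] by (intro nn_integral_cong_AE) auto
  then show "(\<integral>\<^sup>+\<omega>. ennreal (sup_sq T \<omega>) \<partial>P) < \<infinity>" using Wsup_finite[OF T] by simp
qed (auto simp: sup_sq_def)

lemma u_le_Wsup:
  assumes \<omega>: "\<omega> \<in> space P" and t: "0 \<le> t" "t < T"
  shows "ennreal ((norm (u t \<omega>))\<^sup>2) \<le> Wsup T \<omega>"
proof (rule ccontr)
  assume "\<not> ennreal ((norm (u t \<omega>))\<^sup>2) \<le> Wsup T \<omega>"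
  then have less: "Wsup T \<omega> < ennreal ((norm (u t \<omega>))\<^sup>2)" by simp
  have "((\<lambda>s. ennreal ((norm (u s \<omega>))\<^sup>2)) \<longlongrightarrow> ennreal ((norm (u t \<omega>))\<^sup>2)) (at_right t)"
    by (intro tendsto_intros u_right_cont \<omega> t tendsto_ennrealI)
  from order_tendstoD(1)[OF this less] have "\<forall>\<^sub>F s in at_right t. Wsup T \<omega> < ennreal ((norm (u s \<omega>))\<^sup>2)" .
  then obtain b where b: "b > t" "\<And>s. t < s \<Longrightarrow> s < b \<Longrightarrow> Wsup T \<omega> < ennreal ((norm (u s \<omega>))\<^sup>2)"
    by (auto simp: eventually_at_right_field)
  obtain s where s: "s \<in> \<rat>" "t < s" "s < min b T"
    using Rats_dense_in_real[of t "min b T"] b(1) t by auto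
  then have "ennreal ((norm (u s \<omega>))\<^sup>2) \<le> Wsup T \<omega>"
    unfolding Wsup_def using t by (intro SUP_upper) auto
  then show False using b(2)[of s] s by (auto dest: leD)
qed

lemma sup_sq_AE:
  assumes "T \<ge> 0"
  shows "AE \<omega> in P. \<forall>t. 0 \<le> t \<longrightarrow> t < T \<longrightarrow> (norm (u t \<omega>))\<^sup>2 \<le> sup_sq T \<omega>"
  using Wsup_AE[OF assms] AE_space
proof eventually_elim
  case (elim \<omega>)
  show ?case
  proof (intro allI impI)
    fix t assume "0 \<le> t" "t < T"
    from u_le_Wsup[OF elim(2) this] have "ennreal ((norm (u t \<omega>))\<^sup>2) \<le> ennreal (sup_sq T \<omega>)"
      using elim(1) by simp
    then show "(norm (u t \<omega>))\<^sup>2 \<le> sup_sq T \<omega>" by (simp add: sup_sq_def)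
  qed
qed

definition KS :: "real \<Rightarrow> real" where "KS T = expectation (sup_sq T)"

lemma KS_bound: "0 \<le> t \<Longrightarrow> t < T \<Longrightarrow> expectation (\<lambda>\<omega>. (norm (u t \<omega>))\<^sup>2) \<le> KS T"
  unfolding KS_def using sup_sq_AE[of T] sq_integrableD(2)[OF u_sq] sup_sq_integrable[of T]
  by (intro integral_mono_AE) auto

section \<open>Null sets and time shifts on \<open>Q\<close>\<close>

lemma AE_fst:
  assumes "AE \<omega> in P. R \<omega>"
  shows "AE y in Q. R (fst y)"
proof -
  obtain N where N: "N \<in> null_sets P" "{\<omega> \<in> space P. \<not> R \<omega>} \<subseteq> N"
    using assms by (auto simp: eventually_ae_filter)
  have "N \<times> UNIV \<in> null_sets Q"
    using lborel.times_in_null_sets1[OF N(1), of UNIV] by simp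
  then show ?thesis
    by (rule AE_I') (use N(2) in \<open>auto simp: space_pair_measure\<close>)
qed

lemma AE_snd_neq: "AE y in Q. snd y \<noteq> (c::real)"
proof -
  have "{c} \<in> null_sets lborel" by (simp add: null_sets_def)
  from lborel.times_in_null_sets2[OF sets.top this] have "space P \<times> {c} \<in> null_sets Q" .
  then show ?thesis by (rule AE_I') (auto simp: space_pair_measure)
qed

lemma range_AE_shift: "AE y in Q. 0 \<le> snd y + c \<longrightarrow> U (fst y, snd y + c) \<in> range i"
  using shift_AE[OF range_AE, of c] by simp

definition VI :: "real \<Rightarrow> real" where "VI T = (\<integral>y. indicator {0..T} (snd y) * norm (J (U y)) powr p \<partial>Q)"
definition WI :: "real \<Rightarrow> real" where "WI T = (\<integral>y. indicator {0..T} (snd y) * norm (B (U y)) powr q \<partial>Q)"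

lemma VI_nonneg: "VI T \<ge> 0"
  unfolding VI_def by simp

text \<open>A process observed a time \<open>c\<close> later costs no more than the unshifted
  process on a longer window. This makes the estimates below uniform over shifts in
  \<open>[0, 1]\<close>.\<close>

lemma dominated_shift:
  fixes f :: "'w \<times> real \<Rightarrow> real"
  assumes f [measurable]: "f \<in> borel_measurable Q" and int: "integrable Q (\<lambda>y. indicator {0..b + c} (snd y) * f y)"
    and f0: "\<And>y. f y \<ge> 0" and c: "c \<ge> 0" and a: "a \<ge> 0"
  shows "integrable Q (\<lambda>y. indicator {a..b} (snd y) * f (fst y, snd y + c))"
    and "(\<integral>y. indicator {a..b} (snd y) * f (fst y, snd y + c) \<partial>Q) \<le> (\<integral>y. indicator {0..b + c} (snd y) * f y \<partial>Q)"
proof -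
  define g where "g y = indicator {0..b + c} (snd y) * f y" for y
  have gm [measurable]: "g \<in> borel_measurable Q" unfolding g_def by measurable
  have "integrable Q g" using int by (simp add: g_def[abs_def])
  then have ig: "integrable Q (\<lambda>y. g (fst y, snd y + c))"
    using shift_integral(2)[OF gm, of c] by blast
  have le: "indicator {a..b} (snd y) * f (fst y, snd y + c) \<le> g (fst y, snd y + c)" for y
    using c a f0 by (auto simp: g_def indicator_def)
  show 1: "integrable Q (\<lambda>y. indicator {a..b} (snd y) * f (fst y, snd y + c))"
  proof (rule Bochner_Integration.integrable_bound[OF ig])
    show "(\<lambda>y. indicator {a..b} (snd y) * f (fst y, snd y + c)) \<in> borel_measurable Q" by measurable
    show "AE y in Q. norm (indicator {a..b} (snd y) * f (fst y, snd y + c)) \<le> norm (g (fst y, snd y + c))"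
      using le f0 by (intro AE_I2) (auto simp: indicator_def g_def intro: order_trans)
  qed
  have "(\<integral>y. indicator {a..b} (snd y) * f (fst y, snd y + c) \<partial>Q) \<le> (\<integral>y. g (fst y, snd y + c) \<partial>Q)"
    using 1 ig le by (rule integral_mono)
  also have "\<dots> = integral\<^sup>L Q g" by (rule shift_integral(1)[OF gm])
  finally show "(\<integral>y. indicator {a..b} (snd y) * f (fst y, snd y + c) \<partial>Q) \<le> (\<integral>y. indicator {0..b + c} (snd y) * f y \<partial>Q)"
    by (simp add: g_def[abs_def])
qed

lemma borel_JU [measurable]: "(\<lambda>y. norm (J (U y)) powr p) \<in> borel_measurable Q"
  and borel_BU [measurable]: "(\<lambda>y. norm (B (U y)) powr q) \<in> borel_measurable Q"
  by measurable

lemma indicator_mono_integral: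
  fixes f :: "'w \<times> real \<Rightarrow> real"
  assumes "\<And>T. integrable Q (\<lambda>y. indicator {0..T} (snd y) * f y)" "\<And>y. f y \<ge> 0" "S \<le> T"
  shows "(\<integral>y. indicator {0..S} (snd y) * f y \<partial>Q) \<le> (\<integral>y. indicator {0..T} (snd y) * f y \<partial>Q)"
  using assms by (intro integral_mono) (auto simp: indicator_def)

text \<open>With \<open>a = h * \<theta>\<close> and \<open>b = h - h * \<theta>\<close>, this is
  the mean pairing of \<open>A u\<close> at time \<open>r + h * \<theta>\<close> with
  \<open>u\<close> at time \<open>r + h\<close>, integrated over \<open>r\<close> in
  \<open>[0, T]\<close> and translated. The translation leaves \<open>A u\<close> unshifted, which
  matters because \<open>A u\<close> has no continuity in time.\<close>

definition S :: "real \<Rightarrow> real \<Rightarrow> real \<Rightarrow> real" where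
  "S T a b = (\<integral>y. indicator {a..T + a} (snd y) * pairing (U y, U (fst y, snd y + b)) \<partial>Q)"

lemma S_integrable:
  assumes "a \<ge> 0" "b \<ge> 0"
  shows "integrable Q (\<lambda>y. indicator {a..T + a} (snd y) * pairing (U y, U (fst y, snd y + b)))"
proof (rule Bochner_Integration.integrable_bound)
  note V = dominated_shift(1)[OF borel_JU V_integrable _ assms(2,1)]
  note W = dominated_shift(1)[OF borel_BU W_integrable _ order_refl assms(1)]
  show "integrable Q (\<lambda>y. indicator {a..T + a} (snd y) * norm (J (U (fst y, snd y + b))) powr p
     + indicator {a..T + a} (snd y) * norm (B (U (fst y, snd y + 0))) powr q)"
    by (intro Bochner_Integration.integrable_add V W) auto
  show "AE y in Q. norm (indicator {a..T + a} (snd y) * pairing (U y, U (fst y, snd y + b))) \<le>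
     norm (indicator {a..T + a} (snd y) * norm (J (U (fst y, snd y + b))) powr p
     + indicator {a..T + a} (snd y) * norm (B (U (fst y, snd y + 0))) powr q)"
    using pairing_bound by (intro AE_I2) (auto simp: indicator_def)
qed measurable

definition \<rho> :: "nat \<Rightarrow> 'h \<Rightarrow> real" where "\<rho> N y = norm (B y - de (\<eta> N y))"
text \<open>A substitute for the pairing that is continuous in \<open>z\<close> for the norm of
  \<open>H\<close>, as long as \<open>z\<close> stays in \<open>V\<close>. Outside \<open>V\<close>
  it vanishes together with the pairing.\<close>

definition gN :: "nat \<Rightarrow> 'h \<Rightarrow> 'h \<Rightarrow> real" where "gN N y z = (if z \<in> range i then \<eta> N y \<bullet> z else 0)"

lemma borel_rho [measurable]: "\<rho> N \<in> borel_measurable borel"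
  unfolding \<rho>_def by measurable

lemma borel_gN [measurable]: "(\<lambda>y. gN N (f y) (g y)) \<in> borel_measurable K"
  if "f \<in> borel_measurable K" "g \<in> borel_measurable K"
  using that unfolding gN_def by measurable

lemma rho_le: "\<rho> N y powr q \<le> norm (B y) powr q"
  unfolding \<rho>_def using norm_B_eta_le p2 by (intro powr_mono2) auto

text \<open>The error is a product of a quantity at \<open>y\<close> and one at \<open>z\<close>,
  that is, at two different times. Young separates them: the moving factor receives the small
  coefficient \<open>\<delta>\<close>, and the large coefficient meets the fixed factor
  \<open>\<rho> N y\<close>, which tends to 0 with \<open>N\<close>.\<close>

lemma pairing_gN:
  assumes "\<delta> > 0"
  shows "\<bar>pairing (y, z) - gN N y z\<bar> \<le> \<delta> * norm (J z) powr p + \<delta> powr (- 1 / (p - 1)) * \<rho> N y powr q"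
proof (cases "z \<in> range i")
  case True
  then have "\<bar>pairing (y, z) - gN N y z\<bar> \<le> \<rho> N y * norm (J z)"
    using B_apply_J_bound[of z y N] by (simp add: pairing_def gN_def \<rho>_def)
  also have "\<dots> \<le> \<delta> * norm (J z) powr p + \<delta> powr (- 1 / (p - 1)) * \<rho> N y powr q"
    using assms by (intro young_B) (simp_all add: \<rho>_def)
  finally show ?thesis .
next
  case False
  then show ?thesis using assms by (simp add: pairing_def gN_def J_outside)
qed

definition RI :: "nat \<Rightarrow> real \<Rightarrow> real" where
  "RI N T = (\<integral>y. indicator {0..T} (snd y) * \<rho> N (U y) powr q \<partial>Q)"

lemma rho_integrable: "integrable Q (\<lambda>y. indicator {0..T} (snd y) * \<rho> N (U y) powr q)"
proof (rule Bochner_Integration.integrable_bound[OF W_integrable[of T]])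
  show "AE y in Q. norm (indicator {0..T} (snd y) * \<rho> N (U y) powr q) \<le> norm (indicator {0..T} (snd y) * norm (B (U y)) powr q)"
    using rho_le by (intro AE_I2) (simp add: indicator_def)
qed measurable

lemma RI_tendsto: "(\<lambda>N. RI N T) \<longlonglongrightarrow> 0"
proof -
  have "(\<lambda>N. RI N T) \<longlonglongrightarrow> (\<integral>y. 0 \<partial>Q)"
    unfolding RI_def
  proof (rule integral_dominated_convergence[OF _ _ W_integrable[of T]])
    show "AE y in Q. (\<lambda>N. indicator {0..T} (snd y) * \<rho> N (U y) powr q) \<longlonglongrightarrow> 0"
    proof (intro AE_I2)
      fix y
      have "(\<lambda>N. \<rho> N (U y) powr q) \<longlonglongrightarrow> 0"
        using tendsto_B_eta[of "U y"] p2 by (intro tendsto_zero_powrI[OF _ tendsto_const]) (auto simp: \<rho>_def)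
      from tendsto_mult[OF tendsto_const this, of "indicator {0..T} (snd y)"]
      show "(\<lambda>N. indicator {0..T} (snd y) * \<rho> N (U y) powr q) \<longlonglongrightarrow> 0" by simp
    qed
    show "AE y in Q. norm (indicator {0..T} (snd y) * \<rho> N (U y) powr q) \<le> indicator {0..T} (snd y) * norm (B (U y)) powr q" for N
      using rho_le by (intro AE_I2) (simp add: indicator_def)
  qed measurable
  then show ?thesis by simp
qed

lemma u_seq_right_cont:
  assumes "\<omega> \<in> space P" "s \<ge> 0" "\<And>n. b n \<ge> 0" "b \<longlonglongrightarrow> 0"
  shows "(\<lambda>n. U (\<omega>, s + b n)) \<longlonglongrightarrow> U (\<omega>, s)"
proof -
  have c: "continuous (at s within {s..}) (\<lambda>s. u s \<omega>)"
    using u_right_cont[OF assms(1,2)] by (simp add: continuous_within at_within_Ici_at_right)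
  have l: "(\<lambda>n. s + b n) \<longlonglongrightarrow> s" using tendsto_add[OF tendsto_const assms(4), of s] by simp
  have "(\<lambda>n. u (s + b n) \<omega>) \<longlonglongrightarrow> u s \<omega>"
    by (rule continuous_within_tendsto_compose'[OF c _ l]) (simp add: assms(3))
  then show ?thesis using assms(2,3) by (simp add: U_eq)
qed

lemma integrable_indicator_mult:
  assumes f: "integrable P f"
  shows "integrable Q (\<lambda>y. indicator {a..b} (snd y) * f (fst y) :: real)"
proof (rule PL.Fubini_integrable)
  note [measurable] = borel_measurable_integrable[OF f]
  show "(\<lambda>y. indicator {a..b} (snd y) * f (fst y)) \<in> borel_measurable Q" by measurable
  have fin: "emeasure lborel {a..b} < \<infinity>" by (cases "a \<le> b") auto
  then have ind: "integrable lborel (indicator {a..b} :: real \<Rightarrow> real)" by (intro integrable_real_indicator) auto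
  show "integrable P (\<lambda>\<omega>. \<integral>s. norm (indicator {a..b} (snd (\<omega>, s)) * f (fst (\<omega>, s))) \<partial>lborel)"
    using f by (simp add: abs_mult)
  show "AE \<omega> in P. integrable lborel (\<lambda>s. indicator {a..b} (snd (\<omega>, s)) * f (fst (\<omega>, s)))"
    using ind by simp
qed

lemma gN_bound:
  assumes "\<And>y. norm (\<eta> N y) \<le> C" "C \<ge> 0" "(norm z)\<^sup>2 \<le> K"
  shows "\<bar>gN N y z\<bar> \<le> C * (1 + K)"
proof -
  have "0 \<le> (norm z - 1)\<^sup>2" by simp
  then have "2 * norm z \<le> 1 + (norm z)\<^sup>2" by (simp add: power2_diff)
  then have "norm z \<le> 1 + (norm z)\<^sup>2" using norm_ge_zero[of z] by linarith
  then have z: "norm z \<le> 1 + K" using assms(3) by simp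
  have "\<bar>gN N y z\<bar> \<le> norm (\<eta> N y) * norm z"
    by (auto simp: gN_def Cauchy_Schwarz_ineq2)
  also have "\<dots> \<le> C * (1 + K)" using assms z by (intro mult_mono) auto
  finally show ?thesis .
qed

lemma indicator_window_tendsto:
  assumes "a \<longlonglongrightarrow> 0" "s \<noteq> 0" "s \<noteq> T" "\<And>n. a n \<ge> (0::real)"
  shows "(\<lambda>n. indicator {a n..T + a n} s :: real) \<longlonglongrightarrow> indicator {0..T} s"
proof (rule tendsto_eventually)
  have Ta: "(\<lambda>n. T + a n) \<longlonglongrightarrow> T" using tendsto_add[OF tendsto_const assms(1), of T] by simp
  have 1: "\<forall>\<^sub>F n in sequentially. s > 0 \<longrightarrow> a n < s"
    using order_tendstoD(2)[OF assms(1), of s] by (cases "s > 0") auto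
  have 2: "\<forall>\<^sub>F n in sequentially. s > T \<longrightarrow> T + a n < s"
    using order_tendstoD(2)[OF Ta, of s] by (cases "s > T") auto
  show "\<forall>\<^sub>F n in sequentially. (indicator {a n..T + a n} s :: real) = indicator {0..T} s"
    using 1 2
  proof eventually_elim
    case (elim n)
    then show ?case using assms(2,3) assms(4)[of n] by (auto simp: indicator_def)
  qed
qed

text \<open>For fixed \<open>N\<close> the shift may tend to 0 pointwise, by right-continuity in
  \<open>H\<close>. The dominating function exists because \<open>\<eta> N\<close> is bounded and
  the running supremum of the squared norm is integrable.\<close>

lemma gN_convergence:
  assumes T: "T \<ge> 0" and a: "\<And>n. 0 \<le> a n" "\<And>n. a n \<le> 1" "a \<longlonglongrightarrow> 0"
    and b: "\<And>n. 0 \<le> b n" "\<And>n. b n \<le> 1" "b \<longlonglongrightarrow> 0"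
  shows "(\<lambda>n. \<integral>y. indicator {a n..T + a n} (snd y) * gN N (U y) (U (fst y, snd y + b n)) \<partial>Q)
     \<longlonglongrightarrow> (\<integral>y. indicator {0..T} (snd y) * gN N (U y) (U y) \<partial>Q)"
    and "\<And>n. integrable Q (\<lambda>y. indicator {a n..T + a n} (snd y) * gN N (U y) (U (fst y, snd y + b n)))"
    and "integrable Q (\<lambda>y. indicator {0..T} (snd y) * gN N (U y) (U y))"
proof -
  obtain C where C: "\<And>y. norm (\<eta> N y) \<le> C" using eta_bounded by blast
  then have C0: "C \<ge> 0" using norm_ge_zero order_trans by blast
  \<comment> \<open>The window ends at \<open>T + a n\<close>, at most \<open>T + 1\<close>, and the
    shifted time is at most \<open>T + 2\<close>; \<open>T + 3\<close> gives the strict inequality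
    required by \<open>sup_sq_AE\<close>.\<close>
  define w where "w y = indicator {0..T + 1} (snd y) * (C * (1 + sup_sq (T + 3) (fst y)))" for y :: "'w \<times> real"
  have w: "integrable Q w"
    unfolding w_def using sup_sq_integrable[of "T + 3"] T by (intro integrable_indicator_mult) auto
  define f where "f n y = indicator {a n..T + a n} (snd y) * gN N (U y) (U (fst y, snd y + b n))" for n and y :: "'w \<times> real"
  define f' where "f' y = indicator {0..T} (snd y) * gN N (U y) (U y)" for y :: "'w \<times> real"
  have fm [measurable]: "f n \<in> borel_measurable Q" "f' \<in> borel_measurable Q" for n
    unfolding f_def f'_def by measurable
  have lim: "AE y in Q. (\<lambda>n. f n y) \<longlonglongrightarrow> f' y"
  proof -
    \<comment> \<open>Only countably many shifts occur, so one null set serves all of them.\<close>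
    have "AE y in Q. \<forall>n. 0 \<le> snd y + b n \<longrightarrow> U (fst y, snd y + b n) \<in> range i"
      unfolding AE_all_countable using range_AE_shift by blast
    then show ?thesis
      using range_AE AE_snd_neq[of 0] AE_snd_neq[of T] AE_space
    proof eventually_elim
      case (elim y)
      show ?case
      proof (cases "snd y < 0")
        case True
        then have "f n y = 0" "f' y = 0" for n using a(1)[of n] by (auto simp: f_def f'_def)
        then show ?thesis by simp
      next
        case False
        then have U: "U y \<in> range i" "U (fst y, snd y + b n) \<in> range i" for n
          using elim b(1)[of n] by auto
        have "(\<lambda>n. U (fst y, snd y + b n)) \<longlonglongrightarrow> U (fst y, snd y)"
          using elim(5) False by (intro u_seq_right_cont b) (auto simp: space_pair_measure)
        then have "(\<lambda>n. \<eta> N (U y) \<bullet> U (fst y, snd y + b n)) \<longlonglongrightarrow> \<eta> N (U y) \<bullet> U y"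
          by (intro tendsto_intros) simp
        then have "(\<lambda>n. gN N (U y) (U (fst y, snd y + b n))) \<longlonglongrightarrow> gN N (U y) (U y)"
          using U by (simp add: gN_def del: image_iff)
        then show ?thesis
          unfolding f_def f'_def using elim(3,4) a(1,3) by (intro tendsto_mult indicator_window_tendsto)
      qed
    qed
  qed
  have domAE: "AE y in Q. \<forall>t. 0 \<le> t \<longrightarrow> t < T + 3 \<longrightarrow> (norm (u t (fst y)))\<^sup>2 \<le> sup_sq (T + 3) (fst y)"
    using T by (intro AE_fst sup_sq_AE) auto
  have bound: "AE y in Q. norm (f n y) \<le> w y" for n
    using domAE
  proof eventually_elim
    case (elim y)
    show ?case
    proof (cases "snd y \<in> {a n..T + a n}")
      case True
      then have s: "0 \<le> snd y" "snd y \<le> T + 1" "snd y + b n < T + 3" "0 \<le> snd y + b n"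
        using a(1,2)[of n] b(1,2)[of n] by auto
      then have "(norm (U (fst y, snd y + b n)))\<^sup>2 \<le> sup_sq (T + 3) (fst y)"
        using elim by (simp add: U_eq)
      from gN_bound[OF C C0 this, where y="U y"] show ?thesis using True s by (simp add: f_def w_def)
    next
      case False
      then show ?thesis using C0 by (simp add: f_def w_def sup_sq_def)
    qed
  qed
  have bound': "AE y in Q. norm (f' y) \<le> w y"
    using domAE
  proof eventually_elim
    case (elim y)
    show ?case
    proof (cases "snd y \<in> {0..T}")
      case True
      then have "(norm (U y))\<^sup>2 \<le> sup_sq (T + 3) (fst y)"
        using elim by (simp add: U_def)
      from gN_bound[OF C C0 this, where y="U y"] show ?thesis using True by (simp add: f'_def w_def)
    next
      case False
      then show ?thesis using C0 by (simp add: f'_def w_def sup_sq_def)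
    qed
  qed
  show "(\<lambda>n. integral\<^sup>L Q (f n)) \<longlonglongrightarrow> integral\<^sup>L Q f'"
    by (rule integral_dominated_convergence[OF fm(2) fm(1) w lim bound])
  show "integrable Q (f n)" for n
  proof (rule Bochner_Integration.integrable_bound[OF w fm(1)])
    show "AE y in Q. norm (f n y) \<le> norm (w y)"
      using bound[of n] by eventually_elim simp
  qed
  show "integrable Q f'"
  proof (rule Bochner_Integration.integrable_bound[OF w fm(2)])
    show "AE y in Q. norm (f' y) \<le> norm (w y)"
      using bound' by eventually_elim simp
  qed
qed

definition E0 :: "real \<Rightarrow> real" where
  "E0 T = (\<integral>y. indicator {0..T} (snd y) * pairing (U y, U y) \<partial>Q)"

lemma E0_integrable: "integrable Q (\<lambda>y. indicator {0..T} (snd y) * pairing (U y, U y))"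
  using S_integrable[of 0 0 T] by simp

text \<open>The bound does not involve \<open>a\<close> and \<open>b\<close>: shifts of size at most
  1 are absorbed by enlarging the window to \<open>T + 2\<close>.\<close>

lemma approx_error:
  assumes T: "T \<ge> 0" and \<delta>: "\<delta> > 0" and a: "0 \<le> a" "a \<le> 1" and b: "0 \<le> b" "b \<le> 1"
    and g: "integrable Q (\<lambda>y. indicator {a..T + a} (snd y) * gN N (U y) (U (fst y, snd y + b)))"
  shows "\<bar>S T a b - (\<integral>y. indicator {a..T + a} (snd y) * gN N (U y) (U (fst y, snd y + b)) \<partial>Q)\<bar>
    \<le> \<delta> * VI (T + 2) + \<delta> powr (- 1 / (p - 1)) * RI N (T + 2)"
proof -
  let ?\<kappa> = "\<delta> powr (- 1 / (p - 1))" and ?I = "\<lambda>y. indicator {a..T + a} (snd y) :: real"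
  note V = dominated_shift[OF borel_JU V_integrable _ b(1) a(1), of "T + a"]
  have R: "integrable Q (\<lambda>y. ?I y * \<rho> N (U (fst y, snd y + 0)) powr q)"
    "(\<integral>y. ?I y * \<rho> N (U (fst y, snd y + 0)) powr q \<partial>Q) \<le> (\<integral>y. indicator {0..T + a + 0} (snd y) * \<rho> N (U y) powr q \<partial>Q)"
    using rho_integrable by (intro dominated_shift a; simp)+
  have "\<bar>S T a b - (\<integral>y. ?I y * gN N (U y) (U (fst y, snd y + b)) \<partial>Q)\<bar> =
     \<bar>\<integral>y. ?I y * pairing (U y, U (fst y, snd y + b)) - ?I y * gN N (U y) (U (fst y, snd y + b)) \<partial>Q\<bar>"
    unfolding S_def using g S_integrable[OF a(1) b(1)] by simp
  also have "\<dots> \<le> (\<integral>y. \<bar>?I y * pairing (U y, U (fst y, snd y + b)) - ?I y * gN N (U y) (U (fst y, snd y + b))\<bar> \<partial>Q)"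
    by (rule integral_abs_bound)
  also have "\<dots> \<le> (\<integral>y. \<delta> * (?I y * norm (J (U (fst y, snd y + b))) powr p) + ?\<kappa> * (?I y * \<rho> N (U (fst y, snd y + 0)) powr q) \<partial>Q)"
  proof (rule integral_mono)
    show "integrable Q (\<lambda>y. \<bar>?I y * pairing (U y, U (fst y, snd y + b)) - ?I y * gN N (U y) (U (fst y, snd y + b))\<bar>)"
      using g S_integrable[OF a(1) b(1)] by auto
    show "integrable Q (\<lambda>y. \<delta> * (?I y * norm (J (U (fst y, snd y + b))) powr p) + ?\<kappa> * (?I y * \<rho> N (U (fst y, snd y + 0)) powr q))"
      using V(1) R(1) by auto
    fix y
    show "\<bar>?I y * pairing (U y, U (fst y, snd y + b)) - ?I y * gN N (U y) (U (fst y, snd y + b))\<bar> \<le>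
        \<delta> * (?I y * norm (J (U (fst y, snd y + b))) powr p) + ?\<kappa> * (?I y * \<rho> N (U (fst y, snd y + 0)) powr q)"
      using pairing_gN[OF \<delta>, of "U y" "U (fst y, snd y + b)" N] by (simp add: indicator_def)
  qed
  also have "\<dots> = \<delta> * (\<integral>y. ?I y * norm (J (U (fst y, snd y + b))) powr p \<partial>Q) + ?\<kappa> * (\<integral>y. ?I y * \<rho> N (U (fst y, snd y + 0)) powr q \<partial>Q)"
    using V(1) R(1) by simp
  also have "\<dots> \<le> \<delta> * VI (T + 2) + ?\<kappa> * RI N (T + 2)"
  proof (intro add_mono mult_left_mono)
    have "(\<integral>y. ?I y * norm (J (U (fst y, snd y + b))) powr p \<partial>Q) \<le> VI (T + a + b)"
      unfolding VI_def by (rule V(2)) simp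
    also have "\<dots> \<le> VI (T + 2)"
      unfolding VI_def using a b by (intro indicator_mono_integral V_integrable) auto
    finally show "(\<integral>y. ?I y * norm (J (U (fst y, snd y + b))) powr p \<partial>Q) \<le> VI (T + 2)" .
    have "(\<integral>y. ?I y * \<rho> N (U (fst y, snd y + 0)) powr q \<partial>Q) \<le> RI N (T + a + 0)"
      unfolding RI_def by (rule R(2))
    also have "\<dots> \<le> RI N (T + 2)"
      unfolding RI_def using a b by (intro indicator_mono_integral rho_integrable) auto
    finally show "(\<integral>y. ?I y * \<rho> N (U (fst y, snd y + 0)) powr q \<partial>Q) \<le> RI N (T + 2)" .
  qed (use \<delta> in auto)
  finally show ?thesis .
qed

text \<open>Three choices in this order: \<open>\<delta>\<close> small against the
  \<open>L^p(V)\<close> integral, then \<open>N\<close> so large that the error in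
  \<open>L^q(V')\<close> beats the factor depending on \<open>\<delta>\<close>, then
  \<open>n\<close> by \<open>gN_convergence\<close>. The substitution error occurs twice, for the
  shifted and for the limiting integral.\<close>

lemma S_convergence:
  assumes T: "T \<ge> 0" and a: "\<And>n. 0 \<le> a n" "\<And>n. a n \<le> 1" "a \<longlonglongrightarrow> 0"
    and b: "\<And>n. 0 \<le> b n" "\<And>n. b n \<le> 1" "b \<longlonglongrightarrow> 0"
  shows "(\<lambda>n. S T (a n) (b n)) \<longlonglongrightarrow> E0 T"
proof (rule LIMSEQ_I)
  fix \<epsilon> :: real assume \<epsilon>: "0 < \<epsilon>"
  \<comment> \<open>The \<open>+ 1\<close> avoids division by 0. Each substitution error is then at
    most \<open>\<epsilon> / 4\<close>, and a further \<open>\<epsilon> / 4\<close> is left for the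
    convergence.\<close>
  define \<delta> where "\<delta> = \<epsilon> / (8 * (VI (T + 2) + 1))"
  have \<delta>: "\<delta> > 0" using \<epsilon> VI_nonneg[of "T + 2"] by (simp add: \<delta>_def)
  let ?\<kappa> = "\<delta> powr (- 1 / (p - 1))"
  have "\<delta> * VI (T + 2) \<le> \<delta> * (VI (T + 2) + 1)" using \<delta> by simp
  also have "\<dots> = \<epsilon> / 8" using VI_nonneg[of "T + 2"] by (simp add: \<delta>_def field_simps)
  finally have dV: "\<delta> * VI (T + 2) \<le> \<epsilon> / 8" .
  have "(\<lambda>N. ?\<kappa> * RI N (T + 2)) \<longlonglongrightarrow> ?\<kappa> * 0"
    by (intro tendsto_intros RI_tendsto)
  then have "\<forall>\<^sub>F N in sequentially. ?\<kappa> * RI N (T + 2) < \<epsilon> / 8"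
    using \<epsilon> by (intro order_tendstoD(2)) auto
  then obtain N where N: "?\<kappa> * RI N (T + 2) < \<epsilon> / 8"
    by (meson eventually_happens sequentially_bot)
  note g = gN_convergence[OF T a b, where N = N]
  define L where "L = (\<integral>y. indicator {0..T} (snd y) * gN N (U y) (U y) \<partial>Q)"
  define l where "l n = (\<integral>y. indicator {a n..T + a n} (snd y) * gN N (U y) (U (fst y, snd y + b n)) \<partial>Q)" for n
  have "l \<longlonglongrightarrow> L" using g(1) by (simp add: l_def[abs_def] L_def)
  then obtain n0 where n0: "\<And>n. n \<ge> n0 \<Longrightarrow> \<bar>l n - L\<bar> < \<epsilon> / 4"
    using \<epsilon> LIMSEQ_D[of l L "\<epsilon> / 4"] by auto
  have e1: "\<bar>S T (a n) (b n) - l n\<bar> \<le> \<delta> * VI (T + 2) + ?\<kappa> * RI N (T + 2)" for n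
    unfolding l_def by (intro approx_error T \<delta> a b g)
  have "\<bar>S T 0 0 - L\<bar> \<le> \<delta> * VI (T + 2) + ?\<kappa> * RI N (T + 2)"
    using approx_error[OF T \<delta>, of 0 0 N] g(3) by (simp add: L_def)
  then have e2: "\<bar>E0 T - L\<bar> \<le> \<delta> * VI (T + 2) + ?\<kappa> * RI N (T + 2)" by (simp add: E0_def S_def)
  have "norm (S T (a n) (b n) - E0 T) < \<epsilon>" if "n \<ge> n0" for n
    unfolding real_norm_def using e1[of n] e2 n0[OF that] dV N by linarith
  then show "\<exists>no. \<forall>n\<ge>no. norm (S T (a n) (b n) - E0 T) < \<epsilon>" by blast
qed

lemma S_bound:
  assumes a: "0 \<le> a" "a \<le> 1" and b: "0 \<le> b" "b \<le> 1"
  shows "(\<integral>y. \<bar>indicator {a..T + a} (snd y) * pairing (U y, U (fst y, snd y + b))\<bar> \<partial>Q) \<le> VI (T + 2) + WI (T + 2)"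
proof -
  let ?I = "\<lambda>y. indicator {a..T + a} (snd y) :: real"
  note V = dominated_shift[OF borel_JU V_integrable _ b(1) a(1), of "T + a"]
  note W = dominated_shift[OF borel_BU W_integrable _ order_refl a(1), of "T + a"]
  have "(\<integral>y. \<bar>?I y * pairing (U y, U (fst y, snd y + b))\<bar> \<partial>Q) \<le>
     (\<integral>y. ?I y * norm (J (U (fst y, snd y + b))) powr p + ?I y * norm (B (U (fst y, snd y + 0))) powr q \<partial>Q)"
  proof (rule integral_mono)
    show "integrable Q (\<lambda>y. \<bar>?I y * pairing (U y, U (fst y, snd y + b))\<bar>)"
      using S_integrable[OF a(1) b(1)] by auto
    show "integrable Q (\<lambda>y. ?I y * norm (J (U (fst y, snd y + b))) powr p + ?I y * norm (B (U (fst y, snd y + 0))) powr q)"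
      using V(1) W(1) by auto
    fix y show "\<bar>?I y * pairing (U y, U (fst y, snd y + b))\<bar> \<le> ?I y * norm (J (U (fst y, snd y + b))) powr p + ?I y * norm (B (U (fst y, snd y + 0))) powr q"
      using pairing_bound by (simp add: indicator_def)
  qed
  also have "\<dots> = (\<integral>y. ?I y * norm (J (U (fst y, snd y + b))) powr p \<partial>Q) + (\<integral>y. ?I y * norm (B (U (fst y, snd y + 0))) powr q \<partial>Q)"
    using V(1) W(1) by (intro Bochner_Integration.integral_add) auto
  also have "\<dots> \<le> VI (T + a + b) + WI (T + a + 0)"
    unfolding VI_def WI_def using V(2) W(2) by (intro add_mono) auto
  also have "\<dots> \<le> VI (T + 2) + WI (T + 2)"
  proof (rule add_mono)
    show "VI (T + a + b) \<le> VI (T + 2)"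
      unfolding VI_def using a b by (intro indicator_mono_integral V_integrable) auto
    show "WI (T + a + 0) \<le> WI (T + 2)"
      unfolding WI_def using a b by (intro indicator_mono_integral W_integrable) auto
  qed
  finally show ?thesis .
qed


section \<open>Rescaling the time increment to the unit interval\<close>

sublocale TQ: pair_sigma_finite "lborel :: real measure" Q
  by (intro pair_sigma_finite.intro lborel.sigma_finite_measure_axioms PL.sigma_finite_measure_axioms)

text \<open>The substitution \<open>s = r + h * \<theta>\<close> maps \<open>(0, 1]\<close> onto
  \<open>(r, r + h]\<close>, so the domain of \<open>\<theta>\<close> depends neither on
  \<open>r\<close> nor on \<open>h\<close>, and the order of integration can be exchanged.\<close>

definition \<kappa> :: "real \<Rightarrow> real \<Rightarrow> real \<Rightarrow> 'w \<times> real \<Rightarrow> real" where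
  "\<kappa> T h \<theta> y = indicator {0<..1} \<theta> * (indicator {0..T} (snd y) *
     pairing (U (fst y, snd y + h * \<theta>), U (fst y, snd y + h)))"

lemma borel_kappa: "(\<lambda>(\<theta>, y). \<kappa> T h \<theta> y) \<in> borel_measurable (lborel \<Otimes>\<^sub>M Q)"
  unfolding \<kappa>_def by measurable

text \<open>For fixed \<open>\<theta>\<close>, translating \<open>r\<close> by
  \<open>h * \<theta>\<close> gives the integral \<open>S\<close>. The bound by \<open>VI\<close>
  and \<open>WI\<close> depends neither on \<open>h\<close> nor on \<open>\<theta>\<close> within
  \<open>(0, 1]\<close>; it serves Fubini here and dominated convergence in
  \<open>energy_inequality\<close>.\<close>

lemma kappa_section:
  assumes h: "0 < h" "h \<le> 1"
  shows "integrable Q (\<kappa> T h \<theta>)"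
    and "(\<integral>y. \<kappa> T h \<theta> y \<partial>Q) = indicator {0<..1} \<theta> * S T (h * \<theta>) (h - h * \<theta>)"
    and "(\<integral>y. norm (\<kappa> T h \<theta> y) \<partial>Q) \<le> indicator {0<..1} \<theta> * (VI (T + 2) + WI (T + 2))"
proof -
  define a b where "a = h * \<theta>" and "b = h - h * \<theta>"
  define f where "f y = indicator {a..T + a} (snd y) * pairing (U y, U (fst y, snd y + b))" for y
  have fm [measurable]: "f \<in> borel_measurable Q" unfolding f_def by measurable
  have k: "\<kappa> T h \<theta> y = indicator {0<..1} \<theta> * f (fst y, snd y + a)" for y
  proof -
    have e1: "snd y + a + b = snd y + h" by (simp add: a_def b_def)
    have e2: "(indicator {a..T + a} (snd y + a) :: real) = indicator {0..T} (snd y)"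
      by (auto simp: indicator_def)
    show ?thesis
      unfolding \<kappa>_def f_def fst_conv snd_conv e1 e2 a_def[symmetric] by (rule refl)
  qed
  have ab: "0 \<le> a" "a \<le> 1" "0 \<le> b" "b \<le> 1" if "\<theta> \<in> {0<..1}"
  proof -
    have "h * \<theta> \<le> h" "0 \<le> h * \<theta>" using that h mult_left_mono[of \<theta> 1 h] by simp_all
    then show "0 \<le> a" "a \<le> 1" "0 \<le> b" "b \<le> 1" using h unfolding a_def b_def by linarith+
  qed
  show "integrable Q (\<kappa> T h \<theta>)"
  proof (cases "\<theta> \<in> {0<..1}")
    case True
    then have "integrable Q f" unfolding f_def using ab by (intro S_integrable) auto
    then show ?thesis using shift_integral(2)[OF fm, of a] by (simp add: k[abs_def])
  qed (simp add: k[abs_def])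
  show "(\<integral>y. \<kappa> T h \<theta> y \<partial>Q) = indicator {0<..1} \<theta> * S T (h * \<theta>) (h - h * \<theta>)"
  proof -
    have "S T (h * \<theta>) (h - h * \<theta>) = integral\<^sup>L Q f"
      by (simp add: S_def f_def[abs_def] a_def b_def)
    then show ?thesis unfolding k using shift_integral(1)[OF fm, of a] by simp
  qed
  show "(\<integral>y. norm (\<kappa> T h \<theta> y) \<partial>Q) \<le> indicator {0<..1} \<theta> * (VI (T + 2) + WI (T + 2))"
  proof (cases "\<theta> \<in> {0<..1}")
    case True
    have "(\<integral>y. norm (\<kappa> T h \<theta> y) \<partial>Q) = (\<integral>y. \<bar>f (fst y, snd y + a)\<bar> \<partial>Q)"
      using True by (simp add: k)
    also have "\<dots> = (\<integral>y. \<bar>f y\<bar> \<partial>Q)"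
      using shift_integral(1)[of "\<lambda>y. \<bar>f y\<bar>" a] by simp
    also have "\<dots> \<le> VI (T + 2) + WI (T + 2)"
      unfolding f_def using ab[OF True] by (intro S_bound)
    finally show ?thesis using True by simp
  qed (simp add: k)
qed

lemma kappa_integrable:
  assumes h: "0 < h" "h \<le> 1"
  shows "integrable (lborel \<Otimes>\<^sub>M Q) (\<lambda>(\<theta>, y). \<kappa> T h \<theta> y)"
proof (rule TQ.Fubini_integrable[OF borel_kappa])
  let ?C = "VI (T + 2) + WI (T + 2)"
  have [measurable]: "(\<lambda>(\<theta>, y). norm (\<kappa> T h \<theta> y)) \<in> borel_measurable (lborel \<Otimes>\<^sub>M Q)"
    using measurable_compose[OF borel_kappa, of norm borel] by (simp add: split_beta)
  have "integrable lborel (\<lambda>\<theta>. \<integral>y. norm (\<kappa> T h \<theta> y) \<partial>Q)"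
  proof (rule Bochner_Integration.integrable_bound)
    show "integrable lborel (\<lambda>\<theta>. indicator {0<..1::real} \<theta> * ?C)"
      by (intro integrable_mult_left integrable_real_indicator) auto
    show "(\<lambda>\<theta>. \<integral>y. norm (\<kappa> T h \<theta> y) \<partial>Q) \<in> borel_measurable lborel"
      by (rule PL.borel_measurable_lebesgue_integral) measurable
    show "AE \<theta> in lborel. norm (\<integral>y. norm (\<kappa> T h \<theta> y) \<partial>Q) \<le> norm (indicator {0<..1} \<theta> * ?C)"
      using kappa_section(3)[OF h] by (intro AE_I2) (simp add: order_trans[OF _ abs_ge_self])
  qed
  then show "integrable lborel (\<lambda>\<theta>. \<integral>y. norm (case (\<theta>, y) of (\<theta>, y) \<Rightarrow> \<kappa> T h \<theta> y) \<partial>Q)" by simp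
  show "AE \<theta> in lborel. integrable Q (\<lambda>y. case (\<theta>, y) of (\<theta>, y) \<Rightarrow> \<kappa> T h \<theta> y)"
    using kappa_section(1)[OF h] by simp
qed

definition Dd :: "real \<Rightarrow> real \<Rightarrow> 'w \<times> real \<Rightarrow> real" where
  "Dd T h y = indicator {0..T} (snd y) * (U (fst y, snd y + h) \<bullet>
     (U y + MM (fst y, snd y + h) - MM y - U (fst y, snd y + h)))"

lemma Dd_eq: "h \<ge> 0 \<Longrightarrow> Dd T h (\<omega>, r) = indicator {0..T} r * D r (r + h) \<omega>"
  by (simp add: Dd_def D_def U_eq MM_eq indicator_def)

text \<open>\<open>D_eq\<close> with \<open>t = r + h\<close> after the substitution, whose Jacobian
  is the factor \<open>h\<close>. Membership of \<open>u (r + h)\<close> in \<open>V\<close> holds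
  almost everywhere on \<open>Q\<close> by translation.\<close>

lemma Dd_kappa:
  assumes h: "0 < h" "h \<le> 1"
  shows "AE y in Q. Dd T h y = h * (\<integral>\<theta>. \<kappa> T h \<theta> y \<partial>lborel)"
  using AE_fst[OF D_eq] range_AE_shift[of h]
proof eventually_elim
  case (elim y)
  obtain \<omega> r where y: "y = (\<omega>, r)" by fastforce
  show ?case
  proof (cases "r \<in> {0..T}")
    case True
    then have r: "0 \<le> r" "r \<le> r + h" "0 \<le> r + h" using h by auto
    then have "u (r + h) \<omega> \<in> range i" using elim(2) by (simp add: y U_eq)
    then have "D r (r + h) \<omega> = (\<integral>s. indicator {r<..r + h} s * pairing (u s \<omega>, u (r + h) \<omega>) \<partial>lborel)"
      using elim(1) r by (simp add: y)
    also have "\<dots> = h * (\<integral>\<theta>. indicator {r<..r + h} (r + h * \<theta>) * pairing (u (r + h * \<theta>) \<omega>, u (r + h) \<omega>) \<partial>lborel)"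
      using h by (subst lborel_integral_real_affine[where c = h and t = r]) auto
    also have "(\<integral>\<theta>. indicator {r<..r + h} (r + h * \<theta>) * pairing (u (r + h * \<theta>) \<omega>, u (r + h) \<omega>) \<partial>lborel) = (\<integral>\<theta>. \<kappa> T h \<theta> y \<partial>lborel)"
    proof (intro Bochner_Integration.integral_cong refl)
      fix \<theta>
      have "indicator {r<..r + h} (r + h * \<theta>) = (indicator {0<..1} \<theta> :: real)"
        using h by (auto simp: indicator_def zero_less_mult_iff)
      moreover have "0 \<le> r + h * \<theta>" if "\<theta> \<in> {0<..1}" using that h r by simp
      ultimately show "indicator {r<..r + h} (r + h * \<theta>) * pairing (u (r + h * \<theta>) \<omega>, u (r + h) \<omega>) = \<kappa> T h \<theta> y"
        using True r by (auto simp: \<kappa>_def y U_eq indicator_def)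
    qed
    finally show ?thesis using True h by (simp add: y Dd_eq)
  next
    case False
    then show ?thesis by (simp add: y Dd_def \<kappa>_def)
  qed
qed

lemma borel_Dd [measurable]: "Dd T h \<in> borel_measurable Q"
  unfolding Dd_def by measurable

lemma Dd_integral:
  assumes h: "0 < h" "h \<le> 1"
  shows "integrable Q (Dd T h)"
    and "(\<integral>y. Dd T h y \<partial>Q) = h * (\<integral>\<theta>. indicator {0<..1} \<theta> * S T (h * \<theta>) (h - h * \<theta>) \<partial>lborel)"
proof -
  note k = kappa_integrable[OF h, of T]
  have ik: "integrable Q (\<lambda>y. h * (\<integral>\<theta>. \<kappa> T h \<theta> y \<partial>lborel))"
    using TQ.integrable_snd[OF k] by simp
  show "integrable Q (Dd T h)"
    using ik Dd_kappa[OF h, of T] borel_Dd by (subst integrable_cong_AE[where g = "\<lambda>y. h * (\<integral>\<theta>. \<kappa> T h \<theta> y \<partial>lborel)"]) auto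
  have "(\<integral>y. Dd T h y \<partial>Q) = (\<integral>y. h * (\<integral>\<theta>. \<kappa> T h \<theta> y \<partial>lborel) \<partial>Q)"
    using ik Dd_kappa[OF h, of T] borel_Dd by (intro integral_cong_AE) auto
  also have "\<dots> = h * (\<integral>\<theta>. (\<integral>y. \<kappa> T h \<theta> y \<partial>Q) \<partial>lborel)"
    using TQ.Fubini_integral[OF k] by simp
  finally show "(\<integral>y. Dd T h y \<partial>Q) = h * (\<integral>\<theta>. indicator {0<..1} \<theta> * S T (h * \<theta>) (h - h * \<theta>) \<partial>lborel)"
    by (simp add: kappa_section(2)[OF h])
qed

section \<open>Averaging the energy estimate and letting the increment vanish\<close>

definition Yb :: "real \<Rightarrow> real" where "Yb r = Y (max 0 r)"

lemma borel_Yb [measurable]: "Yb \<in> borel_measurable borel"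
proof -
  have m: "(\<lambda>r. \<integral>\<omega>. (norm (f (\<omega>, r)))\<^sup>2 \<partial>P) \<in> borel_measurable borel"
    if [measurable]: "f \<in> borel_measurable (P \<Otimes>\<^sub>M borel)" for f :: "'w \<times> real \<Rightarrow> 'h"
    by (rule borel_measurable_lebesgue_integral) measurable
  show ?thesis
    using borel_measurable_diff[OF m[OF borel_U] m[OF borel_MM]]
    by (simp add: Yb_def[abs_def] Y_def U_def MM_def)
qed

lemma Y_bounds:
  assumes "0 \<le> t" "t < T"
  shows "Y t \<le> KS T" "- X T \<le> Y t"
proof -
  have "0 \<le> expectation (\<lambda>\<omega>. (norm (u t \<omega>))\<^sup>2)" "0 \<le> expectation (\<lambda>\<omega>. (norm (M t \<omega>))\<^sup>2)" by simp_all
  then show "Y t \<le> KS T" "- X T \<le> Y t"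
    unfolding Y_def using KS_bound[OF assms] M_le_X[OF assms(1)] X_mono[of t T] assms by linarith+
qed

lemma Yb_integrable:
  assumes "0 \<le> a"
  shows "integrable lborel (\<lambda>r. indicator {a..b} r * Yb r)"
proof (rule Bochner_Integration.integrable_bound)
  show "integrable lborel (\<lambda>r. indicator {a..b} r * (\<bar>KS (\<bar>b\<bar> + 1)\<bar> + \<bar>X (\<bar>b\<bar> + 1)\<bar>))"
    by (intro integrable_mult_left integrable_real_indicator) (auto simp: emeasure_lborel_Icc_eq)
  show "AE r in lborel. norm (indicator {a..b} r * Yb r) \<le> norm (indicator {a..b} r * (\<bar>KS (\<bar>b\<bar> + 1)\<bar> + \<bar>X (\<bar>b\<bar> + 1)\<bar>))"
  proof (intro AE_I2)
    fix r
    show "norm (indicator {a..b} r * Yb r) \<le> norm (indicator {a..b} r * (\<bar>KS (\<bar>b\<bar> + 1)\<bar> + \<bar>X (\<bar>b\<bar> + 1)\<bar>))"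
    proof (cases "r \<in> {a..b}")
      case True
      then have "Yb r \<le> KS (\<bar>b\<bar> + 1)" "- X (\<bar>b\<bar> + 1) \<le> Yb r"
        using Y_bounds[of r "\<bar>b\<bar> + 1"] assms by (auto simp: Yb_def)
      then show ?thesis using True by (simp add: abs_le_iff) linarith
    qed simp
  qed
qed measurable

text \<open>Averaging over \<open>r \<in> [0, T]\<close> with \<open>t = r + h\<close> telescopes \<open>Y r - Y t\<close> and avoids the choice of a
  partition along which step functions converge to \<open>u\<close> in \<open>L\<^sup>p(V)\<close>.\<close>

lemma averaged_energy:
  assumes T: "T \<ge> 0" and h: "0 < h" "h \<le> 1"
  shows "2 * (\<integral>\<theta>. indicator {0<..1} \<theta> * S T (h * \<theta>) (h - h * \<theta>) \<partial>lborel) \<le> KS 2 + X (T + 2 * h)"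
proof -
  have shift: "(\<integral>r. indicator {0..T} r * Yb (r + h) \<partial>lborel) = (\<integral>r. indicator {h..T + h} r * Yb r \<partial>lborel)"
    "integrable lborel (\<lambda>r. indicator {0..T} r * Yb (r + h))"
  proof -
    have eq: "indicator {h..T + h} (h + 1 * r) * Yb (h + 1 * r) = indicator {0..T} r * Yb (r + h)" for r
      by (auto simp: indicator_def add.commute)
    show "(\<integral>r. indicator {0..T} r * Yb (r + h) \<partial>lborel) = (\<integral>r. indicator {h..T + h} r * Yb r \<partial>lborel)"
      using lborel_integral_real_affine[of 1 "\<lambda>r. indicator {h..T + h} r * Yb r" h] by (simp add: eq[simplified])
    show "integrable lborel (\<lambda>r. indicator {0..T} r * Yb (r + h))"
      using lborel_integrable_real_affine[OF Yb_integrable[of h "T + h"], of 1 h] h by (simp add: eq[simplified])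
  qed
  note D = Dd_integral[OF h, of T]
  have "(\<integral>y. Dd T h y \<partial>Q) = (\<integral>r. (\<integral>\<omega>. Dd T h (\<omega>, r) \<partial>P) \<partial>lborel)"
    using PL.integral_snd[of "\<lambda>\<omega> r. Dd T h (\<omega>, r)"] D(1) by simp
  then have eqD: "2 * (\<integral>y. Dd T h y \<partial>Q) = (\<integral>r. 2 * (\<integral>\<omega>. Dd T h (\<omega>, r) \<partial>P) \<partial>lborel)" by simp
  also have "\<dots> \<le> (\<integral>r. indicator {0..T} r * Yb r - indicator {0..T} r * Yb (r + h) \<partial>lborel)"
  proof (rule integral_mono)
    show "integrable lborel (\<lambda>r. 2 * (\<integral>\<omega>. Dd T h (\<omega>, r) \<partial>P))"
      using PL.integrable_snd[of "\<lambda>\<omega> r. Dd T h (\<omega>, r)"] D(1) by simp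
    show "integrable lborel (\<lambda>r. indicator {0..T} r * Yb r - indicator {0..T} r * Yb (r + h))"
      by (intro Bochner_Integration.integrable_diff Yb_integrable shift) simp
    fix r
    show "2 * (\<integral>\<omega>. Dd T h (\<omega>, r) \<partial>P) \<le> indicator {0..T} r * Yb r - indicator {0..T} r * Yb (r + h)"
    proof (cases "r \<in> {0..T}")
      case True
      then show ?thesis using energy_step[of r "r + h"] h by (simp add: Dd_eq Yb_def max_def)
    qed (use h in \<open>simp add: Dd_eq\<close>)
  qed
  also have "\<dots> = (\<integral>r. indicator {0..T} r * Yb r - indicator {h..T + h} r * Yb r \<partial>lborel)"
    using shift Yb_integrable[of 0 T] Yb_integrable[of h "T + h"] h by simp
  \<comment> \<open>The two windows differ only near their ends. On the left \<open>Y\<close> is at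
    most \<open>KS 2\<close>, because \<open>h < 2\<close>; on the right \<open>- Y\<close> is at
    most \<open>X (T + 2 * h)\<close>, with \<open>2 * h\<close> instead of \<open>h\<close> because
    \<open>Y_bounds\<close> wants a strict inequality. Both end pieces have length \<open>h\<close>,
    which cancels the Jacobian.\<close>
  also have "\<dots> \<le> (\<integral>r. indicator {0..h} r * KS 2 + indicator {T..T + h} r * X (T + 2 * h) \<partial>lborel)"
  proof (rule integral_mono)
    show "integrable lborel (\<lambda>r. indicator {0..T} r * Yb r - indicator {h..T + h} r * Yb r)"
      using h by (intro Bochner_Integration.integrable_diff Yb_integrable) auto
    show "integrable lborel (\<lambda>r. indicator {0..h} r * KS 2 + indicator {T..T + h} r * X (T + 2 * h))"
      using h by (intro Bochner_Integration.integrable_add integrable_mult_left integrable_real_indicator) auto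
    fix r
    have K0: "KS 2 \<ge> 0" unfolding KS_def by (intro integral_nonneg_AE AE_I2) (simp add: sup_sq_def)
    show "indicator {0..T} r * Yb r - indicator {h..T + h} r * Yb r \<le> indicator {0..h} r * KS 2 + indicator {T..T + h} r * X (T + 2 * h)"
    proof (cases "r \<in> {0..T}")
      case True
      then have "r \<in> {h..T + h} \<or> r \<in> {0..h}" using h by auto
      moreover have "Yb r \<le> KS 2" if "r \<in> {0..h}"
        using that Y_bounds(1)[of r 2] h by (simp add: Yb_def)
      ultimately show ?thesis using True K0 X_nonneg[of "T + 2 * h"] by (auto simp: indicator_def)
    next
      case False
      have "- X (T + 2 * h) \<le> Yb r" if "r \<in> {h..T + h}"
        using that Y_bounds(2)[of r "T + 2 * h"] h by (simp add: Yb_def)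
      then show ?thesis using False K0 X_nonneg[of "T + 2 * h"] h by (auto simp: indicator_def)
    qed
  qed
  also have "\<dots> = h * (KS 2 + X (T + 2 * h))"
    using h by (subst Bochner_Integration.integral_add) (auto simp: algebra_simps)
  finally have "2 * (h * (\<integral>\<theta>. indicator {0<..1} \<theta> * S T (h * \<theta>) (h - h * \<theta>) \<partial>lborel)) \<le> h * (KS 2 + X (T + 2 * h))"
    unfolding D(2) .
  then show ?thesis using h by (simp add: mult.left_commute[of 2 h] mult_le_cancel_left)
qed

lemma X_right_cont:
  assumes "T \<ge> 0" "\<And>n. 0 \<le> a n" "\<And>n. a n \<le> 1" "a \<longlonglongrightarrow> 0"
  shows "(\<lambda>n. X (T + a n)) \<longlonglongrightarrow> X T"
  unfolding X_def
proof (rule integral_dominated_convergence[OF _ _ gsq_integrable[of "T + 1"]])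
  have Ta: "(\<lambda>n. T + a n) \<longlonglongrightarrow> T" using tendsto_add[OF tendsto_const assms(4), of T] by simp
  show "AE y in Q. (\<lambda>n. indicator {0..T + a n} (snd y) * gsq (U y)) \<longlonglongrightarrow> indicator {0..T} (snd y) * gsq (U y)"
  proof (intro AE_I2 tendsto_eventually)
    fix y :: "'w \<times> real"
    have "\<forall>\<^sub>F n in sequentially. snd y > T \<longrightarrow> T + a n < snd y"
      using order_tendstoD(2)[OF Ta, of "snd y"] by (cases "snd y > T") auto
    then show "\<forall>\<^sub>F n in sequentially. indicator {0..T + a n} (snd y) * gsq (U y) = indicator {0..T} (snd y) * gsq (U y)"
    proof eventually_elim
      case (elim n)
      then show ?case using assms(2)[of n] by (auto simp: indicator_def)
    qed
  qed
  show "AE y in Q. norm (indicator {0..T + a n} (snd y) * gsq (U y)) \<le> indicator {0..T + 1} (snd y) * gsq (U y)" for n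
    using assms(3)[of n] by (intro AE_I2) (auto simp: indicator_def gsq_nonneg)
qed measurable

lemma energy_inequality:
  assumes T: "T \<ge> 0"
  shows "2 * E0 T \<le> KS 2 + X T"
proof -
  \<comment> \<open>The factor 2 keeps \<open>2 * h n\<close> below 1, as required for
    \<open>X_right_cont\<close>.\<close>
  define h where "h n = 1 / (2 * real (Suc n))" for n
  have h: "0 < h n" "h n \<le> 1 / 2" for n by (auto simp: h_def field_simps)
  have hlim: "h \<longlonglongrightarrow> 0"
    using tendsto_mult[OF tendsto_const[of "1 / 2"] LIMSEQ_inverse_real_of_nat] by (simp add: h_def[abs_def] field_simps)
  let ?s = "\<lambda>n \<theta>. indicator {0<..1} \<theta> * S T (h n * \<theta>) (h n - h n * \<theta>)"
  let ?C = "VI (T + 2) + WI (T + 2)"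
  have "(\<lambda>n. \<integral>\<theta>. ?s n \<theta> \<partial>lborel) \<longlonglongrightarrow> (\<integral>\<theta>. indicator {0<..1::real} \<theta> * E0 T \<partial>lborel)"
  proof (rule integral_dominated_convergence[where s = ?s and w = "\<lambda>\<theta>. indicator {0<..1} \<theta> * ?C"])
    show "integrable lborel (\<lambda>\<theta>. indicator {0<..1::real} \<theta> * ?C)"
      by (intro integrable_mult_left integrable_real_indicator) auto
    show "AE \<theta> in lborel. (\<lambda>n. ?s n \<theta>) \<longlonglongrightarrow> indicator {0<..1} \<theta> * E0 T"
    proof (intro AE_I2)
      fix \<theta> :: real
      show "(\<lambda>n. ?s n \<theta>) \<longlonglongrightarrow> indicator {0<..1} \<theta> * E0 T"
      proof (cases "\<theta> \<in> {0<..1}")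
        case True
        have le: "0 \<le> h n * \<theta>" "h n * \<theta> \<le> h n" for n
          using True h(1)[of n] mult_left_mono[of \<theta> 1 "h n"] by auto
        have "(\<lambda>n. h n * \<theta>) \<longlonglongrightarrow> 0 * \<theta>" "(\<lambda>n. h n - h n * \<theta>) \<longlonglongrightarrow> 0 - 0 * \<theta>"
          by (intro tendsto_intros hlim)+
        then have "(\<lambda>n. S T (h n * \<theta>) (h n - h n * \<theta>)) \<longlonglongrightarrow> E0 T"
        proof (intro S_convergence T)
          fix n
          show "0 \<le> h n * \<theta>" "h n * \<theta> \<le> 1" "0 \<le> h n - h n * \<theta>" "h n - h n * \<theta> \<le> 1"
            using le[of n] h(2)[of n] by auto
        qed simp_all
        then show ?thesis using True by simp
      qed simp
    qed
    show "?s n \<in> borel_measurable lborel" for n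
    proof -
      have "(\<lambda>\<theta>. \<integral>y. \<kappa> T (h n) \<theta> y \<partial>Q) \<in> borel_measurable lborel"
        using borel_kappa by (rule PL.borel_measurable_lebesgue_integral)
      moreover have "(\<integral>y. \<kappa> T (h n) \<theta> y \<partial>Q) = ?s n \<theta>" for \<theta>
        using kappa_section(2)[of "h n"] h[of n] by simp
      ultimately show ?thesis by simp
    qed
    show "AE \<theta> in lborel. norm (?s n \<theta>) \<le> indicator {0<..1} \<theta> * ?C" for n
    proof (intro AE_I2)
      fix \<theta>
      have hn: "0 < h n" "h n \<le> 1" using h[of n] by auto
      have "norm (?s n \<theta>) = norm (\<integral>y. \<kappa> T (h n) \<theta> y \<partial>Q)"
        using kappa_section(2)[OF hn] by simp
      also have "\<dots> \<le> (\<integral>y. norm (\<kappa> T (h n) \<theta> y) \<partial>Q)" by (rule integral_norm_bound)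
      also have "\<dots> \<le> indicator {0<..1} \<theta> * ?C" by (rule kappa_section(3)[OF hn])
      finally show "norm (?s n \<theta>) \<le> indicator {0<..1} \<theta> * ?C" .
    qed
  qed simp
  then have 1: "(\<lambda>n. 2 * (\<integral>\<theta>. ?s n \<theta> \<partial>lborel)) \<longlonglongrightarrow> 2 * E0 T"
    by (intro tendsto_mult tendsto_const) simp
  have "(\<lambda>n. 2 * h n) \<longlonglongrightarrow> 2 * 0" by (intro tendsto_intros hlim)
  then have "(\<lambda>n. X (T + 2 * h n)) \<longlonglongrightarrow> X T"
  proof (intro X_right_cont T)
    show "0 \<le> 2 * h n" "2 * h n \<le> 1" for n using h[of n] by auto
  qed simp
  then have 2: "(\<lambda>n. KS 2 + X (T + 2 * h n)) \<longlonglongrightarrow> KS 2 + X T" by (intro tendsto_intros)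
  have "2 * (\<integral>\<theta>. ?s n \<theta> \<partial>lborel) \<le> KS 2 + X (T + 2 * h n)" for n
    using averaged_energy[OF T, of "h n"] h[of n] by simp
  then show ?thesis by (intro LIMSEQ_le[OF 1 2]) auto
qed


section \<open>From the energy inequality to time averages\<close>

lemma integral_window: "T \<ge> 0 \<Longrightarrow> (\<integral>y. indicator {0..T} (snd y) \<partial>Q) = (T :: real)"
proof -
  assume T: "T \<ge> 0"
  have "integrable Q (\<lambda>(\<omega>, t). indicator {0..T} t :: real)"
    using indicator_integrable[of 0 T] by (simp add: split_beta')
  from PL.integral_fst[OF this] show ?thesis using T by (simp add: split_beta' prob_space)
qed

text \<open>Adding \<open>|v|^2\<close> in \<open>H\<close> to both sides of coercivity explains the
  coefficient \<open>\<alpha>\<^sub>0 + 1\<close>; half of the term with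
  \<open>\<alpha>\<^sub>1\<close> pays for it, and the other half with the added square gives the
  factor \<open>min 1 (\<alpha>\<^sub>1 / 2)\<close>. After integration \<open>X T\<close> cancels,
  so that only \<open>KS 2\<close> depends on the initial value and only a constant multiplies
  \<open>T\<close>.\<close>

lemma time_average:
  assumes coercive: "\<And>v. 2 * A v v - msq m (G (i v)) + \<alpha>\<^sub>0 * (norm (i v))\<^sup>2 \<ge> \<alpha>\<^sub>1 * norm v powr p - C\<^sub>0"
    and c: "\<And>v. (\<alpha>\<^sub>0 + 1) * (norm (i v))\<^sup>2 \<le> \<alpha>\<^sub>1 / 2 * norm v powr p + C\<^sub>3" and \<alpha>: "\<alpha>\<^sub>1 > 0"
    and \<psi> [measurable]: "\<psi> \<in> borel_measurable borel" and \<psi>0: "\<And>y. 0 \<le> \<psi> y" and \<psi>k: "\<And>y. \<psi> y \<le> k"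
    and dom: "\<And>v. \<psi> (i v) \<le> (norm (i v))\<^sup>2 + norm v powr p" and T: "T \<ge> 0"
  shows "(\<integral>t. indicator {0..T} t * expectation (\<lambda>\<omega>. \<psi> (u (max 0 t) \<omega>)) \<partial>lborel) \<le> (KS 2 + (C\<^sub>0 + C\<^sub>3) * T) / min 1 (\<alpha>\<^sub>1 / 2)"
proof -
  let ?c = "min 1 (\<alpha>\<^sub>1 / 2)" and ?I = "\<lambda>y. indicator {0..T} (snd y) :: real"
  have c0: "?c > 0" using \<alpha> by simp
  have \<psi>int: "integrable Q (\<lambda>y. ?I y * \<psi> (U y))"
  proof (rule Bochner_Integration.integrable_bound)
    show "integrable Q (\<lambda>y. ?I y * k)" using indicator_integrable by simp
    show "AE y in Q. norm (?I y * \<psi> (U y)) \<le> norm (?I y * k)"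
    proof (intro AE_I2)
      fix y
      have "\<psi> (U y) \<le> k" "0 \<le> \<psi> (U y)" using \<psi>0 \<psi>k by auto
      then show "norm (?I y * \<psi> (U y)) \<le> norm (?I y * k)" by (simp add: indicator_def)
    qed
  qed measurable
  have pt: "?c * \<psi> y \<le> 2 * pairing (y, y) - gsq y + (C\<^sub>0 + C\<^sub>3)" if y: "y \<in> range i" for y
  proof -
    obtain v where v: "y = i v" using y by blast
    have "?c * \<psi> y \<le> ?c * ((norm (i v))\<^sup>2 + norm v powr p)"
      using dom[of v] c0 by (simp add: v mult_left_mono)
    also have "\<dots> \<le> (norm (i v))\<^sup>2 + \<alpha>\<^sub>1 / 2 * norm v powr p"
    proof -
      have "?c * (norm (i v))\<^sup>2 \<le> 1 * (norm (i v))\<^sup>2" "?c * norm v powr p \<le> \<alpha>\<^sub>1 / 2 * norm v powr p"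
        by (intro mult_right_mono; simp)+
      then show ?thesis by (simp add: distrib_left)
    qed
    also have "\<dots> \<le> 2 * A v v - msq m (G (i v)) + (C\<^sub>0 + C\<^sub>3)"
      using coercive[of v] c[of v] by (simp add: distrib_right)
    finally show ?thesis by (simp add: v pairing_def gsq_def B_eq)
  qed
  note ints = E0_integrable[of T] gsq_integrable[of T] indicator_integrable[of 0 T] \<psi>int
  have "?c * (\<integral>y. ?I y * \<psi> (U y) \<partial>Q) = (\<integral>y. ?c * (?I y * \<psi> (U y)) \<partial>Q)" by simp
  also have "\<dots> \<le> (\<integral>y. 2 * (?I y * pairing (U y, U y)) - ?I y * gsq (U y) + (C\<^sub>0 + C\<^sub>3) * ?I y \<partial>Q)"
  proof (rule integral_mono_AE)
    show "AE y in Q. ?c * (?I y * \<psi> (U y)) \<le> 2 * (?I y * pairing (U y, U y)) - ?I y * gsq (U y) + (C\<^sub>0 + C\<^sub>3) * ?I y"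
      using range_AE
    proof eventually_elim
      case (elim y)
      then show ?case using pt[of "U y"] by (cases "snd y \<in> {0..T}") (simp_all del: image_iff)
    qed
  qed (use ints in auto)
  also have "\<dots> = 2 * E0 T - X T + (C\<^sub>0 + C\<^sub>3) * T"
    using ints integral_window[OF T] by (simp add: E0_def X_def)
  also have "\<dots> \<le> KS 2 + (C\<^sub>0 + C\<^sub>3) * T"
    using energy_inequality[OF T] by simp
  finally have "?c * (\<integral>y. ?I y * \<psi> (U y) \<partial>Q) \<le> KS 2 + (C\<^sub>0 + C\<^sub>3) * T" .
  then have le: "(\<integral>y. ?I y * \<psi> (U y) \<partial>Q) \<le> (KS 2 + (C\<^sub>0 + C\<^sub>3) * T) / ?c"
    using c0 by (simp add: pos_le_divide_eq mult.commute)
  have "(\<integral>y. ?I y * \<psi> (U y) \<partial>Q) = (\<integral>t. (\<integral>\<omega>. indicator {0..T} t * \<psi> (u (max 0 t) \<omega>) \<partial>P) \<partial>lborel)"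
    using PL.integral_snd[of "\<lambda>\<omega> t. indicator {0..T} t * \<psi> (u (max 0 t) \<omega>)"] \<psi>int
    by (simp add: split_beta' U_def)
  then show ?thesis using le by simp
qed

text \<open>Right-continuity in time, together with measurability in the initial value, yields the
  joint measurability needed to exchange the time average with the integral under
  \<open>\<nu>\<close>.\<close>

lemma transition_right_cont:
  assumes \<psi>: "continuous_on UNIV \<psi>" "\<And>y. 0 \<le> \<psi> y" "\<And>y. \<psi> y \<le> (k :: real)" and t: "t \<ge> 0"
  shows "((\<lambda>s. expectation (\<lambda>\<omega>. \<psi> (u s \<omega>))) \<longlongrightarrow> expectation (\<lambda>\<omega>. \<psi> (u t \<omega>))) (at_right t)"
  unfolding tendsto_at_iff_sequentially
proof (intro allI impI)
  fix r assume r: "\<forall>n. r n \<in> {t<..} - {t}" "r \<longlonglongrightarrow> t"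
  then have r0: "r n \<ge> 0" for n using t by (metis DiffD1 greaterThan_iff less_eq_real_def order_trans)
  have [measurable]: "\<psi> \<in> borel_measurable borel" using \<psi>(1) by (rule borel_measurable_continuous_onI)
  show "((\<lambda>s. expectation (\<lambda>\<omega>. \<psi> (u s \<omega>))) \<circ> r) \<longlonglongrightarrow> expectation (\<lambda>\<omega>. \<psi> (u t \<omega>))"
    unfolding comp_def
  proof (rule integral_dominated_convergence[where w = "\<lambda>_. k"])
    show "(\<lambda>\<omega>. \<psi> (u t \<omega>)) \<in> borel_measurable P" "\<And>n. (\<lambda>\<omega>. \<psi> (u (r n) \<omega>)) \<in> borel_measurable P"
      using measurable_compose[OF u_measurable \<open>\<psi> \<in> borel_measurable borel\<close>] t r0 by auto
    show "AE \<omega> in P. (\<lambda>n. \<psi> (u (r n) \<omega>)) \<longlonglongrightarrow> \<psi> (u t \<omega>)"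
    proof (intro AE_I2)
      fix \<omega> assume "\<omega> \<in> space P"
      from u_right_cont[OF this t] have "(\<lambda>n. u (r n) \<omega>) \<longlonglongrightarrow> u t \<omega>"
        unfolding tendsto_at_iff_sequentially using r by (auto simp: comp_def)
      moreover have "isCont \<psi> (u t \<omega>)" using \<psi>(1) by (simp add: continuous_on_eq_continuous_at)
      ultimately show "(\<lambda>n. \<psi> (u (r n) \<omega>)) \<longlonglongrightarrow> \<psi> (u t \<omega>)" by (rule isCont_tendsto_compose[rotated])
    qed
    show "\<And>n. AE \<omega> in P. norm (\<psi> (u (r n) \<omega>)) \<le> k" using \<psi> by (intro AE_I2) simp
  qed simp
qed

end

section \<open>Invariant measures\<close>

text \<open>The constant \<open>K\<close> depends on \<open>x\<close> in an uncontrolled way, so the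
  bound on the averages cannot be integrated directly. The positive part of \<open>g n x - C\<close>
  is at most \<open>k\<close> and tends to 0 for every \<open>x\<close>, and its integral is at
  least \<open>I - C\<close> by invariance.\<close>

lemma prob_space_average_bound:
  fixes f :: "real \<Rightarrow> 'a \<Rightarrow> real"
  assumes \<nu>: "prob_space \<nu>"
    and meas: "(\<lambda>(x, t). f (max 0 t) x) \<in> borel_measurable (\<nu> \<Otimes>\<^sub>M lborel)"
    and f0: "\<And>t x. t \<ge> 0 \<Longrightarrow> 0 \<le> f t x" and fk: "\<And>t x. t \<ge> 0 \<Longrightarrow> f t x \<le> k"
    and inv: "\<And>t. t \<ge> 0 \<Longrightarrow> (\<integral>x. f t x \<partial>\<nu>) = I"
    and avg: "\<And>x. \<exists>K. \<forall>T\<ge>0. (\<integral>t. indicator {0..T} t * f (max 0 t) x \<partial>lborel) \<le> K + C * T"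
    and C: "C \<ge> 0"
  shows "I \<le> C"
proof -
  interpret prob_space \<nu> by fact
  interpret L: pair_sigma_finite \<nu> "lborel :: real measure" ..
  have k0: "k \<ge> 0"
  proof -
    obtain x where "x \<in> space \<nu>" using not_empty by blast
    then show ?thesis using f0[of 0 x] fk[of 0 x] by simp
  qed
  define \<phi> where "\<phi> T x t = indicator {0..T} t * f (max 0 t) x" for T x and t :: real
  have \<phi>m: "(\<lambda>(x, t). \<phi> T x t) \<in> borel_measurable (\<nu> \<Otimes>\<^sub>M lborel)" for T
  proof -
    have "(\<lambda>y. indicator {0..T} (snd y) :: real) \<in> borel_measurable (\<nu> \<Otimes>\<^sub>M lborel)"
      by (rule measurable_compose[OF measurable_snd]) simp
    from borel_measurable_times[OF this meas] show ?thesis by (simp add: \<phi>_def split_beta)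
  qed
  have \<phi>b: "norm (\<phi> T x t) \<le> indicator {0..T} t * k" "0 \<le> \<phi> T x t" for T x t
    using f0[of "max 0 t" x] fk[of "max 0 t" x] by (auto simp: \<phi>_def indicator_def)
  have ind: "integrable lborel (\<lambda>t. indicator {0..T} t * k)" for T :: real
    by (intro integrable_mult_left integrable_real_indicator) (auto simp: emeasure_lborel_Icc_eq)
  have sec: "integrable lborel (\<phi> T x)" if "x \<in> space \<nu>" for T x
  proof (rule Bochner_Integration.integrable_bound[OF ind])
    show "\<phi> T x \<in> borel_measurable lborel"
      using measurable_compose[OF measurable_Pair1'[OF that] \<phi>m[of T]] by simp
    show "AE t in lborel. norm (\<phi> T x t) \<le> norm (indicator {0..T} t * k)"
      using \<phi>b(1)[of T x] k0 by (intro AE_I2) (simp add: order_trans[OF _ abs_ge_self])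
  qed
  have secle: "(\<integral>t. norm (\<phi> T x t) \<partial>lborel) \<le> T * k" if "x \<in> space \<nu>" "T \<ge> 0" for T x
  proof -
    have "(\<integral>t. norm (\<phi> T x t) \<partial>lborel) \<le> (\<integral>t. indicator {0..T} t * k \<partial>lborel)"
      using sec[OF that(1)] ind \<phi>b(1) by (intro integral_mono) auto
    then show ?thesis using that by simp
  qed
  have \<phi>int: "integrable (\<nu> \<Otimes>\<^sub>M lborel) (\<lambda>(x, t). \<phi> T x t)" if "T \<ge> 0" for T
  proof (rule L.Fubini_integrable[OF \<phi>m])
    have nm: "(\<lambda>(x, t). norm (\<phi> T x t)) \<in> borel_measurable (\<nu> \<Otimes>\<^sub>M lborel)"
      using measurable_compose[OF \<phi>m, of norm borel] by (simp add: split_beta)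
    have "integrable \<nu> (\<lambda>x. \<integral>t. norm (\<phi> T x t) \<partial>lborel)"
    proof (rule integrable_const_bound[where B = "T * k"])
      show "AE x in \<nu>. norm (\<integral>t. norm (\<phi> T x t) \<partial>lborel) \<le> T * k"
        using secle that by (intro AE_I2) simp
    qed (rule lborel.borel_measurable_lebesgue_integral[OF nm])
    then show "integrable \<nu> (\<lambda>x. \<integral>t. norm (case (x, t) of (x, t) \<Rightarrow> \<phi> T x t) \<partial>lborel)" by simp
    show "AE x in \<nu>. integrable lborel (\<lambda>t. case (x, t) of (x, t) \<Rightarrow> \<phi> T x t)"
      using sec by (intro AE_I2) simp
  qed
  define g where "g n x = (\<integral>t. \<phi> (real (Suc n)) x t \<partial>lborel) / real (Suc n)" for n x
  have gm [measurable]: "g n \<in> borel_measurable \<nu>" for n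
    unfolding g_def by (intro borel_measurable_divide lborel.borel_measurable_lebesgue_integral \<phi>m borel_measurable_const)
  have gI: "(\<integral>x. g n x \<partial>\<nu>) = I" and gint: "integrable \<nu> (g n)" for n
  proof -
    note i = \<phi>int[of "real (Suc n)", OF of_nat_0_le_iff]
    have "(\<integral>x. (\<integral>t. \<phi> (real (Suc n)) x t \<partial>lborel) \<partial>\<nu>) = (\<integral>t. (\<integral>x. \<phi> (real (Suc n)) x t \<partial>\<nu>) \<partial>lborel)"
      using L.Fubini_integral[OF i] by simp
    also have "\<dots> = (\<integral>t. indicator {0..real (Suc n)} t * I \<partial>lborel)"
      by (simp add: \<phi>_def inv)
    also have "\<dots> = real (Suc n) * I" by simp
    finally show "(\<integral>x. g n x \<partial>\<nu>) = I" by (simp add: g_def del: of_nat_Suc)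
    show "integrable \<nu> (g n)"
      using L.integrable_fst[OF i] unfolding g_def by simp
  qed
  have gb: "0 \<le> g n x" "g n x \<le> k" if "x \<in> space \<nu>" for n x
  proof -
    show "0 \<le> g n x" unfolding g_def using \<phi>b(2) by simp
    have "(\<integral>t. \<phi> (real (Suc n)) x t \<partial>lborel) \<le> real (Suc n) * k"
      using secle[OF that, of "real (Suc n)"] \<phi>b(2) by simp
    then show "g n x \<le> k" by (simp add: g_def divide_le_eq mult.commute del: of_nat_Suc)
  qed
  have lim: "(\<lambda>n. \<integral>x. max 0 (g n x - C) \<partial>\<nu>) \<longlonglongrightarrow> (\<integral>x. 0 \<partial>\<nu>)"
  proof (rule integral_dominated_convergence[where w = "\<lambda>_. k"])
    show "AE x in \<nu>. (\<lambda>n. max 0 (g n x - C)) \<longlonglongrightarrow> 0"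
    proof (intro AE_I2)
      fix x
      obtain K where K: "\<And>T. T \<ge> 0 \<Longrightarrow> (\<integral>t. \<phi> T x t \<partial>lborel) \<le> K + C * T"
        using avg[of x] unfolding \<phi>_def by blast
      have le: "max 0 (g n x - C) \<le> \<bar>K\<bar> * (1 / real (Suc n))" for n
      proof -
        have "g n x \<le> (K + C * real (Suc n)) / real (Suc n)"
          unfolding g_def using K[of "real (Suc n)"] by (intro divide_right_mono) auto
        also have "\<dots> = K * (1 / real (Suc n)) + C" by (simp add: add_divide_distrib del: of_nat_Suc)
        finally have "g n x - C \<le> K * (1 / real (Suc n))" by simp
        also have "\<dots> \<le> \<bar>K\<bar> * (1 / real (Suc n))" by (intro mult_right_mono) auto
        finally show ?thesis by simp
      qed
      have "(\<lambda>n. \<bar>K\<bar> * (1 / real (Suc n))) \<longlonglongrightarrow> \<bar>K\<bar> * 0"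
        using LIMSEQ_inverse_real_of_nat by (intro tendsto_intros) (simp add: inverse_eq_divide)
      then show "(\<lambda>n. max 0 (g n x - C)) \<longlonglongrightarrow> 0"
        by (intro tendsto_sandwich[OF always_eventually always_eventually tendsto_const, rule_format, OF _ le]) simp_all
    qed
    show "\<And>n. AE x in \<nu>. norm (max 0 (g n x - C)) \<le> k"
    proof (intro AE_I2)
      fix n x assume "x \<in> space \<nu>"
      from gb[OF this, of n] show "norm (max 0 (g n x - C)) \<le> k" using C k0 by (simp add: max_def)
    qed
  qed (auto simp: integrable_const)
  have "I - C \<le> (\<integral>x. max 0 (g n x - C) \<partial>\<nu>)" for n
  proof -
    have "I - C = (\<integral>x. g n x - C \<partial>\<nu>)" using gI[of n] gint[of n] by (simp add: prob_space)
    also have "\<dots> \<le> (\<integral>x. max 0 (g n x - C) \<partial>\<nu>)"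
    proof (rule integral_mono)
      show "integrable \<nu> (\<lambda>x. max 0 (g n x - C))" "integrable \<nu> (\<lambda>x. g n x - C)" using gint[of n] by auto
    qed simp
    finally show ?thesis .
  qed
  then have "I - C \<le> 0" using lim by (intro LIMSEQ_le_const[OF lim[simplified]]) auto
  then show ?thesis by simp
qed

text \<open>If \<open>P\<^sub>t \<phi>\<close> were not integrable, then its integral would be the junk value \<open>0\<close>, contradicting
  invariance for \<open>\<phi> \<ge> 1\<close>. So invariance alone gives measurability of \<open>P\<^sub>t \<phi>\<close>.\<close>

lemma invariant_measure_transition:
  fixes u :: "'h::topological_space \<Rightarrow> real \<Rightarrow> 'w \<Rightarrow> 'h"
  assumes "prob_space P" and inv: "invariant_measure (transition P u) \<nu>"
    and \<psi>: "\<psi> \<in> borel_measurable borel" "\<And>y. 0 \<le> \<psi> y" "\<And>y. \<psi> y \<le> k"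
    and u: "\<And>x. u x t \<in> borel_measurable P" and t: "t \<ge> 0"
  shows "(\<lambda>x. transition P u t \<psi> x) \<in> borel_measurable \<nu>"
    and "(\<integral>x. transition P u t \<psi> x \<partial>\<nu>) = (\<integral>x. \<psi> x \<partial>\<nu>)"
proof -
  interpret prob_space P by fact
  interpret N: prob_space \<nu> using inv by (simp add: invariant_measure_def)
  have sets: "sets \<nu> = sets borel" using inv by (simp add: invariant_measure_def)
  have bb: "\<psi> \<in> bounded_borel" "(\<lambda>y. \<psi> y + 1) \<in> bounded_borel"
  proof -
    have "bounded (range \<psi>)" "bounded (range (\<lambda>y. \<psi> y + 1))"
      using \<psi>(2,3) by (auto intro!: boundedI[of _ "k + 1"] simp: abs_of_nonneg add_nonneg_nonneg)
         (metis add.commute add_increasing zero_le_one)+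
    then show "\<psi> \<in> bounded_borel" "(\<lambda>y. \<psi> y + 1) \<in> bounded_borel" using \<psi>(1) by (auto simp: bounded_borel_def)
  qed
  have int: "integrable P (\<lambda>\<omega>. \<psi> (u x t \<omega>))" for x
    using measurable_compose[OF u \<psi>(1)] \<psi>(2,3) by (intro integrable_const_bound[where B = k]) auto
  have tr: "transition P u t (\<lambda>y. \<psi> y + 1) x = transition P u t \<psi> x + 1" for x
    using int by (simp add: transition_def prob_space)
  have \<psi>\<nu>: "\<psi> \<in> borel_measurable \<nu>" using \<psi>(1) sets by (simp cong: measurable_cong_sets)
  have "integrable \<nu> \<psi>" using \<psi>\<nu> \<psi>(2,3) by (intro N.integrable_const_bound[where B = k]) auto
  then have "(\<integral>x. \<psi> x + 1 \<partial>\<nu>) = (\<integral>x. \<psi> x \<partial>\<nu>) + 1" by (simp add: N.prob_space)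
  moreover have "0 \<le> (\<integral>x. \<psi> x \<partial>\<nu>)" using \<psi>(2) by simp
  moreover have "(\<integral>x. transition P u t (\<lambda>y. \<psi> y + 1) x \<partial>\<nu>) = (\<integral>x. \<psi> x + 1 \<partial>\<nu>)"
    using inv bb(2) t unfolding invariant_measure_def by blast
  ultimately have "(\<integral>x. transition P u t (\<lambda>y. \<psi> y + 1) x \<partial>\<nu>) \<noteq> 0" by simp
  then have "integrable \<nu> (\<lambda>x. transition P u t \<psi> x + 1)"
    unfolding tr using not_integrable_integral_eq by blast
  from borel_measurable_diff[OF borel_measurable_integrable[OF this] borel_measurable_const[of 1]]
  show "(\<lambda>x. transition P u t \<psi> x) \<in> borel_measurable \<nu>" by simp
  show "(\<integral>x. transition P u t \<psi> x \<partial>\<nu>) = (\<integral>x. \<psi> x \<partial>\<nu>)"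
    using inv bb(1) t unfolding invariant_measure_def by blast
qed

lemma nn_integral_le_if_truncations:
  fixes f :: "'a \<Rightarrow> real"
  assumes [measurable]: "f \<in> borel_measurable M" and f0: "\<And>x. 0 \<le> f x"
    and le: "\<And>k::nat. (\<integral>\<^sup>+x. ennreal (min (real k) (f x)) \<partial>M) \<le> c"
  shows "(\<integral>\<^sup>+x. ennreal (f x) \<partial>M) \<le> c"
proof -
  have sup: "(SUP k::nat. ennreal (min (real k) (f x))) = ennreal (f x)" for x
  proof (rule antisym)
    show "(SUP k::nat. ennreal (min (real k) (f x))) \<le> ennreal (f x)"
      by (intro SUP_least ennreal_leI) simp
    obtain k :: nat where "f x \<le> real k" using real_arch_simple by blast
    then show "ennreal (f x) \<le> (SUP k::nat. ennreal (min (real k) (f x)))"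
      by (intro SUP_upper2[of k]) simp_all
  qed
  have "(\<integral>\<^sup>+x. ennreal (f x) \<partial>M) = (SUP k::nat. \<integral>\<^sup>+x. ennreal (min (real k) (f x)) \<partial>M)"
    unfolding sup[symmetric]
    by (intro nn_integral_monotone_convergence_SUP) (auto simp: incseq_def le_fun_def intro!: ennreal_leI)
  also have "\<dots> \<le> c" by (intro SUP_least le)
  finally show ?thesis .
qed

theorem theorem2p6:
  fixes P :: "'w measure" and F :: "real \<Rightarrow> 'w measure"
    and m :: "'z measure" and \<mu> :: "'w \<Rightarrow> (real \<times> 'z) measure"
    and i :: "'v::banach \<Rightarrow> 'h::{real_inner, banach, second_countable_topology}"
    and A :: "'v \<Rightarrow> ('v \<Rightarrow>\<^sub>L real)" and G :: "'h \<Rightarrow> 'z \<Rightarrow> 'h"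
    and \<alpha>\<^sub>0 \<alpha>\<^sub>1 C\<^sub>0 C\<^sub>1 C\<^sub>2 p :: real
    and u :: "'h \<Rightarrow> real \<Rightarrow> 'w \<Rightarrow> 'h" and \<nu> :: "'h measure"
  assumes "prob_space P" and "usual_filtration P F"
    and "sigma_finite_measure m" and "poisson_random_measure P F m \<mu>"
    and "evolution_triple i" and "compact_map i"
    and "reflexive TYPE('v)"
    and "strictly_convex TYPE('v)" and "strictly_convex TYPE('v \<Rightarrow>\<^sub>L real)"
    and "(\<lambda>(x, z). G x z) \<in> borel_measurable (borel \<Otimes>\<^sub>M m)"
    and "\<And>x. integrable m (\<lambda>z. (norm (G x z))\<^sup>2)"
    and "demicontinuous A"
    and "\<alpha>\<^sub>0 \<ge> 0" and "\<alpha>\<^sub>1 > 0" and "C\<^sub>0 > 0" and "C\<^sub>1 > 0" and "p > 2"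
    and monotonicity: "\<And>x y. 2 * blinfun_apply (A x - A y) (x - y) - msq m (\<lambda>z. G (i x) z - G (i y) z) \<ge> 0"
    and coercivity: "\<And>x. 2 * blinfun_apply (A x) x - msq m (G (i x)) + \<alpha>\<^sub>0 * (norm (i x))\<^sup>2
                          \<ge> \<alpha>\<^sub>1 * norm x powr p - C\<^sub>0"
    and growth: "\<And>x. norm (A x) \<le> C\<^sub>1 * norm x powr (p - 1) + C\<^sub>2"
    and solution: "\<And>x. strong_solution P F m \<mu> i p A G x (u x)"
    and invariant: "invariant_measure (transition P u) \<nu>"
  shows "(\<integral>\<^sup>+x. (ennreal ((norm x)\<^sup>2) + Vnorm_powr i p x) \<partial>\<nu>) < \<infinity>"
proof -
  \<comment> \<open>All initial values are interpreted at once; \<open>x\<close> remains a parameter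
    of those facts that depend on it.\<close>
  interpret E: energy i A P F m \<mu> G p C\<^sub>1 C\<^sub>2 x "u x" for x
    by (intro energy.intro energy_axioms.intro triple_operator.intro triple_operator_axioms.intro
        reflexive_triple.intro prm.intro prm_axioms.intro assms)
  have \<nu>: "prob_space \<nu>" and sets\<nu>: "sets \<nu> = sets borel"
    using invariant by (auto simp: invariant_measure_def)
  obtain c where c: "c > 0" "\<And>v. norm (i v) \<le> norm v * c" using E.i.pos_bounded by blast
  \<comment> \<open>The embedding constant \<open>c\<close> bounds the norm of \<open>H\<close> by
    that of \<open>V\<close>, so the square can be compared with the power of the norm in
    \<open>V\<close>. Half of \<open>\<alpha>\<^sub>1\<close> is reserved for this.\<close>
  obtain C\<^sub>3 where C3: "C\<^sub>3 \<ge> 0" "\<And>a. a \<ge> 0 \<Longrightarrow> (\<alpha>\<^sub>0 + 1) * c\<^sup>2 * a\<^sup>2 \<le> \<alpha>\<^sub>1 / 2 * a powr p + C\<^sub>3"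
    using square_le_powr[of "(\<alpha>\<^sub>0 + 1) * c\<^sup>2" "\<alpha>\<^sub>1 / 2" p] \<open>\<alpha>\<^sub>0 \<ge> 0\<close> \<open>\<alpha>\<^sub>1 > 0\<close> \<open>p > 2\<close> by auto
  have absorb: "(\<alpha>\<^sub>0 + 1) * (norm (i v))\<^sup>2 \<le> \<alpha>\<^sub>1 / 2 * norm v powr p + C\<^sub>3" for v
  proof -
    have "(norm (i v))\<^sup>2 \<le> (norm v * c)\<^sup>2" using c(2) by (intro power_mono) auto
    then have "(\<alpha>\<^sub>0 + 1) * (norm (i v))\<^sup>2 \<le> (\<alpha>\<^sub>0 + 1) * (norm v * c)\<^sup>2"
      using \<open>\<alpha>\<^sub>0 \<ge> 0\<close> by (intro mult_left_mono) auto
    also have "\<dots> = (\<alpha>\<^sub>0 + 1) * c\<^sup>2 * (norm v)\<^sup>2" by (simp add: power_mult_distrib)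
    also have "\<dots> \<le> \<alpha>\<^sub>1 / 2 * norm v powr p + C\<^sub>3" by (rule C3(2)) simp
    finally show ?thesis .
  qed
  define d where "d = min 1 (\<alpha>\<^sub>1 / 2)"
  have d: "d > 0" using \<open>\<alpha>\<^sub>1 > 0\<close> by (simp add: d_def)
  define C where "C = (C\<^sub>0 + C\<^sub>3) / d"
  have C: "C \<ge> 0" using d \<open>C\<^sub>0 > 0\<close> C3(1) by (simp add: C_def)
  \<comment> \<open>The constant \<open>C\<close> is the same for all test functions and does not
    involve their bound \<open>k\<close>; hence the truncation can be removed afterwards.\<close>
  have bound: "(\<integral>x. \<psi> x \<partial>\<nu>) \<le> C"
    if cont: "continuous_on UNIV \<psi>" and \<psi>0: "\<And>y. 0 \<le> \<psi> y" and \<psi>k: "\<And>y. \<psi> y \<le> k"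
      and dom: "\<And>v. \<psi> (i v) \<le> (norm (i v))\<^sup>2 + norm v powr p" for \<psi> :: "'h \<Rightarrow> real" and k
  proof -
    have \<psi>: "\<psi> \<in> borel_measurable borel" using cont by (rule borel_measurable_continuous_onI)
    note tr = invariant_measure_transition[OF \<open>prob_space P\<close> invariant \<psi> \<psi>0 \<psi>k E.u_measurable]
    show ?thesis
    proof (rule prob_space_average_bound[OF \<nu>, where f = "\<lambda>t x. transition P u t \<psi> x" and k = k])
      show "(\<lambda>(x, t). transition P u (max 0 t) \<psi> x) \<in> borel_measurable (\<nu> \<Otimes>\<^sub>M lborel)"
      proof (rule right_cont_jointly_measurable)
        show "transition P u t \<psi> \<in> borel_measurable \<nu>" if "t \<ge> 0" for t using tr(1)[OF that that] .
        show "((\<lambda>s. transition P u s \<psi> x) \<longlongrightarrow> transition P u t \<psi> x) (at_right t)" if "t \<ge> 0" for x t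
          unfolding transition_def using cont \<psi>0 \<psi>k that by (rule E.transition_right_cont)
      qed
      fix t :: real and x assume t: "t \<ge> 0"
      have i: "integrable P (\<lambda>\<omega>. \<psi> (u x t \<omega>))"
        using measurable_compose[OF E.u_measurable[OF t] \<psi>] \<psi>0 \<psi>k by (intro E.integrable_const_bound[where B = k]) auto
      show "0 \<le> transition P u t \<psi> x" unfolding transition_def using \<psi>0 by simp
      have "transition P u t \<psi> x \<le> E.expectation (\<lambda>\<omega>. k)"
        unfolding transition_def using i \<psi>k by (intro integral_mono) auto
      then show "transition P u t \<psi> x \<le> k" by (simp add: E.prob_space)
      show "(\<integral>x. transition P u t \<psi> x \<partial>\<nu>) = (\<integral>x. \<psi> x \<partial>\<nu>)" using tr(2)[OF t t] .
    next
      fix x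
      show "\<exists>K. \<forall>T\<ge>0. (\<integral>t. indicator {0..T} t * transition P u (max 0 t) \<psi> x \<partial>lborel) \<le> K + C * T"
      proof (intro exI[of _ "E.KS x 2 / d"] allI impI)
        have eq: "(a + b * T) / d = a / d + b / d * T" for a b T :: real
          by (simp add: add_divide_distrib)
        fix T :: real assume "T \<ge> 0"
        from E.time_average[OF coercivity absorb \<open>\<alpha>\<^sub>1 > 0\<close> \<psi> \<psi>0 \<psi>k dom this, of x]
        show "(\<integral>t. indicator {0..T} t * transition P u (max 0 t) \<psi> x \<partial>lborel) \<le> E.KS x 2 / d + C * T"
          unfolding transition_def d_def[symmetric] C_def eq .
      qed
    qed (rule C)
  qed
  define f where "f n x = (norm x)\<^sup>2 + E.vgauge n x powr p" for n and x :: 'h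
  have f0: "0 \<le> f n x" for n x by (simp add: f_def)
  have fcont: "continuous_on UNIV (f n)" for n
    unfolding f_def using E.continuous_vgauge E.vgauge_nonneg \<open>p > 2\<close>
    by (intro continuous_intros continuous_on_powr') auto
  have fm [measurable]: "f n \<in> borel_measurable \<nu>" for n
    using borel_measurable_continuous_onI[OF fcont, of n] sets\<nu> by (simp cong: measurable_cong_sets)
  have fle: "(\<integral>\<^sup>+x. ennreal (f n x) \<partial>\<nu>) \<le> ennreal C" for n
  \<comment> \<open>\<open>f n\<close> is continuous on \<open>H\<close> but unbounded, so its
    truncations at \<open>k\<close> serve as test functions; the gauge keeps them below the required
    majorant on \<open>V\<close>.\<close>
  proof (rule nn_integral_le_if_truncations[OF fm f0])
    fix k :: nat
    have dom: "min (real k) (f n (i v)) \<le> (norm (i v))\<^sup>2 + norm v powr p" for v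
    proof -
      have "E.vgauge n (i v) powr p \<le> norm v powr p"
        using E.vgauge_le_norm E.vgauge_nonneg \<open>p > 2\<close> by (intro powr_mono2) auto
      then show ?thesis by (simp add: f_def min_le_iff_disj)
    qed
    have int: "integrable \<nu> (\<lambda>x. min (real k) (f n x))"
      using f0 by (intro finite_measure.integrable_const_bound[OF prob_space.finite_measure[OF \<nu>], where B = "real k"]) auto
    have "(\<integral>x. min (real k) (f n x) \<partial>\<nu>) \<le> C"
      using f0 dom by (intro bound[of "\<lambda>x. min (real k) (f n x)" "real k"] continuous_intros fcont) auto
    then show "(\<integral>\<^sup>+x. ennreal (min (real k) (f n x)) \<partial>\<nu>) \<le> ennreal C"
      using int f0 by (subst nn_integral_eq_integral) (auto intro: ennreal_leI)
  qed
  have sup: "ennreal ((norm x)\<^sup>2) + Vnorm_powr i p x = (SUP n. ennreal (f n x))" for x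
  proof -
    have "ennreal ((norm x)\<^sup>2) + Vnorm_powr i p x = ennreal ((norm x)\<^sup>2) + (SUP n. ennreal (E.vgauge n x powr p))"
      using \<open>p > 2\<close> by (simp add: E.Vnorm_powr_SUP)
    also have "\<dots> = (SUP n. ennreal ((norm x)\<^sup>2) + ennreal (E.vgauge n x powr p))"
      by (rule ennreal_SUP_add_right) simp
    finally show ?thesis by (simp add: f_def)
  qed
  have "(\<integral>\<^sup>+x. (ennreal ((norm x)\<^sup>2) + Vnorm_powr i p x) \<partial>\<nu>) = (SUP n. \<integral>\<^sup>+x. ennreal (f n x) \<partial>\<nu>)"
    unfolding sup
  proof (rule nn_integral_monotone_convergence_SUP)
    show "incseq (\<lambda>n x. ennreal (f n x))"
      unfolding incseq_def le_fun_def f_def using E.vgauge_mono E.vgauge_nonneg \<open>p > 2\<close>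
      by (auto intro!: ennreal_leI powr_mono2)
  qed measurable
  also have "\<dots> \<le> ennreal C" by (intro SUP_least fle)
  finally show ?thesis by (simp add: le_less_trans)
qed

end
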